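(* Let $p\in[1,\infty)$, $I=[0,1]$, $0=x_0<x_1<\dots<x_N=1$, $u_i(x)=a_ix+b_i$ ($i\in\mathbb{N}_N$) affine with $u_i(0)=x_{i-1}$, $u_i(1)=x_i$, and $\alpha_i\in L^\infty(I)$ with $\Lambda:=\left(\sum_{i=1}^Na_i\|\alpha_i\|_\infty^p\right)^{1/p}<1$. For $f\in L^p(I)$ let $f^\alpha_n\in L^p(I)$ be the unique solution of $f^\alpha_n=f+\sum_{i=1}^N(\alpha_i\circ u_i^{-1})((f^\alpha_n-\widehat M_nf)\circ u_i^{-1})\chi_{u_i(I)}$. Then $f^\alpha_n\to f$ in $L^p(I)$ as $n\to\infty$, and \[ \|f^\alpha_n-f\|_p\le C\,\frac{\Lambda}{1-\Lambda}\,\omega_{1,p}\!\left(f,\frac1{\sqrt n}\right), \] where $C>0$ is a constant independent of $f$ and $p$.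
   Context: The integral MKZ operator is $\widehat M_nf(x)=\int_0^1H_n(x,s)f(s)\,ds$, where $H_n(x,s)=\sum_{k=0}^\infty\widehat m_{nk}(x)\chi_{I_k}(s)$, $\widehat m_{nk}(x)=(n+1)\binom{k+n+1}{k}x^k(1-x)^n$, $I_k=\left[\frac{k}{k+n},\frac{k+1}{k+n+1}\right]$. $\omega_{1,p}(f,t)=\sup_{0<h\le t}\|f(\cdot+h)-f(\cdot)\|_{p,[0,1-h]}$, where $\|\cdot\|_{p,[0,1-h]}$ is the $L^p$ norm over $[0,1-h]$. *)

theory Defs
  imports "HOL-Analysis.Analysis" "HOL-Probability.Essential_Supremum"
begin

definition memLp :: "real \<Rightarrow> real set \<Rightarrow> (real \<Rightarrow> real) \<Rightarrow> bool" where
  "memLp p A f \<longleftrightarrow> f \<in> borel_measurable (lebesgue_on A) \<and>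
     integrable (lebesgue_on A) (\<lambda>x. \<bar>f x\<bar> powr p)"

definition Lpnorm :: "real \<Rightarrow> real set \<Rightarrow> (real \<Rightarrow> real) \<Rightarrow> real" where
  "Lpnorm p A f = (integral\<^sup>L (lebesgue_on A) (\<lambda>x. \<bar>f x\<bar> powr p)) powr (1 / p)"

definition memLinf :: "real set \<Rightarrow> (real \<Rightarrow> real) \<Rightarrow> bool" where
  "memLinf A f \<longleftrightarrow> f \<in> borel_measurable (lebesgue_on A) \<and>
     esssup (lebesgue_on A) (\<lambda>x. ereal \<bar>f x\<bar>) < \<infinity>"

definition Linfnorm :: "real set \<Rightarrow> (real \<Rightarrow> real) \<Rightarrow> real" where
  "Linfnorm A f = real_of_ereal (esssup (lebesgue_on A) (\<lambda>x. ereal \<bar>f x\<bar>))"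

definition mhat :: "nat \<Rightarrow> nat \<Rightarrow> real \<Rightarrow> real" where
  "mhat n k x = real (n + 1) * real ((k + n + 1) choose k) * x ^ k * (1 - x) ^ n"

definition Ik :: "nat \<Rightarrow> nat \<Rightarrow> real set" where
  "Ik n k = {real k / real (k + n) .. real (k + 1) / real (k + n + 1)}"

definition Hker :: "nat \<Rightarrow> real \<Rightarrow> real \<Rightarrow> real" where
  "Hker n x s = (\<Sum>k. mhat n k x * indicator (Ik n k) s)"

definition MKZ :: "nat \<Rightarrow> (real \<Rightarrow> real) \<Rightarrow> real \<Rightarrow> real" where
  "MKZ n f x = integral\<^sup>L (lebesgue_on {0..1}) (\<lambda>s. Hker n x s * f s)"

definition omega1p :: "real \<Rightarrow> (real \<Rightarrow> real) \<Rightarrow> real \<Rightarrow> real" where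
  "omega1p p f t = (SUP h\<in>{0<..t}. Lpnorm p {0..1 - h} (\<lambda>x. f (x + h) - f x))"

end

(* The kernel H of the operator has total mass 1 in s and total mass at most 2 in x, and both second
   moments of s - x under it are at most 4/n. Replace f by the step function S f of its means over
   m = ceiling (2 sqrt n) cells of length 1/m. Comparing f with S f, and consecutive cell means with
   each other, costs only averages of the translation differences of f, hence multiples of the
   modulus w at 1/sqrt n. For the step function, M S f - S f is at most the sum over the grid points t of
   |jump at t| * (H-mass of the s separated from x by t). The sum of these masses over t is bounded
   because m E|s - x| is, and the integral of each over x is O(1/sqrt n), because the indicator that t
   separates x from s is at most (1 + n (s - x)^2)/(1 + n (s - t)^2); Schur's test then gives a constant that does not depend on p.
   Finally the fixed point equation contracts: |g - f|_p <= Lambda |g - M f|_p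
   <= Lambda (|g - f|_p + |f - M f|_p). *)
theory Submission
  imports Defs "HOL-Probability.Probability"
begin

section \<open>Power means and the triangle inequality\<close>

text \<open>The constant must serve all p >= 1 at once. Comparing f with a smooth function and
  bounding the error by a maximal function of its derivative breaks down at p = 1 and has constants
  that depend on p. For a step function the error is a finite sum of jumps with nonnegative weights,
  to which the power mean inequality applies: the total weight at a fixed x (at most 9) enters with
  exponent p - 1, the x-integral of each single weight (at most 24 / sqrt n) enters once, so no
  constant exceeds the p-th power of a fixed number. The mesh is constrained from both sides: 2 / m
  <= 1 / sqrt n keeps points of equal or neighbouring cells within reach of the modulus, and m <= 3
  sqrt n keeps the number of crossed grid points bounded on average. The moments in s come from
  negative binomial distributions, those in x from Beta densities. Most estimates are stated for
  nonnegative integrals and p-th powers of bounds, because \<open>Lpnorm\<close> silently returns 0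
  where the integral is infinite. The final constant is 300 = 8 + 288 + 4.\<close>

lemma powr_add_div_le:
  fixes p y :: real
  assumes "1 \<le> p" "0 \<le> y"
  shows "y \<le> y powr p / p + (1 - 1 / p)"
proof (cases "p = 1")
  case False
  \<comment> \<open>Young's inequality with 1 as second factor, which is the tangent of
    \<open>y powr p / p\<close> at \<open>y = 1\<close>.\<close>
  then have "y * 1 \<le> y powr p / p + 1 powr (p / (p - 1)) / (p / (p - 1))"
    using assms by (intro Youngs_inequality) (auto simp: field_simps)
  also have "1 powr (p / (p - 1)) / (p / (p - 1)) = 1 - 1 / p"
    using assms by (simp add: field_simps)
  finally show ?thesis by simp
qed (use assms in auto)

text \<open>Jensen's inequality from a single tangent: after division by the combination
  \<open>z\<close>, the weighted mean of \<open>u / z\<close> and \<open>v / z\<close> is 1, the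
  point of tangency in \<open>powr_add_div_le\<close>.\<close>

lemma powr_convex_combination:
  fixes p u v t :: real
  assumes p: "1 \<le> p" and uv: "0 \<le> u" "0 \<le> v" and t: "0 \<le> t" "t \<le> 1"
  shows "((1 - t) * u + t * v) powr p \<le> (1 - t) * u powr p + t * v powr p"
proof -
  define z where "z = (1 - t) * u + t * v"
  have z: "0 \<le> z" using uv t by (simp add: z_def)
  show ?thesis
  proof (cases "z = 0")
    case True
    then show ?thesis using assms by (simp add: z_def[symmetric])
  next
    case False
    with z have z: "0 < z" by simp
    have "1 = (1 - t) * (u / z) + t * (v / z)"
      using z by (simp add: add_divide_distrib[symmetric] z_def[symmetric])
    also have "\<dots> \<le> (1 - t) * ((u / z) powr p / p + (1 - 1 / p)) + t * ((v / z) powr p / p + (1 - 1 / p))"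
      using assms z by (intro add_mono mult_left_mono powr_add_div_le) auto
    also have "\<dots> = ((1 - t) * u powr p + t * v powr p) / z powr p / p + (1 - 1 / p)"
      using z uv p by (simp add: powr_divide field_simps)
    finally have "1 / p \<le> ((1 - t) * u powr p + t * v powr p) / z powr p / p"
      by simp
    then have "1 \<le> ((1 - t) * u powr p + t * v powr p) / z powr p"
      using p by (subst (asm) divide_le_cancel) auto
    then have "z powr p \<le> (1 - t) * u powr p + t * v powr p"
      using z by (simp add: field_simps)
    then show ?thesis by (simp only: z_def)
  qed
qed

text \<open>The tangent bound, rescaled to height \<open>B\<close> and integrated against
  \<open>w\<close>. Choosing \<open>B\<close> from the p-th moment turns this into the weighted
  power mean inequality; the rescaling requires \<open>B > 0\<close>.\<close>

lemma nn_integral_power_mean_aux: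
  assumes [measurable]: "w \<in> borel_measurable M" "f \<in> borel_measurable M"
    and p: "1 \<le> p" and f: "\<And>x. 0 \<le> f x"
    and W: "(\<integral>\<^sup>+x. w x \<partial>M) \<le> ennreal W" and B: "0 < B" "0 \<le> W"
    and le: "(\<integral>\<^sup>+x. w x * ennreal (f x powr p) \<partial>M) \<le> ennreal (W * B powr p)"
  shows "(\<integral>\<^sup>+x. w x * ennreal (f x) \<partial>M) \<le> ennreal (W * B)"
proof -
  have pt: "f x \<le> B powr (1 - p) / p * f x powr p + (1 - 1 / p) * B" for x
  proof -
    have "f x / B \<le> (f x / B) powr p / p + (1 - 1 / p)"
      using powr_add_div_le[of p "f x / B"] p f[of x] B by simp
    then have "f x \<le> B * ((f x / B) powr p / p + (1 - 1 / p))"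
      using B by (simp add: field_simps)
    also have "\<dots> = B powr (1 - p) / p * f x powr p + (1 - 1 / p) * B"
      using B f[of x] p by (simp add: powr_divide powr_diff field_simps)
    finally show ?thesis .
  qed
  have "(\<integral>\<^sup>+x. w x * ennreal (f x) \<partial>M)
      \<le> (\<integral>\<^sup>+x. ennreal (B powr (1 - p) / p) * (w x * ennreal (f x powr p)) + ennreal ((1 - 1 / p) * B) * w x \<partial>M)"
  proof (intro nn_integral_mono)
    fix x
    have "w x * ennreal (f x) \<le> w x * ennreal (B powr (1 - p) / p * f x powr p + (1 - 1 / p) * B)"
      by (intro mult_left_mono ennreal_leI pt) auto
    also have "ennreal (B powr (1 - p) / p * f x powr p + (1 - 1 / p) * B)
        = ennreal (B powr (1 - p) / p) * ennreal (f x powr p) + ennreal ((1 - 1 / p) * B)"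
      using p B by (subst ennreal_plus, simp, simp, subst ennreal_mult) auto
    also have "w x * \<dots> = ennreal (B powr (1 - p) / p) * (w x * ennreal (f x powr p)) + ennreal ((1 - 1 / p) * B) * w x"
      by (simp only: distrib_left ac_simps)
    finally show "w x * ennreal (f x) \<le> \<dots>" .
  qed
  also have "\<dots> = ennreal (B powr (1 - p) / p) * (\<integral>\<^sup>+x. w x * ennreal (f x powr p) \<partial>M)
      + ennreal ((1 - 1 / p) * B) * (\<integral>\<^sup>+x. w x \<partial>M)"
    by (simp add: nn_integral_add nn_integral_cmult)
  also have "\<dots> \<le> ennreal (B powr (1 - p) / p) * ennreal (W * B powr p) + ennreal ((1 - 1 / p) * B) * ennreal W"
    by (intro add_mono mult_left_mono le W) auto
  also have "\<dots> = ennreal (B powr (1 - p) / p * (W * B powr p) + (1 - 1 / p) * B * W)"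
    using p B by (simp flip: ennreal_plus ennreal_mult)
  also have "B powr (1 - p) / p * (W * B powr p) + (1 - 1 / p) * B * W = W * B"
    using p B by (simp add: powr_diff field_simps)
  finally show ?thesis .
qed

text \<open>An infinite left integral is no obstacle: \<open>enn2real\<close> sends it to 0, just as the Bochner integral
  of a function that is not integrable is 0.\<close>
lemma nn_integral_power_mean:
  assumes [measurable]: "w \<in> borel_measurable M" "f \<in> borel_measurable M"
    and p: "1 \<le> p" and f: "\<And>x. 0 \<le> f x"
    and W: "(\<integral>\<^sup>+x. w x \<partial>M) \<le> ennreal W" "0 < W"
  shows "ennreal (enn2real (\<integral>\<^sup>+x. w x * ennreal (f x) \<partial>M) powr p)
      \<le> ennreal (W powr (p - 1)) * (\<integral>\<^sup>+x. w x * ennreal (f x powr p) \<partial>M)" (is "?L \<le> ennreal _ * ?R")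
proof (cases "?R = \<infinity>")
  case True
  then show ?thesis using W by (simp add: ennreal_mult_top)
next
  case False
  then obtain r where r: "?R = ennreal r" "0 \<le> r" by (cases ?R) auto
  \<comment> \<open>\<open>B\<close> is the p-th mean, raised by \<open>e\<close> so that it is
    positive even if \<open>r = 0\<close>; afterwards \<open>e\<close> tends to 0.\<close>
  have *: "enn2real (\<integral>\<^sup>+x. w x * ennreal (f x) \<partial>M) \<le> W * ((r + e) / W) powr (1 / p)" if "0 < e" for e
  proof -
    have "(\<integral>\<^sup>+x. w x * ennreal (f x) \<partial>M) \<le> ennreal (W * (((r + e) / W) powr (1 / p)))"
    proof (rule nn_integral_power_mean_aux)
      show "?R \<le> ennreal (W * (((r + e) / W) powr (1 / p)) powr p)"
        using r that W p by (simp add: powr_powr ennreal_leI)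
    qed (use assms r that in auto)
    then show ?thesis
      using W by (intro enn2real_leI) auto
  qed
  have "((\<lambda>e. W * ((r + e) / W) powr (1 / p)) \<longlongrightarrow> W * ((r + 0) / W) powr (1 / p)) (at_right 0)"
    using p W by (intro tendsto_intros) (auto intro!: eventually_at_rightI[of 0 1] simp: r)
  then have "enn2real (\<integral>\<^sup>+x. w x * ennreal (f x) \<partial>M) \<le> W * (r / W) powr (1 / p)"
    by (intro tendsto_lowerbound[where F="at_right 0"])
       (auto intro!: eventually_at_rightI[of 0 1] *)
  then have "enn2real (\<integral>\<^sup>+x. w x * ennreal (f x) \<partial>M) powr p \<le> (W * (r / W) powr (1 / p)) powr p"
    using p by (intro powr_mono2) auto
  also have "\<dots> = W powr (p - 1) * r"
    using p W r by (simp add: powr_mult powr_powr powr_diff)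
  finally show ?thesis
    using r by (simp add: ennreal_mult[symmetric] ennreal_leI)
qed

text \<open>Minkowski's inequality by convexity: |f + g| is at most C + D times a convex combination
  of |f| / C and |g| / D. Bounds \<open>c\<close> and \<open>d\<close> in place of norms avoid
  integrability side conditions.\<close>

lemma Lp_triangle:
  assumes [measurable]: "f \<in> borel_measurable M" "g \<in> borel_measurable M"
    and p: "1 \<le> p" and cd: "0 \<le> c" "0 \<le> d"
    and f: "(\<integral>\<^sup>+x. ennreal (\<bar>f x\<bar> powr p) \<partial>M) \<le> ennreal (c powr p)"
    and g: "(\<integral>\<^sup>+x. ennreal (\<bar>g x\<bar> powr p) \<partial>M) \<le> ennreal (d powr p)"
  shows "(\<integral>\<^sup>+x. ennreal (\<bar>f x + g x\<bar> powr p) \<partial>M) \<le> ennreal ((c + d) powr p)"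
proof -
  have *: "(\<integral>\<^sup>+x. ennreal (\<bar>f x + g x\<bar> powr p) \<partial>M) \<le> ennreal ((c + d + 2 * e) powr p)" if "0 < e" for e
  proof -
    \<comment> \<open>The margin \<open>e\<close> permits division when \<open>c\<close> or
      \<open>d\<close> is 0.\<close>
    define C D where "C = c + e" and "D = d + e"
    have CD: "0 < C" "0 < D" using cd that by (auto simp: C_def D_def)
    have "(\<integral>\<^sup>+x. ennreal (\<bar>f x + g x\<bar> powr p) \<partial>M) \<le>
      (\<integral>\<^sup>+x. ennreal ((C + D) powr (p - 1) * C powr (1 - p)) * ennreal (\<bar>f x\<bar> powr p)
       + ennreal ((C + D) powr (p - 1) * D powr (1 - p)) * ennreal (\<bar>g x\<bar> powr p) \<partial>M)"
    proof (intro nn_integral_mono)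
      fix x
      define u v where "u = \<bar>f x\<bar> / C" and "v = \<bar>g x\<bar> / D"
      have uv: "0 \<le> u" "0 \<le> v" using CD by (auto simp: u_def v_def)
      have "\<bar>f x + g x\<bar> \<le> C * u + D * v"
        using CD by (simp add: u_def v_def)
      also have "\<dots> = (C + D) * (C / (C + D) * u + D / (C + D) * v)"
        using CD by (simp add: distrib_left)
      finally have "\<bar>f x + g x\<bar> powr p \<le> ((C + D) * (C / (C + D) * u + D / (C + D) * v)) powr p"
        using p by (intro powr_mono2) auto
      also have "\<dots> = (C + D) powr p * (C / (C + D) * u + D / (C + D) * v) powr p"
        by (rule powr_mult)
      also have "\<dots> \<le> (C + D) powr p * (C / (C + D) * u powr p + D / (C + D) * v powr p)"
      proof (intro mult_left_mono)
        have "((1 - D / (C + D)) * u + D / (C + D) * v) powr p \<le> (1 - D / (C + D)) * u powr p + D / (C + D) * v powr p"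
          using CD uv p by (intro powr_convex_combination) auto
        moreover have "1 - D / (C + D) = C / (C + D)" using CD by (simp add: field_simps)
        ultimately show "(C / (C + D) * u + D / (C + D) * v) powr p \<le> C / (C + D) * u powr p + D / (C + D) * v powr p"
          by simp
      qed simp
      also have "\<dots> = (C + D) powr (p - 1) * C powr (1 - p) * \<bar>f x\<bar> powr p + (C + D) powr (p - 1) * D powr (1 - p) * \<bar>g x\<bar> powr p"
        using CD by (simp add: u_def v_def powr_divide powr_diff field_simps)
      finally show "ennreal (\<bar>f x + g x\<bar> powr p) \<le> ennreal ((C + D) powr (p - 1) * C powr (1 - p)) * ennreal (\<bar>f x\<bar> powr p)
       + ennreal ((C + D) powr (p - 1) * D powr (1 - p)) * ennreal (\<bar>g x\<bar> powr p)"
        by (simp flip: ennreal_mult ennreal_plus add: ennreal_leI)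
    qed
    also have "\<dots> = ennreal ((C + D) powr (p - 1) * C powr (1 - p)) * (\<integral>\<^sup>+x. ennreal (\<bar>f x\<bar> powr p) \<partial>M)
       + ennreal ((C + D) powr (p - 1) * D powr (1 - p)) * (\<integral>\<^sup>+x. ennreal (\<bar>g x\<bar> powr p) \<partial>M)"
      by (simp add: nn_integral_add nn_integral_cmult)
    also have "\<dots> \<le> ennreal ((C + D) powr (p - 1) * C powr (1 - p)) * ennreal (C powr p)
       + ennreal ((C + D) powr (p - 1) * D powr (1 - p)) * ennreal (D powr p)"
      using p cd that by (intro add_mono mult_left_mono order_trans[OF f] order_trans[OF g] ennreal_leI powr_mono2)
         (auto simp: C_def D_def)
    also have "\<dots> = ennreal ((C + D) powr p)"
    proof -
      have "C powr (1 - p) * C powr p = C" "D powr (1 - p) * D powr p = D" "(C + D) powr (p - 1) * (C + D) = (C + D) powr p"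
        using CD by (simp_all flip: powr_add add: powr_diff)
      then show ?thesis
        using CD by (simp flip: ennreal_mult ennreal_plus add: mult.assoc) (simp flip: distrib_left)
    qed
    finally show ?thesis by (simp add: C_def D_def add_ac)
  qed
  have lim: "((\<lambda>e. ennreal ((c + d + 2 * e) powr p)) \<longlongrightarrow> ennreal ((c + d + 2 * 0) powr p)) (at_right 0)"
    using p cd by (intro tendsto_intros) (auto intro!: eventually_at_rightI[of 0 1])
  have "(\<integral>\<^sup>+x. ennreal (\<bar>f x + g x\<bar> powr p) \<partial>M) \<le> ennreal ((c + d + 2 * 0) powr p)"
    using * by (intro tendsto_lowerbound[OF lim] eventually_at_rightI[of 0 1]) auto
  then show ?thesis by simp
qed

section \<open>The kernel of the integral MKZ operator\<close>

text \<open>The half-open interval leaves out the point 1, where the negative binomial weights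
  degenerate and \<open>cell_index\<close> would reach \<open>m\<close>. Being a density on the
  whole line, the measure has the plain Borel sets as its sigma-algebra.\<close>

definition unit_measure :: "real measure" ("\<U>")
  where "\<U> = density lborel (indicator {0..<1})"

lemma sets_unit_measure [measurable_cong, simp]: "sets \<U> = sets borel"
  by (simp add: unit_measure_def)

lemma space_unit_measure [simp]: "space \<U> = UNIV"
  by (simp add: unit_measure_def)

lemma nn_integral_unit_measure:
  "f \<in> borel_measurable borel \<Longrightarrow> (\<integral>\<^sup>+x. f x \<partial>\<U>) = (\<integral>\<^sup>+x. f x * indicator {0..<1} x \<partial>lborel)"
  by (simp add: unit_measure_def nn_integral_density mult.commute)

lemma AE_unit_measureI: "(\<And>x. 0 \<le> x \<Longrightarrow> x < 1 \<Longrightarrow> P x) \<Longrightarrow> AE x in \<U>. P x"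
  unfolding unit_measure_def by (subst AE_density) (auto intro!: AE_I2 simp: indicator_def split: if_splits)

lemma emeasure_unit_measure: "A \<in> sets borel \<Longrightarrow> emeasure \<U> A = emeasure lborel ({0..<1} \<inter> A)"
  by (simp add: unit_measure_def emeasure_density indicator_inter_arith[symmetric])

interpretation unit_measure: prob_space \<U>
  by standard (simp add: emeasure_unit_measure)

interpretation unit_measure2: pair_sigma_finite \<U> \<U> ..

lemma nn_integral_unit_mono:
  "(\<And>x. 0 \<le> x \<Longrightarrow> x < 1 \<Longrightarrow> f x \<le> g x) \<Longrightarrow> (\<integral>\<^sup>+x. f x \<partial>\<U>) \<le> (\<integral>\<^sup>+x. g x \<partial>\<U>)"
  by (intro nn_integral_mono_AE AE_unit_measureI)

lemma nn_integral_unit_cong: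
  "(\<And>x. 0 \<le> x \<Longrightarrow> x < 1 \<Longrightarrow> f x = g x) \<Longrightarrow> (\<integral>\<^sup>+x. f x \<partial>\<U>) = (\<integral>\<^sup>+x. g x \<partial>\<U>)"
  by (intro nn_integral_cong_AE AE_unit_measureI)

text \<open>\<open>Hker\<close> with values in \<open>ennreal\<close>: sums and integrals
  interchange without summability conditions, and negative values of \<open>mhat\<close> outside the
  unit interval are cut off to 0.\<close>

definition mkz_kernel :: "nat \<Rightarrow> real \<Rightarrow> real \<Rightarrow> ennreal"
  where "mkz_kernel n x s = (\<Sum>k. ennreal (mhat n k x) * indicator (Ik n k) s)"

lemma mhat_measurable [measurable]: "mhat n k \<in> borel_measurable borel"
  unfolding mhat_def[abs_def] by measurable

lemma Ik_measurable [measurable, simp]: "Ik n k \<in> sets borel"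
  unfolding Ik_def by measurable

lemma mkz_kernel_measurable [measurable (raw)]:
  assumes [measurable]: "f \<in> borel_measurable M" "g \<in> borel_measurable M"
  shows "(\<lambda>z. mkz_kernel n (f z) (g z)) \<in> borel_measurable M"
  unfolding mkz_kernel_def by measurable

lemma mhat_nonneg: "0 \<le> x \<Longrightarrow> x \<le> 1 \<Longrightarrow> 0 \<le> mhat n k x"
  by (simp add: mhat_def)

lemma Ik_subset: "1 \<le> n \<Longrightarrow> Ik n k \<subseteq> {0..<1}"
proof
  fix s assume n: "1 \<le> n" and s: "s \<in> Ik n k"
  have "0 \<le> real k / real (k + n)" by simp
  also have "\<dots> \<le> s" using s by (simp add: Ik_def)
  finally have "0 \<le> s" .
  have "s \<le> real (k + 1) / real (k + n + 1)" using s by (simp add: Ik_def)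
  also have "\<dots> < 1" using n by simp
  finally show "s \<in> {0..<1}" using \<open>0 \<le> s\<close> by simp
qed

lemma emeasure_Ik:
  assumes "1 \<le> n"
  shows "emeasure \<U> (Ik n k) = ennreal (real n / (real (k + n) * real (k + n + 1)))"
proof -
  have "emeasure \<U> (Ik n k) = emeasure lborel (Ik n k)"
    using Ik_subset[OF assms, of k] by (simp add: emeasure_unit_measure Int_absorb1)
  also have "real k / real (k + n) \<le> real (k + 1) / real (k + n + 1)"
    using assms by (simp add: field_simps)
  then have "emeasure lborel (Ik n k) = ennreal (real (k + 1) / real (k + n + 1) - real k / real (k + n))"
    by (simp add: Ik_def)
  also have "real (k + 1) / real (k + n + 1) - real k / real (k + n) = real n / (real (k + n) * real (k + n + 1))"
    using assms by (simp add: divide_simps) (simp add: algebra_simps)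
  finally show ?thesis .
qed

text \<open>\<open>y = n s / (1 - s)\<close> inverts \<open>k / (k + n)\<close>, so membership means
  \<open>k <= y <= k + 1\<close>: \<open>k\<close> is the floor of \<open>y\<close>, or one less
  when \<open>y\<close> is an integer.\<close>

lemma mem_Ik_index:
  assumes n: "1 \<le> n" and s: "0 \<le> s" "s < 1" and mem: "s \<in> Ik n k"
  defines "l \<equiv> nat \<lfloor>real n * s / (1 - s)\<rfloor>"
  shows "k \<in> {l - 1, l}"
proof -
  define y where "y = real n * s / (1 - s)"
  have y: "0 \<le> y" using s by (simp add: y_def)
  have "real k / real (k + n) \<le> s" "s \<le> real (k + 1) / real (k + n + 1)"
    using mem by (auto simp: Ik_def)
  then have "real k \<le> y" "y \<le> real k + 1"
    using n s by (auto simp: y_def field_simps)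
  then show ?thesis using y by (auto simp: l_def y_def[symmetric]) linarith
qed

text \<open>Neighbouring closed intervals share an end point, hence 2 and not 1. The bound holds at
  every \<open>s\<close>, so no null set has to be carried along.\<close>

lemma sum_indicator_Ik_le:
  assumes n: "1 \<le> n" and s: "0 \<le> s" "s < 1"
  shows "(\<Sum>k. indicator (Ik n k) s :: ennreal) \<le> 2"
proof -
  define l where "l = nat \<lfloor>real n * s / (1 - s)\<rfloor>"
  have "k \<in> {l - 1, l}" if "s \<in> Ik n k" for k
    using mem_Ik_index[OF n s that] by (simp add: l_def)
  then have "(\<Sum>k. indicator (Ik n k) s :: ennreal) = (\<Sum>k\<in>{l - 1, l}. indicator (Ik n k) s)"
    by (intro suminf_finite) (auto simp: indicator_def)
  also have "\<dots> \<le> (\<Sum>k\<in>{l - 1, l}. 1)"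
    by (intro sum_mono) (auto simp: indicator_def)
  also have "\<dots> = ennreal (real (card {l - 1, l}))"
    by (simp add: ennreal_of_nat_eq_real_of_nat)
  also have "\<dots> \<le> ennreal 2"
    by (intro ennreal_leI) (auto simp: card_insert_if)
  finally show ?thesis by simp
qed

section \<open>Moments in \<open>s\<close>: the negative binomial distribution with success
  probability 1 - x\<close>

definition nbin :: "nat \<Rightarrow> real \<Rightarrow> nat \<Rightarrow> real"
  where "nbin n x k = real ((k + n - 1) choose k) * x ^ k * (1 - x) ^ n"

lemma nbin_nonneg: "0 \<le> x \<Longrightarrow> x \<le> 1 \<Longrightarrow> 0 \<le> nbin n x k"
  by (simp add: nbin_def)

lemma nbin_sums:
  assumes "0 \<le> x" "x < 1"
  shows "nbin n x sums 1"
proof -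
  have eq: "nbin n x k = pmf (neg_binomial_pmf n (1 - x)) k" for k
    using assms by (subst pmf_neg_binomial) (auto simp: nbin_def)
  have "(\<Sum>k. ennreal (nbin n x k)) = 1"
    unfolding eq nn_integral_count_space_nat[symmetric] by (simp add: nn_integral_pmf_eq_1)
  moreover have "summable (nbin n x)"
    using calculation nbin_nonneg[of x n] assms by (intro summable_suminf_not_top) auto
  moreover have "ennreal (suminf (nbin n x)) = (\<Sum>k. ennreal (nbin n x k))"
    using calculation(2) nbin_nonneg[of x n] assms by (intro suminf_ennreal2[symmetric]) auto
  ultimately have "ennreal (suminf (nbin n x)) = ennreal 1" "0 \<le> suminf (nbin n x)"
    using nbin_nonneg[of x n] assms by (auto intro!: suminf_nonneg)
  then have "suminf (nbin n x) = 1"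
    by (subst (asm) ennreal_inj) auto
  with \<open>summable (nbin n x)\<close> show ?thesis by (simp add: sums_iff)
qed

text \<open>The length of \<open>Ik n k\<close> cancels the factor \<open>n + 1\<close> and lowers
  the binomial coefficient, so the kernel distributes its mass over the intervals by a negative
  binomial law.\<close>

lemma mhat_emeasure_Ik:
  assumes "1 \<le> n" "0 \<le> x" "x < 1"
  shows "mhat n k x * (real n / (real (k + n) * real (k + n + 1))) = nbin n x k"
proof -
  obtain m where m: "n = Suc m" using assms by (cases n) auto
  \<comment> \<open>Cross-multiplied form: both sides times \<open>k! m!\<close>, where
    \<open>m = n - 1\<close>, equal \<open>(k + n + 1)!\<close>.\<close>
  have eq: "real ((k + n + 1) choose k) * (real (n + 1) * real n) = real (k + n + 1) * (real (k + n) * real ((k + n - 1) choose k))" (is "?L = ?R")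
  proof -
    define F where "F = (fact k * fact m :: real)"
    have "F \<noteq> 0" by (simp add: F_def)
    have binom: "real (N choose k) * (fact k * fact j) = fact N" if "N = k + j" for N j
      using that by (simp add: binomial_fact)
    have 1: "real ((k + n - 1) choose k) * F = fact (k + m)"
      unfolding F_def using m by (subst binom) auto
    have "fact (n + 1) = real (n + 1) * (real n * fact m)"
      by (simp add: m)
    then have "?L * F = real ((k + n + 1) choose k) * (fact k * fact (n + 1))"
      unfolding F_def by (simp only: mult_ac)
    also have "\<dots> = fact (k + n + 1)"
      by (rule binom) simp
    also have "\<dots> = real (k + n + 1) * (real (k + n) * fact (k + m))"
      by (simp add: m)
    also have "\<dots> = ?R * F"
      unfolding 1[symmetric] by (simp only: mult_ac)
    finally show ?thesis using \<open>F \<noteq> 0\<close> by simp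
  qed
  have "real ((k + n + 1) choose k) * (real (n + 1) * real n) / (real (k + n + 1) * real (k + n)) = real ((k + n - 1) choose k)"
    unfolding eq using m by simp
  moreover have "mhat n k x * (real n / (real (k + n) * real (k + n + 1)))
      = real ((k + n + 1) choose k) * (real (n + 1) * real n) / (real (k + n + 1) * real (k + n)) * (x ^ k * (1 - x) ^ n)"
    unfolding mhat_def by (simp only: times_divide_eq_left times_divide_eq_right mult_ac)
  ultimately show ?thesis
    by (simp only: nbin_def mult.assoc)
qed

text \<open>The negative binomial weights have mean exactly \<open>x\<close> at these nodes, unlike at the end points
  of \<open>Ik n k\<close>; for \<open>n = 1\<close>, \<open>k = 0\<close> the junk value \<open>0 / 0 = 0\<close> is the right one.\<close>
definition mkz_node :: "nat \<Rightarrow> nat \<Rightarrow> real"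
  where "mkz_node n k = real k / real (k + n - 1)"

lemma mkz_node_bounds: "1 \<le> n \<Longrightarrow> 0 \<le> mkz_node n k" "1 \<le> n \<Longrightarrow> mkz_node n k \<le> 1"
  by (auto simp: mkz_node_def divide_le_eq_1)

lemma mkz_node_Suc_le:
  assumes "1 \<le> n"
  shows "mkz_node n (Suc k) \<le> mkz_node n k + 1 / real n"
proof -
  have "mkz_node n (Suc k) = real k / real (k + n) + 1 / real (k + n)"
    by (simp add: mkz_node_def add_divide_distrib)
  also have "\<dots> \<le> real k / real (k + n - 1) + 1 / real n"
    using assms by (intro add_mono) (cases k, auto intro!: divide_left_mono)
  finally show ?thesis by (simp add: mkz_node_def)
qed

text \<open>An index shift that trades a factor \<open>mkz_node\<close> for \<open>x\<close>. Summed
  over \<open>k\<close> it gives the mean exactly; applied to one of the two factors of the second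
  moment it reduces that to the mean.\<close>

lemma nbin_node_Suc:
  assumes "1 \<le> n"
  shows "nbin n x (Suc k) * mkz_node n (Suc k) = x * nbin n x k"
proof -
  obtain m where m: "n = Suc m" using assms by (cases n) auto
  have "real (Suc k) * real (Suc (k + m) choose Suc k) = real (Suc (k + m)) * real ((k + m) choose k)"
    by (metis Suc_times_binomial_eq mult.commute of_nat_mult)
  then have "real (Suc (k + m) choose Suc k) * (real (Suc k) / real (Suc (k + m))) = real ((k + m) choose k)"
    by (simp add: divide_eq_eq mult.commute del: binomial_Suc_Suc)
  then show ?thesis
    by (simp add: nbin_def mkz_node_def m mult_ac del: binomial_Suc_Suc of_nat_Suc)
qed

lemma nbin_variance:
  assumes n: "1 \<le> n" and x: "0 \<le> x" "x < 1"
  shows "summable (\<lambda>k. nbin n x k * (mkz_node n k - x)\<^sup>2)"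
    and "(\<Sum>k. nbin n x k * (mkz_node n k - x)\<^sup>2) \<le> 1 / real n"
proof -
  let ?P = "nbin n x" and ?q = "mkz_node n"
  have P: "?P sums 1" using nbin_sums x by simp
  have q0: "?q 0 = 0" by (simp add: mkz_node_def)
  have "(\<lambda>k. ?P (Suc k) * ?q (Suc k)) sums (x * 1)"
    unfolding nbin_node_Suc[OF n] by (intro sums_mult P)
  then have Pq: "(\<lambda>k. ?P k * ?q k) sums x"
    by (subst (asm) sums_Suc_iff) (simp add: q0)
  have sum2: "summable (\<lambda>k. ?P k * (?q k)\<^sup>2)"
  proof (rule summable_comparison_test'[where N=0])
    show "summable ?P" using P by (rule sums_summable)
    fix k
    have "?P k * (?q k)\<^sup>2 \<le> ?P k * 1"
      using mkz_node_bounds[OF n, of k] nbin_nonneg x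
      by (intro mult_left_mono) (auto simp: power_le_one)
    then show "norm (?P k * (?q k)\<^sup>2) \<le> ?P k"
      using nbin_nonneg[of x n k] x by simp
  qed
  have "(\<Sum>k. ?P k * (?q k)\<^sup>2) = (\<Sum>k. ?P (Suc k) * (?q (Suc k))\<^sup>2)"
    using suminf_split_head[OF sum2] by (simp add: q0)
  \<comment> \<open>The shift turns one node factor into \<open>x\<close>; the other remains
    \<open>mkz_node n (Suc k)\<close>, which exceeds \<open>mkz_node n k\<close> by at most 1 /
    n.\<close>
  also have "\<dots> \<le> (\<Sum>k. x * (?P k * ?q k) + x * ?P k / n)"
  proof (intro suminf_le)
    fix k
    have "?P (Suc k) * (?q (Suc k))\<^sup>2 = x * ?P k * ?q (Suc k)"
      using nbin_node_Suc[OF n, of x k] by (simp add: power2_eq_square)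
    also have "\<dots> \<le> x * ?P k * (?q k + 1 / n)"
      using mkz_node_Suc_le[OF n] nbin_nonneg x by (intro mult_left_mono) auto
    finally show "?P (Suc k) * (?q (Suc k))\<^sup>2 \<le> x * (?P k * ?q k) + x * ?P k / n"
      by (simp add: algebra_simps)
    show "summable (\<lambda>k. ?P (Suc k) * (?q (Suc k))\<^sup>2)"
      using sum2 by (subst summable_Suc_iff)
    show "summable (\<lambda>k. x * (?P k * ?q k) + x * ?P k / n)"
      using Pq P by (intro summable_add summable_mult summable_divide) (auto simp: sums_iff)
  qed
  also have "\<dots> = x * x + x * 1 / n"
    using sums_add[OF sums_mult[OF Pq, of x] sums_divide[OF sums_mult[OF P, of x], of "real n"]]
    by (simp add: sums_iff)
  also have "\<dots> \<le> x\<^sup>2 + 1 / n"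
    using x by (simp add: power2_eq_square divide_right_mono)
  finally have le: "(\<Sum>k. ?P k * (?q k)\<^sup>2) \<le> x\<^sup>2 + 1 / n" .
  have eq: "(\<lambda>k. ?P k * (?q k - x)\<^sup>2) = (\<lambda>k. ?P k * (?q k)\<^sup>2 - 2 * x * (?P k * ?q k) + x\<^sup>2 * ?P k)"
    by (auto simp: fun_eq_iff power2_eq_square algebra_simps)
  have "(\<lambda>k. ?P k * (?q k - x)\<^sup>2) sums ((\<Sum>k. ?P k * (?q k)\<^sup>2) - 2 * x * x + x\<^sup>2 * 1)"
    unfolding eq by (intro sums_add sums_diff sums_mult P Pq summable_sums sum2)
  with le show "summable (\<lambda>k. ?P k * (?q k - x)\<^sup>2)" "(\<Sum>k. ?P k * (?q k - x)\<^sup>2) \<le> 1 / real n"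
    by (auto simp: sums_iff power2_eq_square)
qed

text \<open>Both \<open>s\<close> and the node lie between \<open>k / (k + n)\<close> and that value
  plus 1 / n.\<close>

lemma mkz_node_close:
  assumes n: "1 \<le> n" and s: "s \<in> Ik n k"
  shows "\<bar>s - mkz_node n k\<bar> \<le> 1 / n"
proof -
  have le: "real k / real (k + n) \<le> mkz_node n k"
    using n unfolding mkz_node_def by (cases k) (auto intro!: divide_left_mono)
  have "mkz_node n k - real k / real (k + n) = mkz_node n k * (1 / real (k + n))"
  \<comment> \<open>For \<open>n = 1\<close>, \<open>k = 0\<close> the node divides by 0, and both
    sides are 0.\<close>
  proof (cases "k + n = 1")
    case False
    then have "real (k + n - 1) = real (k + n) - 1" "real (k + n) \<noteq> 1" "real (k + n) \<noteq> 0"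
      using n by (auto simp: of_nat_diff)
    then show ?thesis unfolding mkz_node_def by (simp add: divide_simps) (simp add: algebra_simps)
  qed (use n in \<open>auto simp: mkz_node_def\<close>)
  also have "\<dots> \<le> 1 * (1 / real n)"
    using mkz_node_bounds[OF n, of k] n by (intro mult_mono) (auto intro!: divide_left_mono)
  finally have "mkz_node n k - s \<le> 1 / n"
    using s by (auto simp: Ik_def)
  moreover have "s \<le> real k / real (k + n + 1) + 1 / real (k + n + 1)"
    using s by (auto simp: Ik_def add_divide_distrib)
  moreover have "real k / real (k + n + 1) \<le> real k / real (k + n)" "1 / real (k + n + 1) \<le> 1 / n"
    using n by (auto intro!: divide_left_mono)
  ultimately show ?thesis using le by linarith
qed

lemma nn_integral_mkz_kernel_left:
  assumes [measurable]: "f \<in> borel_measurable borel"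
  shows "(\<integral>\<^sup>+s. mkz_kernel n x s * f s \<partial>\<U>) = (\<Sum>k. ennreal (mhat n k x) * (\<integral>\<^sup>+s. indicator (Ik n k) s * f s \<partial>\<U>))"
  unfolding mkz_kernel_def
  by (simp add: ennreal_suminf_multc[symmetric] nn_integral_suminf nn_integral_cmult mult.assoc)

lemma mhat_times_emeasure_Ik:
  assumes n: "1 \<le> n" and x: "0 \<le> x" "x < 1"
  shows "ennreal (mhat n k x) * emeasure \<U> (Ik n k) = ennreal (nbin n x k)"
  unfolding emeasure_Ik[OF n] mhat_emeasure_Ik[OF n x, symmetric]
  by (rule ennreal_mult[symmetric]) (use mhat_nonneg[of x n k] x in auto)

lemma nn_integral_mkz_kernel_left_1:
  assumes n: "1 \<le> n" and x: "0 \<le> x" "x < 1"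
  shows "(\<integral>\<^sup>+s. mkz_kernel n x s \<partial>\<U>) = 1"
proof -
  have "(\<integral>\<^sup>+s. mkz_kernel n x s \<partial>\<U>) = (\<Sum>k. ennreal (nbin n x k))"
    using nn_integral_mkz_kernel_left[of "\<lambda>_. 1" n x] by (simp add: mhat_times_emeasure_Ik[OF n x])
  also have "\<dots> = 1"
    using nbin_sums[OF x, of n] nbin_nonneg[of x n] x by (subst suminf_ennreal_eq[where x=1]) auto
  finally show ?thesis .
qed

lemma mkz_kernel_variance_left:
  assumes n: "1 \<le> n" and x: "0 \<le> x" "x < 1"
  shows "(\<integral>\<^sup>+s. mkz_kernel n x s * ennreal ((s - x)\<^sup>2) \<partial>\<U>) \<le> ennreal (4 / n)"
proof -
  \<comment> \<open>The squared distance of \<open>s\<close> from \<open>x\<close> is at most twice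
    that of \<open>s\<close> from the node plus twice that of the node from \<open>x\<close>. The
    first part is at most 2 / n since (1 / n)^2 <= 1 / n, and the second averages to at most 2 /
    n.\<close>
  let ?v = "\<lambda>k. 2 / n + 2 * (mkz_node n k - x)\<^sup>2"
  have "(\<integral>\<^sup>+s. mkz_kernel n x s * ennreal ((s - x)\<^sup>2) \<partial>\<U>)
     = (\<Sum>k. ennreal (mhat n k x) * (\<integral>\<^sup>+s. indicator (Ik n k) s * ennreal ((s - x)\<^sup>2) \<partial>\<U>))"
    by (rule nn_integral_mkz_kernel_left) simp
  also have "\<dots> \<le> (\<Sum>k. ennreal (nbin n x k * ?v k))"
  proof (intro suminf_le)
    fix k
    have "(\<integral>\<^sup>+s. indicator (Ik n k) s * ennreal ((s - x)\<^sup>2) \<partial>\<U>) \<le> (\<integral>\<^sup>+s. ennreal (?v k) * indicator (Ik n k) s \<partial>\<U>)"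
    proof (intro nn_integral_mono)
      fix s
      have "(s - x)\<^sup>2 \<le> ?v k" if "s \<in> Ik n k"
      proof -
        have "(s - mkz_node n k)\<^sup>2 \<le> (1 / n)\<^sup>2"
          using mkz_node_close[OF n that] by (intro power2_le_iff_abs_le[THEN iffD2]) auto
        also have "\<dots> \<le> 1 / n" using n by (simp add: power2_eq_square divide_simps)
        finally have "(s - mkz_node n k)\<^sup>2 \<le> 1 / n" .
        moreover have "(s - x)\<^sup>2 \<le> 2 * (s - mkz_node n k)\<^sup>2 + 2 * (mkz_node n k - x)\<^sup>2"
          using zero_le_power2[of "(s - mkz_node n k) - (mkz_node n k - x)"] by (simp add: power2_eq_square algebra_simps)
        ultimately show ?thesis by simp
      qed
      then show "indicator (Ik n k) s * ennreal ((s - x)\<^sup>2) \<le> ennreal (?v k) * indicator (Ik n k) s"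
        by (auto simp: indicator_def simp del: ennreal_plus intro!: ennreal_leI)
    qed
    also have "\<dots> = ennreal (?v k) * emeasure \<U> (Ik n k)"
      by (simp add: nn_integral_cmult_indicator)
    finally have "ennreal (mhat n k x) * (\<integral>\<^sup>+s. indicator (Ik n k) s * ennreal ((s - x)\<^sup>2) \<partial>\<U>)
        \<le> ennreal (mhat n k x) * (ennreal (?v k) * emeasure \<U> (Ik n k))"
      by (intro mult_left_mono) auto
    also have "\<dots> = (ennreal (mhat n k x) * emeasure \<U> (Ik n k)) * ennreal (?v k)"
      by (simp only: mult_ac)
    also have "ennreal (mhat n k x) * emeasure \<U> (Ik n k) = ennreal (nbin n x k)"
      by (rule mhat_times_emeasure_Ik) fact+
    also have "ennreal (nbin n x k) * ennreal (?v k) = ennreal (nbin n x k * ?v k)"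
      by (rule ennreal_mult[symmetric]) (use nbin_nonneg[of x n k] x in auto)
    finally show "ennreal (mhat n k x) * (\<integral>\<^sup>+s. indicator (Ik n k) s * ennreal ((s - x)\<^sup>2) \<partial>\<U>) \<le> ennreal (nbin n x k * ?v k)" .
  qed auto
  also have "\<dots> = ennreal (2 / n * 1 + 2 * (\<Sum>k. nbin n x k * (mkz_node n k - x)\<^sup>2))"
  proof (rule suminf_ennreal_eq)
    have eq: "(\<lambda>k. nbin n x k * ?v k) = (\<lambda>k. 2 / n * nbin n x k + 2 * (nbin n x k * (mkz_node n k - x)\<^sup>2))"
      by (simp add: fun_eq_iff distrib_left)
    show "(\<lambda>k. nbin n x k * ?v k) sums (2 / n * 1 + 2 * (\<Sum>k. nbin n x k * (mkz_node n k - x)\<^sup>2))"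
      unfolding eq by (intro sums_add sums_mult nbin_sums x summable_sums nbin_variance n)
    show "0 \<le> nbin n x k * ?v k" for k
      using nbin_nonneg[of x n k] x by simp
  qed
  also have "\<dots> \<le> ennreal (2 / n * 1 + 2 * (1 / n))"
    by (intro ennreal_leI add_left_mono mult_left_mono nbin_variance n x) simp
  also have "2 / n * 1 + 2 * (1 / n) = 4 / real n" by simp
  finally show ?thesis .
qed

section \<open>Moments in \<open>x\<close>: Beta integrals\<close>

lemma has_integral_power_mult_power:
  "((\<lambda>x::real. x ^ a * (1 - x) ^ b) has_integral (fact a * fact b / fact (a + b + 1))) {0..1}"
proof -
  have "((\<lambda>x::real. x powr (real (a + 1) - 1) * (1 - x) powr (real (b + 1) - 1)) has_integral Beta (real (a + 1)) (real (b + 1))) {0..1}"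
    by (rule has_integral_Beta_real) auto
  also have "Beta (real (a + 1)) (real (b + 1)) = fact a * fact b / fact (a + b + 1)"
    using Gamma_fact[of a, where 'a=real] Gamma_fact[of b, where 'a=real] Gamma_fact[of "a + b + 1", where 'a=real]
    by (simp add: Beta_def add_ac)
  finally have I: "((\<lambda>x::real. x powr (real (a + 1) - 1) * (1 - x) powr (real (b + 1) - 1)) has_integral fact a * fact b / fact (a + b + 1)) {0..1}" .
  show ?thesis
    \<comment> \<open>At 0 and 1 the integrands may differ, because \<open>0 powr 0 = 0\<close> but
      \<open>0 ^ 0 = 1\<close>.\<close>
    by (rule has_integral_spike_finite[OF _ _ I, of "{0, 1}"]) (auto simp: powr_realpow)
qed

text \<open>\<open>mhat n k\<close> is the density of the Beta distribution with parameters k + 1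
  and n + 1; these are its mass, mean and second moment.\<close>

lemma mhat_moments:
  shows "(mhat n k has_integral 1) {0..1}"
    and "((\<lambda>x. mhat n k x * x) has_integral (real (k + 1) / real (k + n + 2))) {0..1}"
    and "((\<lambda>x. mhat n k x * x\<^sup>2) has_integral (real (k + 1) * real (k + 2) / (real (k + n + 2) * real (k + n + 3)))) {0..1}"
proof -
  define c where "c = real (n + 1) * real ((k + n + 1) choose k)"
  have c: "c * (fact k * fact n / fact (k + n + 1)) = 1"
  proof -
    have "real ((k + n + 1) choose k) = fact (k + n + 1) / (fact k * fact (n + 1))"
      by (subst binomial_fact) auto
    also have "fact (n + 1) = real (n + 1) * fact n" by simp
    finally show ?thesis by (simp add: c_def del: fact_Suc of_nat_Suc of_nat_add)
  qed
  have mh: "mhat n k x * x ^ j = c * (x ^ (k + j) * (1 - x) ^ n)" for x j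
    by (simp add: mhat_def c_def power_add mult_ac)
  have I: "((\<lambda>x. mhat n k x * x ^ j) has_integral (c * (fact (k + j) * fact n / fact (k + j + n + 1)))) {0..1}" for j
    unfolding mh by (intro has_integral_mult_right has_integral_power_mult_power)
  show "(mhat n k has_integral 1) {0..1}"
    using I[of 0] unfolding add_0_right c by simp
  have "c * (fact (k + 1) * fact n / fact (k + 1 + n + 1)) = c * (fact k * fact n / fact (k + n + 1)) * (real (k + 1) / real (k + n + 2))"
    by (simp add: field_simps del: of_nat_Suc of_nat_add) 
  then show "((\<lambda>x. mhat n k x * x) has_integral (real (k + 1) / real (k + n + 2))) {0..1}"
    using I[of 1] unfolding c by simp
  have "c * (fact (k + 2) * fact n / fact (k + 2 + n + 1)) = c * (fact k * fact n / fact (k + n + 1)) *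
     (real (k + 1) * real (k + 2) / (real (k + n + 2) * real (k + n + 3)))"
  proof -
    have "fact (k + 2) = real (k + 2) * (real (k + 1) * fact k)" 
      by (simp add: numeral_2_eq_2)
    moreover have "fact (k + 2 + n + 1) = real (k + n + 3) * (real (k + n + 2) * fact (k + n + 1))"
      by (simp add: numeral_2_eq_2 numeral_3_eq_3)
    ultimately show ?thesis
      by (simp only: times_divide_eq_left times_divide_eq_right divide_divide_eq_left mult_ac)
  qed
  then show "((\<lambda>x. mhat n k x * x\<^sup>2) has_integral (real (k + 1) * real (k + 2) / (real (k + n + 2) * real (k + n + 3)))) {0..1}"
    using I[of 2] unfolding c by simp
qed

text \<open>The left side is the second moment of that Beta law about \<open>s\<close>: the variance
  \<mu> (1 - \<mu>) / (N + 1) plus the squared distance of \<open>s\<close> from the mean \<mu>,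
  each at most 1 / n.\<close>

lemma beta_second_moment_le:
  assumes n: "1 \<le> n" and s: "s \<in> Ik n k"
  shows "real (k + 1) * real (k + 2) / (real (k + n + 2) * real (k + n + 3)) - 2 * s * (real (k + 1) / real (k + n + 2)) + s\<^sup>2 \<le> 2 / n"
proof -
  define N where "N = real (k + n + 2)"
  define \<mu> where "\<mu> = real (k + 1) / N"
  have N: "real n \<le> N" "0 < N" "3 \<le> N" using n by (auto simp: N_def)
  have \<mu>: "0 \<le> \<mu>" "\<mu> \<le> 1" using N by (auto simp: \<mu>_def N_def)
  have "real (k + 1) * real (k + 2) / (N * (N + 1)) = \<mu> * ((\<mu> * N + 1) / (N + 1))"
    using N by (simp add: \<mu>_def add_ac)
  also have "\<dots> = \<mu>\<^sup>2 + \<mu> * (1 - \<mu>) / (N + 1)"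
    using N by (simp add: power2_eq_square divide_simps) (simp add: algebra_simps)
  also have "\<dots> \<le> \<mu>\<^sup>2 + 1 * 1 / n"
    using \<mu> N n by (intro add_left_mono frac_le mult_mono) auto
  finally have 1: "real (k + 1) * real (k + 2) / (N * (N + 1)) \<le> \<mu>\<^sup>2 + 1 / n" by simp
  have "\<bar>s - \<mu>\<bar> \<le> 1 / n"
  proof -
    have s1: "real k / real (k + n) \<le> s" "s \<le> real (k + 1) / real (k + n + 1)"
      using s by (auto simp: Ik_def)
    have "\<mu> = real k / N + 1 / N" by (simp add: \<mu>_def add_divide_distrib)
    also have "\<dots> \<le> real k / real (k + n) + 1 / n"
      using n N by (intro add_mono divide_left_mono) (auto simp: N_def)
    finally have "\<mu> - s \<le> 1 / n" using s1 by simp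
    moreover have "real (k + 1) / real (k + n + 1) - \<mu> = \<mu> * (1 / real (k + n + 1))"
      by (simp add: \<mu>_def N_def divide_simps) (simp add: algebra_simps)
    then have "real (k + 1) / real (k + n + 1) - \<mu> \<le> 1 * (1 / n)"
      using \<mu> n by (simp only:) (intro mult_mono divide_left_mono, auto)
    ultimately show ?thesis using s1 by linarith
  qed
  then have "(s - \<mu>)\<^sup>2 \<le> (1 / n)\<^sup>2"
    by (intro power2_le_iff_abs_le[THEN iffD2]) auto
  also have "\<dots> \<le> 1 / n" using n by (simp add: power2_eq_square divide_simps)
  finally have "(s - \<mu>)\<^sup>2 \<le> 1 / n" .
  moreover have "(s - \<mu>)\<^sup>2 = \<mu>\<^sup>2 - 2 * s * \<mu> + s\<^sup>2"
    by (simp add: power2_eq_square algebra_simps)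
  moreover have "real (k + n + 3) = N + 1" by (simp add: N_def)
  ultimately show ?thesis
    using 1 unfolding \<open>real (k + n + 3) = N + 1\<close> N_def[symmetric] \<mu>_def[symmetric] by linarith
qed

lemma nn_integral_unit_has_integral:
  assumes "f \<in> borel_measurable borel" "\<And>x. x \<in> {0..1} \<Longrightarrow> 0 \<le> f x" "(f has_integral I) {0..1}"
  shows "(\<integral>\<^sup>+x. ennreal (f x) \<partial>\<U>) = ennreal I"
proof -
  have "(\<integral>\<^sup>+x. ennreal (f x) \<partial>\<U>) = (\<integral>\<^sup>+x. ennreal (f x) * indicator {0..<1} x \<partial>lborel)"
    using assms by (intro nn_integral_unit_measure) auto
  also have "\<dots> = (\<integral>\<^sup>+x. ennreal (indicator {0..1} x * f x) \<partial>lborel)"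
    using AE_lborel_singleton[of 1]
    by (intro nn_integral_cong_AE) (auto simp: indicator_def)
  also have "\<dots> = ennreal I"
    using assms by (intro nn_integral_has_integral_lebesgue) auto
  finally show ?thesis .
qed

lemma nn_integral_mkz_kernel_right:
  assumes [measurable]: "f \<in> borel_measurable borel"
  shows "(\<integral>\<^sup>+x. mkz_kernel n x s * f x \<partial>\<U>) = (\<Sum>k. (\<integral>\<^sup>+x. ennreal (mhat n k x) * f x \<partial>\<U>) * indicator (Ik n k) s)"
proof -
  have "(\<integral>\<^sup>+x. mkz_kernel n x s * f x \<partial>\<U>) = (\<integral>\<^sup>+x. (\<Sum>k. (ennreal (mhat n k x) * f x) * indicator (Ik n k) s) \<partial>\<U>)"
    unfolding mkz_kernel_def
    by (intro nn_integral_cong) (simp add: ennreal_suminf_multc[symmetric] mult_ac)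
  also have "\<dots> = (\<Sum>k. (\<integral>\<^sup>+x. ennreal (mhat n k x) * f x \<partial>\<U>) * indicator (Ik n k) s)"
    by (subst nn_integral_suminf) (simp_all add: nn_integral_multc)
  finally show ?thesis .
qed

text \<open>Each \<open>mhat n k\<close> has mass 1, so the integral counts the intervals that
  contain \<open>s\<close>.\<close>

lemma nn_integral_mkz_kernel_right_le:
  assumes n: "1 \<le> n" and s: "0 \<le> s" "s < 1"
  shows "(\<integral>\<^sup>+x. mkz_kernel n x s \<partial>\<U>) \<le> 2"
proof -
  have "(\<integral>\<^sup>+x. ennreal (mhat n k x) \<partial>\<U>) = ennreal 1" for k
    by (intro nn_integral_unit_has_integral mhat_moments) (auto intro: mhat_nonneg)
  then have "(\<integral>\<^sup>+x. mkz_kernel n x s \<partial>\<U>) = (\<Sum>k. indicator (Ik n k) s)"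
    using nn_integral_mkz_kernel_right[of "\<lambda>_. 1" n s] by simp
  also have "\<dots> \<le> 2" by (rule sum_indicator_Ik_le) fact+
  finally show ?thesis .
qed

lemma mkz_kernel_variance_right:
  assumes n: "1 \<le> n" and s: "0 \<le> s" "s < 1"
  shows "(\<integral>\<^sup>+x. mkz_kernel n x s * ennreal ((s - x)\<^sup>2) \<partial>\<U>) \<le> ennreal (4 / n)"
proof -
  have I: "((\<lambda>x. mhat n k x * (s - x)\<^sup>2) has_integral
      (real (k + 1) * real (k + 2) / (real (k + n + 2) * real (k + n + 3)) - 2 * s * (real (k + 1) / real (k + n + 2)) + s\<^sup>2 * 1)) {0..1}" for k
  proof -
    have eq: "(\<lambda>x. mhat n k x * (s - x)\<^sup>2) = (\<lambda>x. mhat n k x * x\<^sup>2 - 2 * s * (mhat n k x * x) + s\<^sup>2 * mhat n k x)"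
      by (auto simp: fun_eq_iff power2_eq_square algebra_simps)
    show ?thesis unfolding eq
      by (intro has_integral_add has_integral_diff has_integral_mult_right mhat_moments)
  qed
  have "(\<integral>\<^sup>+x. mkz_kernel n x s * ennreal ((s - x)\<^sup>2) \<partial>\<U>)
      = (\<Sum>k. (\<integral>\<^sup>+x. ennreal (mhat n k x) * ennreal ((s - x)\<^sup>2) \<partial>\<U>) * indicator (Ik n k) s)"
    by (rule nn_integral_mkz_kernel_right) simp
  also have "\<dots> \<le> (\<Sum>k. ennreal (2 / n) * indicator (Ik n k) s)"
  proof (intro suminf_le)
    fix k
    have "(\<integral>\<^sup>+x. ennreal (mhat n k x) * ennreal ((s - x)\<^sup>2) \<partial>\<U>) = (\<integral>\<^sup>+x. ennreal (mhat n k x * (s - x)\<^sup>2) \<partial>\<U>)"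
      by (intro nn_integral_cong) (simp add: ennreal_mult'')
    also have "\<dots> = ennreal (real (k + 1) * real (k + 2) / (real (k + n + 2) * real (k + n + 3)) - 2 * s * (real (k + 1) / real (k + n + 2)) + s\<^sup>2 * 1)"
      by (intro nn_integral_unit_has_integral I) (auto intro!: mult_nonneg_nonneg mhat_nonneg)
    also have "\<dots> \<le> ennreal (2 / n)" if "s \<in> Ik n k"
      using beta_second_moment_le[OF n that] by (intro ennreal_leI) simp
    finally show "(\<integral>\<^sup>+x. ennreal (mhat n k x) * ennreal ((s - x)\<^sup>2) \<partial>\<U>) * indicator (Ik n k) s \<le> ennreal (2 / n) * indicator (Ik n k) s"
      by (auto simp: indicator_def)
  qed auto
  also have "\<dots> = ennreal (2 / n) * (\<Sum>k. indicator (Ik n k) s)"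
    by simp
  also have "\<dots> \<le> ennreal (2 / n) * 2"
    using sum_indicator_Ik_le[OF n s] by (intro mult_left_mono) auto
  also have "\<dots> = ennreal (4 / n)"
    by (simp flip: ennreal_mult'' ennreal_numeral)
  finally show ?thesis .
qed

section \<open>Step functions and the modulus of continuity\<close>

text \<open>Substituting y = x + h and exchanging the integrals leaves one translation integral for
  each \<open>h\<close> in an interval of length 2 r.\<close>

lemma nn_integral_near_diagonal:
  fixes F :: "real \<Rightarrow> real"
  assumes [measurable]: "F \<in> borel_measurable borel" and r: "0 \<le> r"
    and w: "\<And>h. 0 < h \<Longrightarrow> h \<le> r \<Longrightarrow>
       (\<integral>\<^sup>+x. ennreal (\<bar>F (x + h) - F x\<bar> powr p) * indicator {0..1 - h} x \<partial>lborel) \<le> W"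
  shows "(\<integral>\<^sup>+x. \<integral>\<^sup>+y. indicator {..r} \<bar>x - y\<bar> * ennreal (\<bar>F x - F y\<bar> powr p) \<partial>\<U> \<partial>\<U>) \<le> ennreal (2 * r) * W"
proof -
  define G where "G x y = indicator {..r} \<bar>x - y\<bar> * ennreal (\<bar>F x - F y\<bar> powr p) * indicator {0..<1} x * indicator {0..<1} y" for x y
  have G_meas [measurable]: "(\<lambda>z. G (f z) (g z)) \<in> borel_measurable M"
    if [measurable]: "f \<in> borel_measurable M" "g \<in> borel_measurable M" for f g :: "'a \<Rightarrow> real" and M
    unfolding G_def by measurable
  have "(\<integral>\<^sup>+x. \<integral>\<^sup>+y. indicator {..r} \<bar>x - y\<bar> * ennreal (\<bar>F x - F y\<bar> powr p) \<partial>\<U> \<partial>\<U>)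
     = (\<integral>\<^sup>+x. \<integral>\<^sup>+y. G x y \<partial>lborel \<partial>lborel)"
  proof -
    have "(\<integral>\<^sup>+y. indicator {..r} \<bar>x - y\<bar> * ennreal (\<bar>F x - F y\<bar> powr p) \<partial>\<U>) * indicator {0..<1} x = (\<integral>\<^sup>+y. G x y \<partial>lborel)" for x
    proof -
      have "(\<integral>\<^sup>+y. indicator {..r} \<bar>x - y\<bar> * ennreal (\<bar>F x - F y\<bar> powr p) \<partial>\<U>) * indicator {0..<1} x
        = (\<integral>\<^sup>+y. indicator {..r} \<bar>x - y\<bar> * ennreal (\<bar>F x - F y\<bar> powr p) * indicator {0..<1} y \<partial>lborel) * indicator {0..<1} x"
        by (subst nn_integral_unit_measure) simp_all
      also have "\<dots> = (\<integral>\<^sup>+y. G x y \<partial>lborel)"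
        unfolding G_def by (subst nn_integral_multc[symmetric]) (simp_all add: mult_ac)
      finally show ?thesis .
    qed
    then show ?thesis by (subst nn_integral_unit_measure) simp_all
  qed
  also have "\<dots> = (\<integral>\<^sup>+x. \<integral>\<^sup>+h. G x (x + h) \<partial>lborel \<partial>lborel)"
  proof (rule nn_integral_cong)
    fix x :: real
    show "(\<integral>\<^sup>+y. G x y \<partial>lborel) = (\<integral>\<^sup>+h. G x (x + h) \<partial>lborel)"
      using nn_integral_real_affine[of "G x" 1 x] by simp
  qed
  also have "\<dots> = (\<integral>\<^sup>+h. \<integral>\<^sup>+x. G x (x + h) \<partial>lborel \<partial>lborel)"
    by (rule lborel_pair.Fubini') measurable
  also have "\<dots> \<le> (\<integral>\<^sup>+h. W * indicator {- r..r} h \<partial>lborel)"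
  proof (intro nn_integral_mono)
    fix h :: real
    have pos: "(\<integral>\<^sup>+x. G x (x + h) \<partial>lborel) \<le> W \<and> (\<integral>\<^sup>+x. G (x + h) x \<partial>lborel) \<le> W" if h: "0 < h" "h \<le> r" for h
    proof -
      have "G x (x + h) \<le> ennreal (\<bar>F (x + h) - F x\<bar> powr p) * indicator {0..1 - h} x"
        "G (x + h) x \<le> ennreal (\<bar>F (x + h) - F x\<bar> powr p) * indicator {0..1 - h} x" for x
        using h by (auto simp: G_def indicator_def abs_minus_commute)
      then show ?thesis
        by (intro conjI order_trans[OF nn_integral_mono w[OF h]])
    qed
    show "(\<integral>\<^sup>+x. G x (x + h) \<partial>lborel) \<le> W * indicator {- r..r} h"
    proof (cases "h \<in> {-r..r}")
      case False
      then have "G x (x + h) = 0" for x by (auto simp: G_def indicator_def)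
      then show ?thesis by simp
    next
      case True
      consider "h = 0" | "0 < h" | "h < 0" by linarith
      then show ?thesis
      proof cases
        case 1
        \<comment> \<open>The hypothesis \<open>w\<close> does not cover \<open>h = 0\<close>; there
          the integrand is \<open>0 powr p = 0\<close>.\<close>
        then show ?thesis by (simp add: G_def)
      next
        case 2
        then show ?thesis using pos[of h] True by simp
      next
        case 3
        \<comment> \<open>Moving \<open>x\<close> by \<open>- h\<close> swaps the two points and
          reduces a negative shift to a positive one.\<close>
        have "(\<integral>\<^sup>+x. G x (x + h) \<partial>lborel) = (\<integral>\<^sup>+x. G (x + (- h)) x \<partial>lborel)"
          using nn_integral_real_affine[of "\<lambda>x. G x (x + h)" 1 "- h"] by simp
        then show ?thesis using pos[of "- h"] True 3 by simp
      qed
    qed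
  qed
  also have "\<dots> = ennreal (2 * r) * W"
    using r by (simp add: nn_integral_cmult_indicator mult.commute)
  finally show ?thesis .
qed

section \<open>Cells, cell means and the step function built from them\<close>

definition cell :: "nat \<Rightarrow> nat \<Rightarrow> real set"
  where "cell m j = {real j / real m..<real (Suc j) / real m}"

definition cell_index :: "nat \<Rightarrow> real \<Rightarrow> nat"
  where "cell_index m x = nat \<lfloor>real m * x\<rfloor>"

definition cell_mean :: "nat \<Rightarrow> (real \<Rightarrow> real) \<Rightarrow> nat \<Rightarrow> real"
  where "cell_mean m F j = (LINT y|\<U>. real m * indicator (cell m j) y * F y)"

definition step_approx :: "nat \<Rightarrow> (real \<Rightarrow> real) \<Rightarrow> real \<Rightarrow> real"
  where "step_approx m F x = cell_mean m F (cell_index m x)"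

lemma cell_measurable [measurable, simp]: "cell m j \<in> sets borel"
  by (simp add: cell_def)

lemma step_approx_measurable [measurable]: "step_approx m F \<in> borel_measurable borel"
  unfolding step_approx_def[abs_def] cell_index_def by measurable

lemma cell_index_less: "1 \<le> m \<Longrightarrow> 0 \<le> x \<Longrightarrow> x < 1 \<Longrightarrow> cell_index m x < m"
  unfolding cell_index_def by (subst nat_less_iff) (auto simp: floor_less_iff)

lemma cell_index_less_iff:
  assumes "1 \<le> m" "0 \<le> x" "1 \<le> j"
  shows "cell_index m x < j \<longleftrightarrow> x < real j / real m"
proof -
  have "cell_index m x < j \<longleftrightarrow> \<lfloor>real m * x\<rfloor> < int j"
    using assms unfolding cell_index_def by (subst nat_less_iff) auto
  also have "\<dots> \<longleftrightarrow> x < real j / real m"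
    using assms by (simp add: floor_less_iff field_simps)
  finally show ?thesis .
qed

lemma mem_cell_iff: "1 \<le> m \<Longrightarrow> 0 \<le> x \<Longrightarrow> x \<in> cell m j \<longleftrightarrow> cell_index m x = j"
proof -
  assume a: "1 \<le> m" "0 \<le> x"
  have "x \<in> cell m j \<longleftrightarrow> int j \<le> \<lfloor>real m * x\<rfloor> \<and> \<lfloor>real m * x\<rfloor> < int j + 1"
    using a by (auto simp: cell_def le_floor_iff floor_less_iff field_simps)
  also have "\<dots> \<longleftrightarrow> cell_index m x = j"
    using a by (auto simp: cell_index_def)
  finally show ?thesis .
qed

lemma cell_subset: "j < m \<Longrightarrow> cell m j \<subseteq> {0..<1}"
proof
  fix x assume j: "j < m" and "x \<in> cell m j"
  then have x: "real j / real m \<le> x" "x < real (Suc j) / real m" by (auto simp: cell_def)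
  have "0 \<le> real j / real m" by simp
  moreover have "real (Suc j) / real m \<le> 1" using j by simp
  ultimately show "x \<in> {0..<1}" using x unfolding atLeastLessThan_iff by linarith
qed

lemma nn_integral_cell:
  assumes "j < m"
  shows "(\<integral>\<^sup>+y. ennreal (real m * indicator (cell m j) y) \<partial>\<U>) = 1"
proof -
  have "(\<integral>\<^sup>+y. ennreal (real m * indicator (cell m j) y) \<partial>\<U>) = (\<integral>\<^sup>+y. ennreal (real m) * indicator (cell m j) y \<partial>\<U>)"
    by (intro nn_integral_cong) (simp add: indicator_def)
  also have "\<dots> = ennreal (real m) * emeasure lborel (cell m j)"
    using cell_subset[OF assms] by (simp add: nn_integral_cmult_indicator emeasure_unit_measure Int_absorb1)
  also have "emeasure lborel (cell m j) = ennreal (real (Suc j) / real m - real j / real m)"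
    unfolding cell_def by (intro emeasure_lborel_Ico divide_right_mono) auto
  also have "real (Suc j) / real m - real j / real m = 1 / real m"
    by (simp add: add_divide_distrib)
  also have "ennreal (real m) * ennreal (1 / real m) = 1"
    using assms by (simp flip: ennreal_mult')
  finally show ?thesis .
qed

lemma abs_integral_le_enn2real:
  fixes f :: "'a \<Rightarrow> real"
  shows "\<bar>\<integral>x. f x \<partial>M\<bar> \<le> enn2real (\<integral>\<^sup>+x. ennreal \<bar>f x\<bar> \<partial>M)"
proof (cases "integrable M f")
  case True
  then have "\<bar>\<integral>x. f x \<partial>M\<bar> \<le> (\<integral>x. \<bar>f x\<bar> \<partial>M)"
    using integral_norm_bound[of M f] by simp
  also have "\<dots> = enn2real (\<integral>\<^sup>+x. ennreal \<bar>f x\<bar> \<partial>M)"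
    using True by (intro integral_eq_nn_integral) auto
  finally show ?thesis .
qed (simp add: not_integrable_integral_eq)

text \<open>Jensen's inequality on one cell, where \<open>m\<close> times the indicator has mass 1.
  The number \<open>z\<close> is arbitrary, so that it can be a value of \<open>F\<close> or another
  cell mean.\<close>

lemma cell_mean_diff:
  assumes j: "j < m" and p: "1 \<le> p" and F: "integrable \<U> F"
  shows "ennreal (\<bar>z - cell_mean m F j\<bar> powr p)
    \<le> (\<integral>\<^sup>+y. ennreal (real m * indicator (cell m j) y) * ennreal (\<bar>z - F y\<bar> powr p) \<partial>\<U>)"
proof -
  have [measurable]: "F \<in> borel_measurable borel" using borel_measurable_integrable[OF F] by simp
  have [simp]: "integrable \<U> (\<lambda>y. real m * indicator (cell m j) y * F y)"
    by (rule Bochner_Integration.integrable_bound[OF integrable_mult_right[OF F, of "real m"]])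
       (auto simp: indicator_def abs_mult)
  have int1: "integrable \<U> (\<lambda>y. real m * indicator (cell m j) y)" "(LINT y|\<U>. real m * indicator (cell m j) y) = 1"
  proof -
    show "integrable \<U> (\<lambda>y. real m * indicator (cell m j) y)"
      using nn_integral_cell[OF j] by (intro integrableI_nonneg) auto
    show "(LINT y|\<U>. real m * indicator (cell m j) y) = 1"
      using nn_integral_cell[OF j] by (subst integral_eq_nn_integral) auto
  qed
  have "z - cell_mean m F j = (LINT y|\<U>. real m * indicator (cell m j) y * (z - F y))"
    unfolding cell_mean_def right_diff_distrib using int1 by (subst Bochner_Integration.integral_diff) auto
  then have "\<bar>z - cell_mean m F j\<bar> \<le> enn2real (\<integral>\<^sup>+y. ennreal \<bar>real m * indicator (cell m j) y * (z - F y)\<bar> \<partial>\<U>)"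
    using abs_integral_le_enn2real[of \<U> "\<lambda>y. real m * indicator (cell m j) y * (z - F y)"] by simp
  also have "(\<integral>\<^sup>+y. ennreal \<bar>real m * indicator (cell m j) y * (z - F y)\<bar> \<partial>\<U>)
      = (\<integral>\<^sup>+y. ennreal (real m * indicator (cell m j) y) * ennreal \<bar>z - F y\<bar> \<partial>\<U>)"
    by (intro nn_integral_cong) (simp add: abs_mult ennreal_mult)
  finally have "ennreal (\<bar>z - cell_mean m F j\<bar> powr p)
     \<le> ennreal (enn2real (\<integral>\<^sup>+y. ennreal (real m * indicator (cell m j) y) * ennreal \<bar>z - F y\<bar> \<partial>\<U>) powr p)"
    using p by (intro ennreal_leI powr_mono2) auto
  also have "\<dots> \<le> ennreal (1 powr (p - 1)) * (\<integral>\<^sup>+y. ennreal (real m * indicator (cell m j) y) * ennreal (\<bar>z - F y\<bar> powr p) \<partial>\<U>)"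
    using p nn_integral_cell[OF j] by (intro nn_integral_power_mean) auto
  finally show ?thesis by simp
qed

text \<open>The cases \<open>j = i\<close> and \<open>j = i + 1\<close> are kept together, so that
  the step error and the jumps use the same strip around the diagonal.\<close>

lemma cell_dist:
  assumes "1 \<le> m" "x \<in> cell m i" "y \<in> cell m j" "i \<le> j" "j \<le> Suc i"
  shows "\<bar>x - y\<bar> \<le> 2 / real m"
proof -
  have "real m * x \<in> {real i..<real i + 1}" "real m * y \<in> {real j..<real j + 1}"
    using assms by (auto simp: cell_def field_simps)
  then have "\<bar>real m * x - real m * y\<bar> \<le> 2" using assms by auto
  also have "\<bar>real m * x - real m * y\<bar> = real m * \<bar>x - y\<bar>"
    by (simp add: abs_mult flip: right_diff_distrib)
  finally show ?thesis using assms by (simp add: field_simps)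
qed

text \<open>The mean over the cell of \<open>x\<close> has density \<open>m\<close>, and that cell
  lies within the strip of radius 2 / m.\<close>

lemma step_approx_error:
  assumes m: "1 \<le> m" and p: "1 \<le> p" and F: "integrable \<U> F"
  defines "D \<equiv> \<integral>\<^sup>+x. \<integral>\<^sup>+y. indicator {..2 / real m} \<bar>x - y\<bar> * ennreal (\<bar>F x - F y\<bar> powr p) \<partial>\<U> \<partial>\<U>"
  shows "(\<integral>\<^sup>+x. ennreal (\<bar>F x - step_approx m F x\<bar> powr p) \<partial>\<U>) \<le> ennreal (real m) * D"
proof -
  have [measurable]: "F \<in> borel_measurable borel" using borel_measurable_integrable[OF F] by simp
  have "(\<integral>\<^sup>+x. ennreal (\<bar>F x - step_approx m F x\<bar> powr p) \<partial>\<U>)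
    \<le> (\<integral>\<^sup>+x. ennreal (real m) * (\<integral>\<^sup>+y. indicator {..2 / real m} \<bar>x - y\<bar> * ennreal (\<bar>F x - F y\<bar> powr p) \<partial>\<U>) \<partial>\<U>)"
  proof (rule nn_integral_unit_mono)
    fix x :: real assume x: "0 \<le> x" "x < 1"
    let ?i = "cell_index m x"
    have "ennreal (\<bar>F x - step_approx m F x\<bar> powr p)
      \<le> (\<integral>\<^sup>+y. ennreal (real m * indicator (cell m ?i) y) * ennreal (\<bar>F x - F y\<bar> powr p) \<partial>\<U>)"
      unfolding step_approx_def using cell_index_less[OF m x] by (intro cell_mean_diff p F)
    also have "\<dots> \<le> (\<integral>\<^sup>+y. ennreal (real m) * (indicator {..2 / real m} \<bar>x - y\<bar> * ennreal (\<bar>F x - F y\<bar> powr p)) \<partial>\<U>)"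
    proof (intro nn_integral_mono)
      fix y
      have "\<bar>x - y\<bar> \<le> 2 / real m" if "y \<in> cell m ?i"
        using mem_cell_iff[OF m x(1), of ?i] that by (intro cell_dist[of m x ?i y ?i] m) auto
      then show "ennreal (real m * indicator (cell m ?i) y) * ennreal (\<bar>F x - F y\<bar> powr p)
         \<le> ennreal (real m) * (indicator {..2 / real m} \<bar>x - y\<bar> * ennreal (\<bar>F x - F y\<bar> powr p))"
        by (auto simp: indicator_def)
    qed
    also have "\<dots> = ennreal (real m) * (\<integral>\<^sup>+y. indicator {..2 / real m} \<bar>x - y\<bar> * ennreal (\<bar>F x - F y\<bar> powr p) \<partial>\<U>)"
      by (rule nn_integral_cmult) measurable
    finally show "ennreal (\<bar>F x - step_approx m F x\<bar> powr p) \<le> \<dots>" .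
  qed
  also have "\<dots> = ennreal (real m) * D"
    unfolding D_def by (rule nn_integral_cmult) measurable
  finally show ?thesis .
qed

text \<open>Two applications of \<open>cell_mean_diff\<close> bound a jump by an average over the
  product of two neighbouring cells, with density m^2. These products are disjoint and lie in the
  strip, so all jumps together cost one integral over it.\<close>

lemma cell_mean_jumps:
  assumes m: "1 \<le> m" and p: "1 \<le> p" and F: "integrable \<U> F"
  defines "D \<equiv> \<integral>\<^sup>+x. \<integral>\<^sup>+y. indicator {..2 / real m} \<bar>x - y\<bar> * ennreal (\<bar>F x - F y\<bar> powr p) \<partial>\<U> \<partial>\<U>"
  shows "(\<Sum>j\<in>{1..<m}. ennreal (\<bar>cell_mean m F (j - 1) - cell_mean m F j\<bar> powr p)) \<le> ennreal (real m * real m) * D"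
proof -
  have [measurable]: "F \<in> borel_measurable borel" using borel_measurable_integrable[OF F] by simp
  let ?k = "\<lambda>j y. ennreal (real m * indicator (cell m j) y)"
  have "(\<Sum>j\<in>{1..<m}. ennreal (\<bar>cell_mean m F (j - 1) - cell_mean m F j\<bar> powr p))
      \<le> (\<Sum>j\<in>{1..<m}. \<integral>\<^sup>+y. \<integral>\<^sup>+x. ?k j y * ?k (j - 1) x * ennreal (\<bar>F y - F x\<bar> powr p) \<partial>\<U> \<partial>\<U>)"
  proof (intro sum_mono)
    fix j assume j: "j \<in> {1..<m}"
    have "ennreal (\<bar>cell_mean m F (j - 1) - cell_mean m F j\<bar> powr p)
      \<le> (\<integral>\<^sup>+y. ?k j y * ennreal (\<bar>cell_mean m F (j - 1) - F y\<bar> powr p) \<partial>\<U>)"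
      using j by (intro cell_mean_diff p F) auto
    also have "\<dots> \<le> (\<integral>\<^sup>+y. ?k j y * (\<integral>\<^sup>+x. ?k (j - 1) x * ennreal (\<bar>F y - F x\<bar> powr p) \<partial>\<U>) \<partial>\<U>)"
      using j by (intro nn_integral_mono mult_left_mono, subst abs_minus_commute)
         (auto intro!: cell_mean_diff p F)
    also have "\<dots> = (\<integral>\<^sup>+y. \<integral>\<^sup>+x. ?k j y * ?k (j - 1) x * ennreal (\<bar>F y - F x\<bar> powr p) \<partial>\<U> \<partial>\<U>)"
      by (simp add: nn_integral_cmult[symmetric] mult_ac)
    finally show "ennreal (\<bar>cell_mean m F (j - 1) - cell_mean m F j\<bar> powr p) \<le> \<dots>" .
  qed
  also have "\<dots> = (\<integral>\<^sup>+y. \<integral>\<^sup>+x. (\<Sum>j\<in>{1..<m}. ?k j y * ?k (j - 1) x * ennreal (\<bar>F y - F x\<bar> powr p)) \<partial>\<U> \<partial>\<U>)"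
    by (simp add: nn_integral_sum)
  also have "\<dots> \<le> (\<integral>\<^sup>+y. \<integral>\<^sup>+x. ennreal (real m * real m) * (indicator {..2 / real m} \<bar>y - x\<bar> * ennreal (\<bar>F y - F x\<bar> powr p)) \<partial>\<U> \<partial>\<U>)"
  proof (intro nn_integral_unit_mono)
    fix y x :: real assume y: "0 \<le> y" "y < 1" and x: "0 \<le> x" "x < 1"
    \<comment> \<open>Only the \<open>j\<close> whose cell contains \<open>y\<close> contributes, so
      the densities do not add up.\<close>
    let ?j = "cell_index m y"
    let ?t = "\<lambda>j. ?k j y * ?k (j - 1) x * ennreal (\<bar>F y - F x\<bar> powr p)"
    have "(\<Sum>j\<in>{1..<m}. ?t j) = (\<Sum>j\<in>{1..<m} \<inter> {?j}. ?t j)"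
      using mem_cell_iff[OF m y(1)] by (intro sum.mono_neutral_right) (auto simp: indicator_def)
    also have "\<dots> \<le> ennreal (real m * real m) * (indicator {..2 / real m} \<bar>y - x\<bar> * ennreal (\<bar>F y - F x\<bar> powr p))"
    proof (cases "?j \<in> {1..<m} \<and> x \<in> cell m (?j - 1)")
      case True
      then have "\<bar>x - y\<bar> \<le> 2 / real m"
        using mem_cell_iff[OF m y(1), of ?j] by (intro cell_dist[of m x "?j - 1" y ?j] m) auto
      then show ?thesis
        using True mem_cell_iff[OF m y(1), of ?j] by (simp add: ennreal_mult abs_minus_commute mult.assoc)
    next
      case False
      then have "(\<Sum>j\<in>{1..<m} \<inter> {?j}. ?t j) = 0" by (intro sum.neutral) auto
      then show ?thesis by (rule ord_eq_le_trans) simp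
    qed
    finally show "(\<Sum>j\<in>{1..<m}. ?t j) \<le> \<dots>" .
  qed
  also have "\<dots> = ennreal (real m * real m) * D"
    unfolding D_def by (simp add: nn_integral_cmult)
  finally show ?thesis .
qed

section \<open>The operator on step functions\<close>

lemma summable_Hker:
  assumes n: "1 \<le> n" and s: "0 \<le> s" "s < 1"
  shows "summable (\<lambda>k. mhat n k x * indicator (Ik n k) s)"
proof (rule summable_finite)
  show "finite {nat \<lfloor>real n * s / (1 - s)\<rfloor> - 1, nat \<lfloor>real n * s / (1 - s)\<rfloor>}" by simp
qed (use mem_Ik_index[OF n s] in \<open>auto simp: indicator_def\<close>)

lemma mkz_kernel_eq_Hker:
  assumes n: "1 \<le> n" and x: "0 \<le> x" "x < 1" and s: "0 \<le> s" "s < 1"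
  shows "mkz_kernel n x s = ennreal (Hker n x s)" "0 \<le> Hker n x s"
proof -
  have nonneg: "0 \<le> mhat n k x * indicator (Ik n k) s" for k
    using mhat_nonneg[of x n k] x by simp
  have "mkz_kernel n x s = (\<Sum>k. ennreal (mhat n k x * indicator (Ik n k) s))"
    unfolding mkz_kernel_def by (intro suminf_cong) (simp add: indicator_def)
  also have "\<dots> = ennreal (Hker n x s)"
    unfolding Hker_def by (intro suminf_ennreal2 nonneg summable_Hker n s)
  finally show "mkz_kernel n x s = ennreal (Hker n x s)" .
  show "0 \<le> Hker n x s"
    unfolding Hker_def by (intro suminf_nonneg summable_Hker n s nonneg)
qed

text \<open>\<open>MKZ\<close> rewritten for Borel functions over \<open>unit_measure\<close>, where
  Tonelli's theorem applies to the \<open>ennreal\<close> kernel.\<close>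

definition mkz_op :: "nat \<Rightarrow> (real \<Rightarrow> real) \<Rightarrow> real \<Rightarrow> real"
  where "mkz_op n F x = (LINT s|\<U>. enn2real (mkz_kernel n x s) * F s)"

lemma mkz_op_measurable [measurable]:
  assumes [measurable]: "F \<in> borel_measurable borel"
  shows "mkz_op n F \<in> borel_measurable borel"
proof -
  have "(\<lambda>x. LINT s|\<U>. enn2real (mkz_kernel n x s) * F s) \<in> borel_measurable \<U>"
    by (rule unit_measure.borel_measurable_lebesgue_integral) measurable
  then show ?thesis unfolding mkz_op_def[abs_def] by simp
qed

lemma ennreal_enn2real_mkz_kernel:
  assumes "1 \<le> n" "0 \<le> x" "x < 1" "0 \<le> s" "s < 1"
  shows "ennreal (enn2real (mkz_kernel n x s)) = mkz_kernel n x s"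
  using mkz_kernel_eq_Hker[OF assms] by simp

lemma abs_mkz_op_powr_le:
  assumes n: "1 \<le> n" and p: "1 \<le> p" and x: "0 \<le> x" "x < 1"
    and [measurable]: "G \<in> borel_measurable borel"
  shows "ennreal (\<bar>mkz_op n G x\<bar> powr p) \<le> (\<integral>\<^sup>+s. mkz_kernel n x s * ennreal (\<bar>G s\<bar> powr p) \<partial>\<U>)"
proof -
  have "\<bar>mkz_op n G x\<bar> \<le> enn2real (\<integral>\<^sup>+s. ennreal \<bar>enn2real (mkz_kernel n x s) * G s\<bar> \<partial>\<U>)"
    unfolding mkz_op_def by (rule abs_integral_le_enn2real)
  also have "(\<integral>\<^sup>+s. ennreal \<bar>enn2real (mkz_kernel n x s) * G s\<bar> \<partial>\<U>) = (\<integral>\<^sup>+s. mkz_kernel n x s * ennreal \<bar>G s\<bar> \<partial>\<U>)"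
    by (intro nn_integral_unit_cong) (simp add: abs_mult ennreal_mult ennreal_enn2real_mkz_kernel[OF n x])
  finally have "ennreal (\<bar>mkz_op n G x\<bar> powr p) \<le> ennreal (enn2real (\<integral>\<^sup>+s. mkz_kernel n x s * ennreal \<bar>G s\<bar> \<partial>\<U>) powr p)"
    using p by (intro ennreal_leI powr_mono2) auto
  also have "\<dots> \<le> ennreal (1 powr (p - 1)) * (\<integral>\<^sup>+s. mkz_kernel n x s * ennreal (\<bar>G s\<bar> powr p) \<partial>\<U>)"
    using p nn_integral_mkz_kernel_left_1[OF n x] by (intro nn_integral_power_mean) auto
  finally show ?thesis by simp
qed

lemma nn_integral_mkz_kernel_twice_le:
  assumes n: "1 \<le> n" and [measurable]: "h \<in> borel_measurable borel"
  shows "(\<integral>\<^sup>+x. \<integral>\<^sup>+s. mkz_kernel n x s * h s \<partial>\<U> \<partial>\<U>) \<le> 2 * (\<integral>\<^sup>+s. h s \<partial>\<U>)"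
proof -
  have "(\<integral>\<^sup>+x. \<integral>\<^sup>+s. mkz_kernel n x s * h s \<partial>\<U> \<partial>\<U>) = (\<integral>\<^sup>+s. \<integral>\<^sup>+x. mkz_kernel n x s * h s \<partial>\<U> \<partial>\<U>)"
    by (rule unit_measure2.Fubini') measurable
  also have "\<dots> = (\<integral>\<^sup>+s. (\<integral>\<^sup>+x. mkz_kernel n x s \<partial>\<U>) * h s \<partial>\<U>)"
    by (simp add: nn_integral_multc)
  also have "\<dots> \<le> (\<integral>\<^sup>+s. 2 * h s \<partial>\<U>)"
    using n by (intro nn_integral_unit_mono mult_right_mono nn_integral_mkz_kernel_right_le) auto
  also have "\<dots> = 2 * (\<integral>\<^sup>+s. h s \<partial>\<U>)"
    by (simp add: nn_integral_cmult)
  finally show ?thesis .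
qed

text \<open>Schur's test: mass 1 in \<open>s\<close> gives Jensen's inequality for each
  \<open>x\<close>, and mass at most 2 in \<open>x\<close> gives the factor. It multiplies p-th
  powers, hence is at most 2 on norms for every p.\<close>

lemma mkz_op_bounded:
  assumes n: "1 \<le> n" and p: "1 \<le> p" and [measurable]: "G \<in> borel_measurable borel"
  shows "(\<integral>\<^sup>+x. ennreal (\<bar>mkz_op n G x\<bar> powr p) \<partial>\<U>) \<le> 2 * (\<integral>\<^sup>+x. ennreal (\<bar>G x\<bar> powr p) \<partial>\<U>)"
proof -
  have "(\<integral>\<^sup>+x. ennreal (\<bar>mkz_op n G x\<bar> powr p) \<partial>\<U>)
      \<le> (\<integral>\<^sup>+x. \<integral>\<^sup>+s. mkz_kernel n x s * ennreal (\<bar>G s\<bar> powr p) \<partial>\<U> \<partial>\<U>)"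
    using n p by (intro nn_integral_unit_mono abs_mkz_op_powr_le) auto
  also have "\<dots> \<le> 2 * (\<integral>\<^sup>+x. ennreal (\<bar>G x\<bar> powr p) \<partial>\<U>)"
    using n by (intro nn_integral_mkz_kernel_twice_le) auto
  finally show ?thesis .
qed

text \<open>This licenses splitting \<open>mkz_op\<close> linearly. By Tonelli the integrals of the
  kernel times |F| have a finite integral over \<open>x\<close>, hence are finite almost
  everywhere.\<close>

lemma AE_integrable_mkz_kernel:
  assumes n: "1 \<le> n" and F: "integrable \<U> F"
  shows "AE x in \<U>. integrable \<U> (\<lambda>s. enn2real (mkz_kernel n x s) * F s)"
proof -
  have [measurable]: "F \<in> borel_measurable borel" using borel_measurable_integrable[OF F] by simp
  have "(\<integral>\<^sup>+x. \<integral>\<^sup>+s. mkz_kernel n x s * ennreal \<bar>F s\<bar> \<partial>\<U> \<partial>\<U>) \<le> 2 * (\<integral>\<^sup>+s. ennreal \<bar>F s\<bar> \<partial>\<U>)"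
    using n by (intro nn_integral_mkz_kernel_twice_le) auto
  also have "\<dots> < \<infinity>"
    using F by (simp add: integrable_iff_bounded ennreal_mult_less_top)
  finally have "AE x in \<U>. (\<integral>\<^sup>+s. mkz_kernel n x s * ennreal \<bar>F s\<bar> \<partial>\<U>) \<noteq> \<infinity>"
    by (intro nn_integral_PInf_AE) auto
  moreover have "AE x in \<U>. 0 \<le> x \<and> x < 1" by (rule AE_unit_measureI) simp
  ultimately show ?thesis
  proof eventually_elim
    case (elim x)
    have "(\<integral>\<^sup>+s. ennreal (norm (enn2real (mkz_kernel n x s) * F s)) \<partial>\<U>) = (\<integral>\<^sup>+s. mkz_kernel n x s * ennreal \<bar>F s\<bar> \<partial>\<U>)"
      using elim n by (intro nn_integral_unit_cong) (simp add: abs_mult ennreal_mult ennreal_enn2real_mkz_kernel)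
    with elim show ?case
      by (intro integrableI_bounded) (auto simp: top.not_eq_extremum)
  qed
qed

section \<open>Mass that the kernel carries across grid points\<close>

definition crossing :: "real \<Rightarrow> real \<Rightarrow> real \<Rightarrow> ennreal"
  where "crossing t x s = (if (x < t \<and> t \<le> s) \<or> (s < t \<and> t \<le> x) then 1 else 0)"

lemma crossing_measurable [measurable (raw)]:
  assumes [measurable]: "f \<in> borel_measurable M" "g \<in> borel_measurable M"
  shows "(\<lambda>z. crossing t (f z) (g z)) \<in> borel_measurable M"
  unfolding crossing_def by measurable

text \<open>If \<open>t\<close> separates the points, then |s - t| <= |s - x| and the quotient is at
  least 1. For fixed \<open>s\<close> the denominator does not depend on \<open>x\<close>, and the
  weight \<open>n\<close> in the numerator balances the second moment 4 / n.\<close>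

lemma crossing_le: "crossing t x s \<le> ennreal ((1 + real n * (s - x)\<^sup>2) / (1 + real n * (s - t)\<^sup>2))"
proof -
  have "1 \<le> (1 + real n * (s - x)\<^sup>2) / (1 + real n * (s - t)\<^sup>2)" if "(x < t \<and> t \<le> s) \<or> (s < t \<and> t \<le> x)"
  proof -
    have "\<bar>s - t\<bar> \<le> \<bar>s - x\<bar>" using that by auto
    then have "(s - t)\<^sup>2 \<le> (s - x)\<^sup>2" by (simp add: abs_le_square_iff)
    then have "1 + real n * (s - t)\<^sup>2 \<le> 1 + real n * (s - x)\<^sup>2" by (intro add_left_mono mult_left_mono) auto
    moreover have "0 < 1 + real n * (s - t)\<^sup>2" by (intro add_pos_nonneg) auto
    ultimately show ?thesis by simp
  qed
  then show ?thesis by (auto simp: crossing_def simp flip: ennreal_1 intro!: ennreal_leI)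
qed

text \<open>The antiderivative is \<open>6 / sqrt n * arctan (sqrt n * (s - t))\<close>; two values
  of arctan differ by less than pi < 4, and 6 * 4 = 24.\<close>

lemma nn_integral_cauchy_kernel_le:
  assumes n: "1 \<le> n"
  shows "(\<integral>\<^sup>+s. ennreal (6 / (1 + real n * (s - t)\<^sup>2)) \<partial>\<U>) \<le> ennreal (24 / sqrt n)"
proof -
  define I where "I = 6 / sqrt n * arctan (sqrt n * (1 - t)) - 6 / sqrt n * arctan (sqrt n * (0 - t))"
  have "((\<lambda>s. 6 / (1 + real n * (s - t)\<^sup>2)) has_integral I) {0..1}"
    unfolding I_def
  proof (rule fundamental_theorem_of_calculus)
    fix s :: real assume "s \<in> {0..1}"
    have "((\<lambda>s. sqrt n * (s - t)) has_real_derivative sqrt n) (at s)"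
      by (auto intro!: derivative_eq_intros)
    from DERIV_cmult[OF DERIV_chain2[OF DERIV_arctan this], of "6 / sqrt n"]
    have "((\<lambda>s. 6 / sqrt n * arctan (sqrt n * (s - t))) has_real_derivative
       6 / sqrt n * (inverse (1 + (sqrt n * (s - t))\<^sup>2) * sqrt n)) (at s)" .
    also have "6 / sqrt n * (inverse (1 + (sqrt n * (s - t))\<^sup>2) * sqrt n) = 6 / (1 + real n * (s - t)\<^sup>2)"
      using n by (simp add: power_mult_distrib divide_inverse)
    finally show "((\<lambda>s. 6 / sqrt n * arctan (sqrt n * (s - t))) has_vector_derivative 6 / (1 + real n * (s - t)\<^sup>2)) (at s within {0..1})"
      by (simp add: has_real_derivative_iff_has_vector_derivative has_vector_derivative_at_within)
  qed simp
  then have "(\<integral>\<^sup>+s. ennreal (6 / (1 + real n * (s - t)\<^sup>2)) \<partial>\<U>) = ennreal I"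
    by (intro nn_integral_unit_has_integral) auto
  also have "I = 6 / sqrt n * (arctan (sqrt n * (1 - t)) - arctan (sqrt n * (0 - t)))"
    by (simp add: I_def right_diff_distrib)
  also have "\<dots> \<le> 6 / sqrt n * 4"
    using arctan_ubound[of "sqrt n * (1 - t)"] arctan_lbound[of "sqrt n * (0 - t)"] pi_less_4
    by (intro mult_left_mono) auto
  finally show ?thesis using n by (auto intro: ennreal_leI)
qed

lemma nn_integral_mkz_kernel_crossing:
  assumes n: "1 \<le> n"
  shows "(\<integral>\<^sup>+x. \<integral>\<^sup>+s. mkz_kernel n x s * crossing t x s \<partial>\<U> \<partial>\<U>) \<le> ennreal (24 / sqrt n)"
proof -
  have "(\<integral>\<^sup>+x. \<integral>\<^sup>+s. mkz_kernel n x s * crossing t x s \<partial>\<U> \<partial>\<U>) = (\<integral>\<^sup>+s. \<integral>\<^sup>+x. mkz_kernel n x s * crossing t x s \<partial>\<U> \<partial>\<U>)"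
    by (rule unit_measure2.Fubini') measurable
  also have "\<dots> \<le> (\<integral>\<^sup>+s. ennreal (6 / (1 + real n * (s - t)\<^sup>2)) \<partial>\<U>)"
  proof (rule nn_integral_unit_mono)
    fix s :: real assume s: "0 \<le> s" "s < 1"
    define c where "c = 1 / (1 + real n * (s - t)\<^sup>2)"
    have c: "0 \<le> c" by (simp add: c_def)
    have "(\<integral>\<^sup>+x. mkz_kernel n x s * crossing t x s \<partial>\<U>)
      \<le> (\<integral>\<^sup>+x. ennreal c * (mkz_kernel n x s + ennreal (real n) * (mkz_kernel n x s * ennreal ((s - x)\<^sup>2))) \<partial>\<U>)"
    proof (intro nn_integral_mono)
      fix x
      have "mkz_kernel n x s * crossing t x s \<le> mkz_kernel n x s * ennreal ((1 + real n * (s - x)\<^sup>2) * c)"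
        using crossing_le[of t x s n] by (intro mult_left_mono) (simp_all add: c_def)
      also have "ennreal ((1 + real n * (s - x)\<^sup>2) * c) = (1 + ennreal (real n) * ennreal ((s - x)\<^sup>2)) * ennreal c"
        using c by (subst ennreal_mult, simp, simp, subst ennreal_plus) (simp_all add: ennreal_mult)
      also have "mkz_kernel n x s * \<dots> = ennreal c * (mkz_kernel n x s + ennreal (real n) * (mkz_kernel n x s * ennreal ((s - x)\<^sup>2)))"
        by (simp add: distrib_left distrib_right mult_ac)
      finally show "mkz_kernel n x s * crossing t x s \<le> \<dots>" .
    qed
    also have "\<dots> = ennreal c * ((\<integral>\<^sup>+x. mkz_kernel n x s \<partial>\<U>) + ennreal (real n) * (\<integral>\<^sup>+x. mkz_kernel n x s * ennreal ((s - x)\<^sup>2) \<partial>\<U>))"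
      by (simp add: nn_integral_cmult nn_integral_add)
    \<comment> \<open>Origin of the 6: mass 2 plus n times the second moment 4 / n.\<close>
    also have "\<dots> \<le> ennreal c * (2 + ennreal (real n) * ennreal (4 / n))"
      using n s by (intro mult_left_mono add_mono nn_integral_mkz_kernel_right_le mkz_kernel_variance_right) auto
    also have "ennreal (real n) * ennreal (4 / n) = ennreal 4"
      using n by (simp flip: ennreal_mult)
    also have "ennreal c * (2 + ennreal 4) = ennreal c * ennreal 6"
      by (simp flip: ennreal_numeral ennreal_plus)
    also have "\<dots> = ennreal (c * 6)"
      by (rule ennreal_mult[symmetric]) (use c in auto)
    also have "c * 6 = 6 / (1 + real n * (s - t)\<^sup>2)"
      by (simp add: c_def)
    finally show "(\<integral>\<^sup>+x. mkz_kernel n x s * crossing t x s \<partial>\<U>) \<le> \<dots>" .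
  qed
  also have "\<dots> \<le> ennreal (24 / sqrt n)"
    by (rule nn_integral_cauchy_kernel_le[OF n])
  finally show ?thesis .
qed

text \<open>The strict and weak inequalities in \<open>crossing\<close> match the half-open cells: a
  grid point belongs to the cell on its right.\<close>

lemma crossing_cell_index:
  assumes "1 \<le> m" "0 \<le> x" "0 \<le> s" "1 \<le> j"
  shows "crossing (real j / real m) x s =
    indicator ({cell_index m x<..cell_index m s} \<union> {cell_index m s<..cell_index m x}) j"
  using cell_index_less_iff[of m x j] cell_index_less_iff[of m s j] assms
  by (auto simp: crossing_def indicator_def not_less[symmetric])

text \<open>The sum counts the integers between two floors, whose distance exceeds that of their
  arguments by less than 1.\<close>

lemma sum_crossing_le:
  assumes m: "1 \<le> m" and x: "0 \<le> x" "x < 1" and s: "0 \<le> s" "s < 1"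
  shows "(\<Sum>j\<in>{1..<m}. crossing (real j / real m) x s) \<le> ennreal (1 + real m * \<bar>s - x\<bar>)"
proof -
  let ?a = "cell_index m x" and ?b = "cell_index m s"
  let ?A = "{?a<..?b} \<union> {?b<..?a}"
  have "(\<Sum>j\<in>{1..<m}. crossing (real j / real m) x s) = (\<Sum>j\<in>{1..<m}. indicator ?A j)"
    using m x s by (intro sum.cong crossing_cell_index) auto
  also have "\<dots> = (\<Sum>j\<in>{1..<m} \<inter> ?A. 1)"
    by (intro sum.mono_neutral_cong_right) (auto simp: indicator_def)
  also have "\<dots> = ennreal (real (card ({1..<m} \<inter> ?A)))"
    by (simp add: ennreal_of_nat_eq_real_of_nat)
  also have "\<dots> \<le> ennreal (real (card ?A))"
    by (intro ennreal_leI of_nat_mono card_mono) auto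
  also have "card ?A \<le> (?b - ?a) + (?a - ?b)"
    using card_Un_le[of "{?a<..?b}" "{?b<..?a}"] by simp
  also have "real ((?b - ?a) + (?a - ?b)) \<le> 1 + real m * \<bar>s - x\<bar>"
  proof -
    have "real ?a = of_int \<lfloor>real m * x\<rfloor>" "real ?b = of_int \<lfloor>real m * s\<rfloor>"
      using x s by (simp_all add: cell_index_def)
    moreover have "real ((?b - ?a) + (?a - ?b)) = \<bar>real ?b - real ?a\<bar>"
      by (cases "?a \<le> ?b") (auto simp: of_nat_diff)
    moreover have "\<bar>real m * s - real m * x\<bar> = real m * \<bar>s - x\<bar>"
      by (simp add: abs_mult flip: right_diff_distrib)
    ultimately show ?thesis by linarith
  qed
  finally show ?thesis by (simp add: ennreal_leI)
qed

lemma telescope_abs_le: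
  fixes c :: "nat \<Rightarrow> real"
  assumes "a \<le> b"
  shows "\<bar>c b - c a\<bar> \<le> (\<Sum>j\<in>{a<..b}. \<bar>c (j - 1) - c j\<bar>)"
  using assms
proof (induction b rule: dec_induct)
  case (step k)
  have "{a<..Suc k} = insert (Suc k) {a<..k}" using step by auto
  with step show ?case by simp
qed simp

text \<open>Telescoping from the cell of \<open>x\<close> to the cell of \<open>s\<close>; each jump
  on the way carries the crossing indicator of its grid point.\<close>

lemma step_approx_diff_le:
  assumes m: "1 \<le> m" and x: "0 \<le> x" "x < 1" and s: "0 \<le> s" "s < 1"
  shows "ennreal \<bar>step_approx m F s - step_approx m F x\<bar>
    \<le> (\<Sum>j\<in>{1..<m}. crossing (real j / real m) x s * ennreal \<bar>cell_mean m F (j - 1) - cell_mean m F j\<bar>)"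
proof -
  let ?a = "cell_index m x" and ?b = "cell_index m s" and ?c = "cell_mean m F"
  let ?A = "{?a<..?b} \<union> {?b<..?a}"
  have ab: "?a < m" "?b < m" using cell_index_less m x s by auto
  have "\<bar>?c ?b - ?c ?a\<bar> \<le> (\<Sum>j\<in>?A. \<bar>?c (j - 1) - ?c j\<bar>)"
    using telescope_abs_le[of ?a ?b ?c] telescope_abs_le[of ?b ?a ?c]
    by (cases "?a \<le> ?b") (auto simp: abs_minus_commute)
  also have "(\<Sum>j\<in>?A. \<bar>?c (j - 1) - ?c j\<bar>) = (\<Sum>j\<in>{1..<m}. indicator ?A j * \<bar>?c (j - 1) - ?c j\<bar>)"
    using ab by (intro sum.mono_neutral_cong_left) (auto simp: indicator_def)
  finally have "ennreal \<bar>?c ?b - ?c ?a\<bar> \<le> ennreal (\<Sum>j\<in>{1..<m}. indicator ?A j * \<bar>?c (j - 1) - ?c j\<bar>)"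
    by (rule ennreal_leI)
  also have "\<dots> = (\<Sum>j\<in>{1..<m}. ennreal (indicator ?A j * \<bar>?c (j - 1) - ?c j\<bar>))"
    by (rule sum_ennreal[symmetric]) simp
  also have "\<dots> = (\<Sum>j\<in>{1..<m}. crossing (real j / real m) x s * ennreal \<bar>?c (j - 1) - ?c j\<bar>)"
    using m x s by (intro sum.cong refl) (auto simp: crossing_cell_index indicator_def)
  finally show ?thesis by (simp add: step_approx_def)
qed

lemma integrable_enn2real_mkz_kernel:
  assumes n: "1 \<le> n" and x: "0 \<le> x" "x < 1"
  shows "integrable \<U> (\<lambda>s. enn2real (mkz_kernel n x s))" "(LINT s|\<U>. enn2real (mkz_kernel n x s)) = 1"
proof -
  have "(\<integral>\<^sup>+s. ennreal (enn2real (mkz_kernel n x s)) \<partial>\<U>) = (\<integral>\<^sup>+s. mkz_kernel n x s \<partial>\<U>)"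
    by (intro nn_integral_unit_cong) (simp add: ennreal_enn2real_mkz_kernel[OF n x])
  also have "\<dots> = 1" by (rule nn_integral_mkz_kernel_left_1) fact+
  finally have 1: "(\<integral>\<^sup>+s. ennreal (enn2real (mkz_kernel n x s)) \<partial>\<U>) = 1" .
  then show "integrable \<U> (\<lambda>s. enn2real (mkz_kernel n x s))"
    by (intro integrableI_nonneg) auto
  show "(LINT s|\<U>. enn2real (mkz_kernel n x s)) = 1"
    using 1 by (subst integral_eq_nn_integral) auto
qed

lemma integrable_mkz_kernel_step:
  assumes n: "1 \<le> n" and m: "1 \<le> m" and x: "0 \<le> x" "x < 1"
  shows "integrable \<U> (\<lambda>s. enn2real (mkz_kernel n x s) * step_approx m F s)"
proof -
  define B where "B = (\<Sum>j<m. \<bar>cell_mean m F j\<bar>)"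
  have "integrable \<U> (\<lambda>s. B * enn2real (mkz_kernel n x s))"
    by (intro integrable_mult_right integrable_enn2real_mkz_kernel n x)
  then show ?thesis
  proof (rule Bochner_Integration.integrable_bound)
    show "AE s in \<U>. norm (enn2real (mkz_kernel n x s) * step_approx m F s) \<le> norm (B * enn2real (mkz_kernel n x s))"
    proof (rule AE_unit_measureI)
      fix s :: real assume s: "0 \<le> s" "s < 1"
      have "\<bar>step_approx m F s\<bar> \<le> B"
        unfolding step_approx_def B_def using cell_index_less[OF m s] by (intro member_le_sum) auto
      then show "norm (enn2real (mkz_kernel n x s) * step_approx m F s) \<le> norm (B * enn2real (mkz_kernel n x s))"
        using mult_right_mono[of "\<bar>step_approx m F s\<bar>" B "enn2real (mkz_kernel n x s)"]
        by (simp add: abs_mult mult.commute)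
    qed
  qed measurable
qed

lemma sum_mkz_kernel_crossing_le:
  assumes n: "1 \<le> n" and m: "1 \<le> m" "real m \<le> 3 * sqrt n" and x: "0 \<le> x" "x < 1"
  shows "(\<Sum>j\<in>{1..<m}. \<integral>\<^sup>+s. mkz_kernel n x s * crossing (real j / real m) x s \<partial>\<U>) \<le> ennreal 9"
proof -
  have "(\<Sum>j\<in>{1..<m}. \<integral>\<^sup>+s. mkz_kernel n x s * crossing (real j / real m) x s \<partial>\<U>)
     = (\<integral>\<^sup>+s. mkz_kernel n x s * (\<Sum>j\<in>{1..<m}. crossing (real j / real m) x s) \<partial>\<U>)"
    by (simp add: nn_integral_sum sum_distrib_left)
  \<comment> \<open>With u = sqrt n |s - x| and u <= (1 + u^2) / 2, the count 1 + m |s - x| <= 1 + 3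
    u is at most 5 / 2 + (3 / 2) n (s - x)^2. Integrated this is at most 5 / 2 + 6 = 17 / 2.\<close>
  also have "\<dots> \<le> (\<integral>\<^sup>+s. ennreal (5 / 2) * mkz_kernel n x s + ennreal (3 / 2 * n) * (mkz_kernel n x s * ennreal ((s - x)\<^sup>2)) \<partial>\<U>)"
  proof (rule nn_integral_unit_mono)
    fix s :: real assume s: "0 \<le> s" "s < 1"
    have "real m * \<bar>s - x\<bar> \<le> 3 * (sqrt n * \<bar>s - x\<bar>)"
      using m(2) mult_right_mono[of "real m" "3 * sqrt n" "\<bar>s - x\<bar>"] by (simp add: mult.assoc)
    also have "\<dots> \<le> 3 * ((1 + (sqrt n * \<bar>s - x\<bar>)\<^sup>2) / 2)"
      using zero_le_power2[of "1 - sqrt n * \<bar>s - x\<bar>"]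
      by (intro mult_left_mono) (simp_all add: power2_eq_square algebra_simps)
    also have "(sqrt n * \<bar>s - x\<bar>)\<^sup>2 = real n * (s - x)\<^sup>2"
      by (simp add: power_mult_distrib)
    finally have "1 + real m * \<bar>s - x\<bar> \<le> 5 / 2 + 3 / 2 * real n * (s - x)\<^sup>2" by simp
    then have "(\<Sum>j\<in>{1..<m}. crossing (real j / real m) x s) \<le> ennreal (5 / 2 + 3 / 2 * real n * (s - x)\<^sup>2)"
      by (intro order_trans[OF sum_crossing_le[OF m(1) x s]] ennreal_leI)
    also have "\<dots> = ennreal (5 / 2) + ennreal (3 / 2 * n) * ennreal ((s - x)\<^sup>2)"
      by (subst ennreal_plus, simp, simp, subst ennreal_mult''[symmetric]) simp_all
    finally have "mkz_kernel n x s * (\<Sum>j\<in>{1..<m}. crossing (real j / real m) x s) \<le> mkz_kernel n x s * \<dots>"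
      by (rule mult_left_mono) simp
    also have "\<dots> = ennreal (5 / 2) * mkz_kernel n x s + ennreal (3 / 2 * n) * (mkz_kernel n x s * ennreal ((s - x)\<^sup>2))"
      by (simp only: distrib_left mult_ac)
    finally show "mkz_kernel n x s * (\<Sum>j\<in>{1..<m}. crossing (real j / real m) x s) \<le> \<dots>" .
  qed
  also have "\<dots> = ennreal (5 / 2) * (\<integral>\<^sup>+s. mkz_kernel n x s \<partial>\<U>) + ennreal (3 / 2 * n) * (\<integral>\<^sup>+s. mkz_kernel n x s * ennreal ((s - x)\<^sup>2) \<partial>\<U>)"
    by (simp add: nn_integral_cmult nn_integral_add)
  also have "\<dots> \<le> ennreal (5 / 2) * 1 + ennreal (3 / 2 * n) * ennreal (4 / n)"
    using nn_integral_mkz_kernel_left_1[OF n x] mkz_kernel_variance_left[OF n x]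
    by (intro add_mono mult_left_mono) auto
  also have "ennreal (3 / 2 * n) * ennreal (4 / n) = ennreal 6"
    using n by (simp flip: ennreal_mult)
  also have "ennreal (5 / 2) * 1 + ennreal 6 = ennreal (17 / 2)"
    by (subst mult_1_right, subst ennreal_plus[symmetric]) auto
  also have "\<dots> \<le> ennreal 9" by (intro ennreal_leI) simp
  finally show ?thesis .
qed

text \<open>The power mean inequality for the counting measure on the grid points, the weights being
  the kernel masses across them, at most 9 in total.\<close>

lemma mkz_step_pointwise:
  assumes n: "1 \<le> n" and m: "1 \<le> m" "real m \<le> 3 * sqrt n" and p: "1 \<le> p" and x: "0 \<le> x" "x < 1"
  shows "ennreal (\<bar>LINT s|\<U>. enn2real (mkz_kernel n x s) * (step_approx m F s - step_approx m F x)\<bar> powr p)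
    \<le> ennreal (9 powr (p - 1)) * (\<Sum>j\<in>{1..<m}. (\<integral>\<^sup>+s. mkz_kernel n x s * crossing (real j / real m) x s \<partial>\<U>)
         * ennreal (\<bar>cell_mean m F (j - 1) - cell_mean m F j\<bar> powr p))"
proof -
  let ?k = "\<lambda>j. \<integral>\<^sup>+s. mkz_kernel n x s * crossing (real j / real m) x s \<partial>\<U>"
  let ?d = "\<lambda>j. \<bar>cell_mean m F (j - 1) - cell_mean m F j\<bar>"
  let ?J = "{1..<m}"
  have k: "(\<Sum>j\<in>?J. ?k j) \<le> ennreal 9" by (rule sum_mkz_kernel_crossing_le) fact+
  \<comment> \<open>Finiteness is what allows the later passage through \<open>enn2real\<close>,
    which would send an infinite sum to 0.\<close>
  have fin: "?k j < \<top>" if "j \<in> ?J" for j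
  proof -
    have "?k j \<le> (\<Sum>j\<in>?J. ?k j)" using that by (intro member_le_sum) auto
    also note k
    also have "ennreal 9 < \<top>" by (rule ennreal_less_top)
    finally show ?thesis .
  qed
  have "\<bar>LINT s|\<U>. enn2real (mkz_kernel n x s) * (step_approx m F s - step_approx m F x)\<bar>
     \<le> enn2real (\<integral>\<^sup>+s. ennreal \<bar>enn2real (mkz_kernel n x s) * (step_approx m F s - step_approx m F x)\<bar> \<partial>\<U>)"
    by (rule abs_integral_le_enn2real)
  also have "\<dots> \<le> enn2real (\<Sum>j\<in>?J. ?k j * ennreal (?d j))"
  proof (rule enn2real_mono)
    have "(\<integral>\<^sup>+s. ennreal \<bar>enn2real (mkz_kernel n x s) * (step_approx m F s - step_approx m F x)\<bar> \<partial>\<U>)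
       \<le> (\<integral>\<^sup>+s. (\<Sum>j\<in>?J. mkz_kernel n x s * crossing (real j / real m) x s * ennreal (?d j)) \<partial>\<U>)"
    proof (rule nn_integral_unit_mono)
      fix s :: real assume s: "0 \<le> s" "s < 1"
      have "ennreal \<bar>enn2real (mkz_kernel n x s) * (step_approx m F s - step_approx m F x)\<bar>
         = mkz_kernel n x s * ennreal \<bar>step_approx m F s - step_approx m F x\<bar>"
        by (simp add: abs_mult ennreal_mult ennreal_enn2real_mkz_kernel[OF n x s])
      also have "\<dots> \<le> mkz_kernel n x s * (\<Sum>j\<in>?J. crossing (real j / real m) x s * ennreal (?d j))"
        using step_approx_diff_le[OF m(1) x s] by (intro mult_left_mono) auto
      finally show "ennreal \<bar>enn2real (mkz_kernel n x s) * (step_approx m F s - step_approx m F x)\<bar>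
          \<le> (\<Sum>j\<in>?J. mkz_kernel n x s * crossing (real j / real m) x s * ennreal (?d j))"
        by (simp only: sum_distrib_left mult.assoc)
    qed
    also have "\<dots> = (\<Sum>j\<in>?J. ?k j * ennreal (?d j))"
      by (simp add: nn_integral_sum nn_integral_multc)
    finally show "(\<integral>\<^sup>+s. ennreal \<bar>enn2real (mkz_kernel n x s) * (step_approx m F s - step_approx m F x)\<bar> \<partial>\<U>) \<le> \<dots>" .
    show "(\<Sum>j\<in>?J. ?k j * ennreal (?d j)) < \<top>"
      using fin by (simp add: ennreal_mult_less_top)
  qed
  finally have "ennreal (\<bar>LINT s|\<U>. enn2real (mkz_kernel n x s) * (step_approx m F s - step_approx m F x)\<bar> powr p)
     \<le> ennreal (enn2real (\<Sum>j\<in>?J. ?k j * ennreal (?d j)) powr p)"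
    using p by (intro ennreal_leI powr_mono2) auto
  also have "\<dots> \<le> ennreal (9 powr (p - 1)) * (\<Sum>j\<in>?J. ?k j * ennreal (?d j powr p))"
    using nn_integral_power_mean[of ?k "count_space ?J" ?d p 9] p k
    by (simp add: nn_integral_count_space_finite)
  finally show ?thesis .
qed

text \<open>With m <= 3 sqrt n the factors 24 / sqrt n and 4 m multiply to at most 24 * 4 * 3 = 288.
  Enlarging the 9 in \<open>9 powr (p - 1)\<close> to 288 then completes a pure p-th power.\<close>

lemma mkz_step_bound:
  assumes n: "1 \<le> n" and m: "1 \<le> m" "real m \<le> 3 * sqrt n" and p: "1 \<le> p" and w: "0 \<le> w"
    and jumps: "(\<Sum>j\<in>{1..<m}. ennreal (\<bar>cell_mean m F (j - 1) - cell_mean m F j\<bar> powr p)) \<le> ennreal (4 * real m * w powr p)"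
  shows "(\<integral>\<^sup>+x. ennreal (\<bar>LINT s|\<U>. enn2real (mkz_kernel n x s) * (step_approx m F s - step_approx m F x)\<bar> powr p) \<partial>\<U>)
    \<le> ennreal ((288 * w) powr p)"
proof -
  let ?d = "\<lambda>j. ennreal (\<bar>cell_mean m F (j - 1) - cell_mean m F j\<bar> powr p)"
  have "(\<integral>\<^sup>+x. ennreal (\<bar>LINT s|\<U>. enn2real (mkz_kernel n x s) * (step_approx m F s - step_approx m F x)\<bar> powr p) \<partial>\<U>)
    \<le> (\<integral>\<^sup>+x. ennreal (9 powr (p - 1)) * (\<Sum>j\<in>{1..<m}. (\<integral>\<^sup>+s. mkz_kernel n x s * crossing (real j / real m) x s \<partial>\<U>) * ?d j) \<partial>\<U>)"
    using n m p by (intro nn_integral_unit_mono mkz_step_pointwise) auto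
  also have "\<dots> = ennreal (9 powr (p - 1)) * (\<Sum>j\<in>{1..<m}. (\<integral>\<^sup>+x. \<integral>\<^sup>+s. mkz_kernel n x s * crossing (real j / real m) x s \<partial>\<U> \<partial>\<U>) * ?d j)"
    by (simp add: nn_integral_cmult nn_integral_sum nn_integral_multc)
  also have "\<dots> \<le> ennreal (9 powr (p - 1)) * (\<Sum>j\<in>{1..<m}. ennreal (24 / sqrt n) * ?d j)"
    using n by (intro mult_left_mono sum_mono mult_right_mono nn_integral_mkz_kernel_crossing) auto
  also have "\<dots> \<le> ennreal (9 powr (p - 1)) * (ennreal (24 / sqrt n) * ennreal (4 * real m * w powr p))"
    unfolding sum_distrib_left[symmetric] using jumps by (intro mult_left_mono) auto
  also have "\<dots> = ennreal (9 powr (p - 1) * (24 / sqrt n * (4 * real m * w powr p)))"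
    by (subst ennreal_mult, simp, simp, subst ennreal_mult) auto
  also have "\<dots> \<le> ennreal ((288 * w) powr p)"
  proof (rule ennreal_leI)
    have "24 / sqrt n * (4 * real m * w powr p) = 96 * (real m / sqrt n) * w powr p" by simp
    also have "\<dots> \<le> 96 * 3 * w powr p"
      using m(2) n by (intro mult_right_mono mult_left_mono) (auto simp: divide_le_eq)
    finally have "24 / sqrt n * (4 * real m * w powr p) \<le> 288 * w powr p" by simp
    then have "9 powr (p - 1) * (24 / sqrt n * (4 * real m * w powr p)) \<le> 288 powr (p - 1) * (288 * w powr p)"
      using p by (rule_tac mult_mono[OF powr_mono2]) auto
    also have "\<dots> = (288 * w) powr p"
      by (simp add: powr_mult powr_diff)
    finally show "9 powr (p - 1) * (24 / sqrt n * (4 * real m * w powr p)) \<le> (288 * w) powr p" .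
  qed
  finally show ?thesis .
qed

text \<open>Moves constants under the p-th power, where they remain independent of \<open>p\<close>
  after the root is taken.\<close>

lemma mult_powr_le:
  fixes w p c :: real
  assumes "1 \<le> p" "1 \<le> c" "0 \<le> w"
  shows "c * w powr p \<le> (c * w) powr p"
proof -
  have "c powr 1 \<le> c powr p" using assms by (intro powr_mono) auto
  then show ?thesis using assms by (simp add: powr_mult mult_right_mono)
qed

lemma mkz_op_error:
  assumes n: "1 \<le> n" and p: "1 \<le> p" and F: "integrable \<U> F" and w: "0 \<le> w"
    and mod: "\<And>h. 0 < h \<Longrightarrow> h \<le> 1 / sqrt n \<Longrightarrow>
       (\<integral>\<^sup>+x. ennreal (\<bar>F (x + h) - F x\<bar> powr p) * indicator {0..1 - h} x \<partial>lborel) \<le> ennreal (w powr p)"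
  shows "(\<integral>\<^sup>+x. ennreal (\<bar>mkz_op n F x - F x\<bar> powr p) \<partial>\<U>) \<le> ennreal ((300 * w) powr p)"
proof -
  have [measurable]: "F \<in> borel_measurable borel" using borel_measurable_integrable[OF F] by simp
  \<comment> \<open>The least \<open>m\<close> with 2 / m <= 1 / sqrt n, so that \<open>mod\<close>
    covers the strip; \<open>sqrt n >= 1\<close> yields m <= 3 sqrt n.\<close>
  define m where "m = nat \<lceil>2 * sqrt n\<rceil>"
  have sq: "1 \<le> sqrt n" using n by simp
  have m_ge: "2 * sqrt n \<le> real m" unfolding m_def by linarith
  have m: "1 \<le> m" "real m \<le> 3 * sqrt n"
    using sq unfolding m_def by linarith+
  have "2 / real m \<le> 1 / sqrt n"
    using m_ge sq m by (simp add: field_simps)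
  define D where "D = (\<integral>\<^sup>+x. \<integral>\<^sup>+y. indicator {..2 / real m} \<bar>x - y\<bar> * ennreal (\<bar>F x - F y\<bar> powr p) \<partial>\<U> \<partial>\<U>)"
  have D: "D \<le> ennreal (2 * (2 / real m)) * ennreal (w powr p)"
    unfolding D_def using \<open>2 / real m \<le> 1 / sqrt n\<close> by (intro nn_integral_near_diagonal mod) auto
  let ?S = "step_approx m F"
  let ?B = "\<lambda>x. LINT s|\<U>. enn2real (mkz_kernel n x s) * (?S s - ?S x)"
  have [measurable]: "?B \<in> borel_measurable \<U>"
    by (rule unit_measure.borel_measurable_lebesgue_integral) measurable
  have "(\<integral>\<^sup>+x. ennreal (\<bar>F x - ?S x\<bar> powr p) \<partial>\<U>) \<le> ennreal (real m) * D"
    unfolding D_def by (rule step_approx_error) fact+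
  also have "\<dots> \<le> ennreal (real m) * (ennreal (2 * (2 / real m)) * ennreal (w powr p))"
    by (intro mult_left_mono D) simp
  also have "\<dots> = ennreal (real m * (2 * (2 / real m) * w powr p))"
    by (subst ennreal_mult, simp, simp, subst ennreal_mult) auto
  also have "real m * (2 * (2 / real m) * w powr p) = 4 * w powr p"
    using m by simp
  finally have E: "(\<integral>\<^sup>+x. ennreal (\<bar>F x - ?S x\<bar> powr p) \<partial>\<U>) \<le> ennreal (4 * w powr p)" .
  have "(\<Sum>j\<in>{1..<m}. ennreal (\<bar>cell_mean m F (j - 1) - cell_mean m F j\<bar> powr p)) \<le> ennreal (real m * real m) * D"
    unfolding D_def by (rule cell_mean_jumps) fact+
  also have "\<dots> \<le> ennreal (real m * real m) * (ennreal (2 * (2 / real m)) * ennreal (w powr p))"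
    by (intro mult_left_mono D) simp
  also have "\<dots> = ennreal (real m * real m * (2 * (2 / real m) * w powr p))"
    by (subst ennreal_mult, simp, simp, subst ennreal_mult) auto
  also have "real m * real m * (2 * (2 / real m) * w powr p) = 4 * real m * w powr p"
    using m by simp
  finally have jumps: "(\<Sum>j\<in>{1..<m}. ennreal (\<bar>cell_mean m F (j - 1) - cell_mean m F j\<bar> powr p)) \<le> ennreal (4 * real m * w powr p)" .
  have 1: "(\<integral>\<^sup>+x. ennreal (\<bar>mkz_op n (\<lambda>s. F s - ?S s) x\<bar> powr p) \<partial>\<U>) \<le> ennreal ((8 * w) powr p)"
  proof -
    have "(\<integral>\<^sup>+x. ennreal (\<bar>mkz_op n (\<lambda>s. F s - ?S s) x\<bar> powr p) \<partial>\<U>) \<le> 2 * (\<integral>\<^sup>+x. ennreal (\<bar>F x - ?S x\<bar> powr p) \<partial>\<U>)"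
      by (intro mkz_op_bounded n p) measurable
    also have "\<dots> \<le> ennreal 2 * ennreal (4 * w powr p)"
      using E by (intro mult_mono) auto
    also have "\<dots> = ennreal (8 * w powr p)"
      by (subst ennreal_mult[symmetric]) auto
    also have "\<dots> \<le> ennreal ((8 * w) powr p)"
      using p w by (intro ennreal_leI mult_powr_le) auto
    finally show ?thesis .
  qed
  have 2: "(\<integral>\<^sup>+x. ennreal (\<bar>?B x\<bar> powr p) \<partial>\<U>) \<le> ennreal ((288 * w) powr p)"
    by (rule mkz_step_bound) fact+
  have 3: "(\<integral>\<^sup>+x. ennreal (\<bar>?S x - F x\<bar> powr p) \<partial>\<U>) \<le> ennreal ((4 * w) powr p)"
    using E p w by (subst abs_minus_commute) (elim order_trans, intro ennreal_leI mult_powr_le, auto)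
  \<comment> \<open>M F - F = M (F - S) + (M S - S) + (S - F), and the middle term is
    \<open>?B\<close> because the kernel has mass 1 in \<open>s\<close>. The splitting uses
    integrability of the kernel times \<open>F\<close>, which is known for almost every
    \<open>x\<close>.\<close>
  have "AE x in \<U>. mkz_op n F x - F x = mkz_op n (\<lambda>s. F s - ?S s) x + ?B x + (?S x - F x)"
  proof -
    have "AE x in \<U>. 0 \<le> x \<and> x < 1" by (rule AE_unit_measureI) simp
    with AE_integrable_mkz_kernel[OF n F] show ?thesis
    proof eventually_elim
      case (elim x)
      then have x: "0 \<le> x" "x < 1" by auto
      note I = elim(1) integrable_mkz_kernel_step[OF n m(1) x, of F] integrable_enn2real_mkz_kernel[OF n x]
      have "mkz_op n (\<lambda>s. F s - ?S s) x = mkz_op n F x - (LINT s|\<U>. enn2real (mkz_kernel n x s) * ?S s)"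
        unfolding mkz_op_def right_diff_distrib using I by (intro Bochner_Integration.integral_diff) auto
      moreover have "?B x = (LINT s|\<U>. enn2real (mkz_kernel n x s) * ?S s) - ?S x"
        unfolding right_diff_distrib using I by (subst Bochner_Integration.integral_diff) auto
      ultimately show ?case by simp
    qed
  qed
  then have "(\<integral>\<^sup>+x. ennreal (\<bar>mkz_op n F x - F x\<bar> powr p) \<partial>\<U>)
      = (\<integral>\<^sup>+x. ennreal (\<bar>mkz_op n (\<lambda>s. F s - ?S s) x + ?B x + (?S x - F x)\<bar> powr p) \<partial>\<U>)"
    by (intro nn_integral_cong_AE) (elim eventually_mono, simp only:)
  also have "\<dots> \<le> ennreal ((8 * w + 288 * w + 4 * w) powr p)"
    using p w by (intro Lp_triangle 1 2 3) auto
  finally show ?thesis by simp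
qed

section \<open>Continuity of translation\<close>

lemma nn_integral_shift:
  fixes f :: "real \<Rightarrow> ennreal"
  assumes "f \<in> borel_measurable borel"
  shows "(\<integral>\<^sup>+x. f (x + h) \<partial>lborel) = (\<integral>\<^sup>+x. f x \<partial>lborel)"
  using nn_integral_real_affine[of f 1 h] assms by (simp add: add.commute)

text \<open>Continuity of translation at shift 0 in L1, a property stable under sums and L1 limits,
  so that induction over integrable functions applies.\<close>

definition L1_continuous :: "(real \<Rightarrow> real) \<Rightarrow> bool"
  where "L1_continuous f \<longleftrightarrow> (\<forall>e>0. \<forall>\<^sub>F h in nhds 0. (\<integral>\<^sup>+x. ennreal \<bar>f (x + h) - f x\<bar> \<partial>lborel) \<le> ennreal e)"

text \<open>Three errors of size e / 3; translation invariance makes the shifted approximation error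
  equal to the unshifted one.\<close>

lemma L1_continuous_approx:
  assumes [measurable]: "f \<in> borel_measurable borel"
    and approx: "\<And>e. 0 < e \<Longrightarrow> \<exists>g\<in>borel_measurable borel. L1_continuous g \<and> (\<integral>\<^sup>+x. ennreal \<bar>f x - g x\<bar> \<partial>lborel) \<le> ennreal e"
  shows "L1_continuous f"
  unfolding L1_continuous_def
proof (intro allI impI)
  fix e :: real assume e: "0 < e"
  then obtain g where [measurable]: "g \<in> borel_measurable borel" and g: "L1_continuous g"
    and fg: "(\<integral>\<^sup>+x. ennreal \<bar>f x - g x\<bar> \<partial>lborel) \<le> ennreal (e / 3)"
    using approx[of "e / 3"] by auto
  have "\<forall>\<^sub>F h in nhds 0. (\<integral>\<^sup>+x. ennreal \<bar>g (x + h) - g x\<bar> \<partial>lborel) \<le> ennreal (e / 3)"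
    using g e by (simp add: L1_continuous_def)
  then show "\<forall>\<^sub>F h in nhds 0. (\<integral>\<^sup>+x. ennreal \<bar>f (x + h) - f x\<bar> \<partial>lborel) \<le> ennreal e"
  proof eventually_elim
    case (elim h)
    have "(\<integral>\<^sup>+x. ennreal \<bar>f (x + h) - f x\<bar> \<partial>lborel)
      \<le> (\<integral>\<^sup>+x. ennreal \<bar>f (x + h) - g (x + h)\<bar> + ennreal \<bar>g (x + h) - g x\<bar> + ennreal \<bar>f x - g x\<bar> \<partial>lborel)"
      by (intro nn_integral_mono) (simp flip: ennreal_plus add: ennreal_leI)
    also have "\<dots> = (\<integral>\<^sup>+x. ennreal \<bar>f (x + h) - g (x + h)\<bar> \<partial>lborel)
       + (\<integral>\<^sup>+x. ennreal \<bar>g (x + h) - g x\<bar> \<partial>lborel) + (\<integral>\<^sup>+x. ennreal \<bar>f x - g x\<bar> \<partial>lborel)"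
      by (simp add: nn_integral_add)
    also have "(\<integral>\<^sup>+x. ennreal \<bar>f (x + h) - g (x + h)\<bar> \<partial>lborel) = (\<integral>\<^sup>+x. ennreal \<bar>f x - g x\<bar> \<partial>lborel)"
      by (rule nn_integral_shift[of "\<lambda>x. ennreal \<bar>f x - g x\<bar>"]) measurable
    also have "(\<integral>\<^sup>+x. ennreal \<bar>f x - g x\<bar> \<partial>lborel) + (\<integral>\<^sup>+x. ennreal \<bar>g (x + h) - g x\<bar> \<partial>lborel) + (\<integral>\<^sup>+x. ennreal \<bar>f x - g x\<bar> \<partial>lborel)
      \<le> ennreal (e / 3) + ennreal (e / 3) + ennreal (e / 3)"
      by (intro add_mono fg elim)
    also have "\<dots> = ennreal e"
      using e by (simp flip: ennreal_plus)
    finally show ?case .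
  qed
qed

lemma L1_continuous_add:
  assumes [measurable]: "f \<in> borel_measurable borel" "g \<in> borel_measurable borel"
    and f: "L1_continuous f" and g: "L1_continuous g"
  shows "L1_continuous (\<lambda>x. f x + g x)"
  unfolding L1_continuous_def
proof (intro allI impI)
  fix e :: real assume e: "0 < e"
  have "\<forall>\<^sub>F h in nhds 0. (\<integral>\<^sup>+x. ennreal \<bar>f (x + h) - f x\<bar> \<partial>lborel) \<le> ennreal (e / 2)"
    "\<forall>\<^sub>F h in nhds 0. (\<integral>\<^sup>+x. ennreal \<bar>g (x + h) - g x\<bar> \<partial>lborel) \<le> ennreal (e / 2)"
    using f g e by (auto simp: L1_continuous_def)
  then show "\<forall>\<^sub>F h in nhds 0. (\<integral>\<^sup>+x. ennreal \<bar>f (x + h) + g (x + h) - (f x + g x)\<bar> \<partial>lborel) \<le> ennreal e"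
  proof eventually_elim
    case (elim h)
    have "(\<integral>\<^sup>+x. ennreal \<bar>f (x + h) + g (x + h) - (f x + g x)\<bar> \<partial>lborel)
      \<le> (\<integral>\<^sup>+x. ennreal \<bar>f (x + h) - f x\<bar> + ennreal \<bar>g (x + h) - g x\<bar> \<partial>lborel)"
      by (intro nn_integral_mono) (simp flip: ennreal_plus add: ennreal_leI)
    also have "\<dots> = (\<integral>\<^sup>+x. ennreal \<bar>f (x + h) - f x\<bar> \<partial>lborel) + (\<integral>\<^sup>+x. ennreal \<bar>g (x + h) - g x\<bar> \<partial>lborel)"
      by (simp add: nn_integral_add)
    also have "\<dots> \<le> ennreal (e / 2) + ennreal (e / 2)"
      by (intro add_mono elim)
    also have "\<dots> = ennreal e"
      using e by (simp flip: ennreal_plus)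
    finally show ?case .
  qed
qed

text \<open>At a point of \<open>U\<close> small shifts stay in \<open>U\<close> by openness, and
  elsewhere the product vanishes. Counting only departures from \<open>U\<close> thus gives
  convergence everywhere, even if the boundary of \<open>U\<close> has positive measure.\<close>

lemma indicator_open_shift_tendsto:
  fixes U :: "real set"
  assumes U: "open U" "emeasure lborel U < \<infinity>" and h: "h \<longlonglongrightarrow> 0"
  shows "(\<lambda>i. \<integral>\<^sup>+x. indicator U x * indicator (- U) (x + h i) \<partial>lborel) \<longlonglongrightarrow> 0"
proof -
  have [measurable]: "U \<in> sets borel" using U by simp
  have "(\<lambda>i. \<integral>\<^sup>+x. indicator U x * indicator (- U) (x + h i) \<partial>lborel) \<longlonglongrightarrow> (\<integral>\<^sup>+x. (0::ennreal) \<partial>(lborel :: real measure))"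
  proof (rule nn_integral_dominated_convergence[where w="indicator U"])
    show "(\<integral>\<^sup>+x. indicator U x \<partial>lborel) < \<infinity>" using U by simp
    show "AE x in lborel. (\<lambda>i. indicator U x * indicator (- U) (x + h i) :: ennreal) \<longlonglongrightarrow> 0"
    proof (rule AE_I2)
      fix x
      show "(\<lambda>i. indicator U x * indicator (- U) (x + h i) :: ennreal) \<longlonglongrightarrow> 0"
      proof (cases "x \<in> U")
        case True
        have "(\<lambda>i. x + h i) \<longlonglongrightarrow> x + 0" by (intro tendsto_intros h)
        then have "\<forall>\<^sub>F i in sequentially. x + h i \<in> U"
          using U True by (auto intro: topological_tendstoD)
        then show ?thesis
          by (intro tendsto_eventually) (elim eventually_mono, simp)
      qed simp
    qed
  qed (auto simp: indicator_def)
  then show ?thesis by simp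
qed

lemma L1_continuous_indicator_open:
  fixes U :: "real set"
  assumes U: "open U" "emeasure lborel U < \<infinity>"
  shows "L1_continuous (\<lambda>x. c * indicator U x)"
  unfolding L1_continuous_def
proof (intro allI impI)
  fix e :: real assume e: "0 < e"
  have [measurable]: "U \<in> sets borel" using U by simp
  \<comment> \<open>Dominated convergence concerns sequences. The rule that carries them over to the
    filter speaks of neighbourhoods within a set, here \<open>UNIV\<close>.\<close>
  have "eventually (\<lambda>h. (\<integral>\<^sup>+x. ennreal \<bar>c * indicator U (x + h) - c * indicator U x\<bar> \<partial>lborel) \<le> ennreal e) (inf (nhds 0) (principal UNIV))"
  proof (intro sequentially_imp_eventually_nhds_within allI impI)
    fix h :: "nat \<Rightarrow> real" assume "(\<forall>n. h n \<in> UNIV) \<and> h \<longlonglongrightarrow> 0"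
    then have h: "h \<longlonglongrightarrow> 0" "(\<lambda>i. - h i) \<longlonglongrightarrow> 0"
      using tendsto_minus[of h 0] by auto
    \<comment> \<open>The difference of the indicators splits into leaving and entering
      \<open>U\<close>; a translation turns entering into leaving under the shift
      \<open>- h\<close>.\<close>
    have eq: "(\<integral>\<^sup>+x. ennreal \<bar>c * indicator U (x + h) - c * indicator U x\<bar> \<partial>lborel)
      = ennreal \<bar>c\<bar> * ((\<integral>\<^sup>+x. indicator U x * indicator (- U) (x + - h) \<partial>lborel) + (\<integral>\<^sup>+x. indicator U x * indicator (- U) (x + h) \<partial>lborel))" for h
    proof -
      have "(\<integral>\<^sup>+x. ennreal \<bar>c * indicator U (x + h) - c * indicator U x\<bar> \<partial>lborel)
        = (\<integral>\<^sup>+x. ennreal \<bar>c\<bar> * (indicator U (x + h) * indicator (- U) (x + h + - h) + indicator U x * indicator (- U) (x + h)) \<partial>lborel)"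
        by (intro nn_integral_cong) (auto simp: indicator_def)
      also have "\<dots> = ennreal \<bar>c\<bar> * ((\<integral>\<^sup>+x. indicator U (x + h) * indicator (- U) (x + h + - h) \<partial>lborel) + (\<integral>\<^sup>+x. indicator U x * indicator (- U) (x + h) \<partial>lborel))"
        by (subst nn_integral_cmult) (simp_all add: nn_integral_add)
      also have "(\<integral>\<^sup>+x. indicator U (x + h) * indicator (- U) (x + h + - h) \<partial>lborel) = (\<integral>\<^sup>+x. indicator U x * indicator (- U) (x + - h) \<partial>lborel)"
        by (rule nn_integral_shift[of "\<lambda>x. indicator U x * indicator (- U) (x + - h)"]) measurable
      finally show ?thesis .
    qed
    have "(\<lambda>i. \<integral>\<^sup>+x. ennreal \<bar>c * indicator U (x + h i) - c * indicator U x\<bar> \<partial>lborel) \<longlonglongrightarrow> ennreal \<bar>c\<bar> * (0 + 0)"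
      unfolding eq using indicator_open_shift_tendsto[OF U h(1)] indicator_open_shift_tendsto[OF U h(2)]
      by (intro ennreal_tendsto_cmult tendsto_add) auto
    then have "\<forall>\<^sub>F i in sequentially. (\<integral>\<^sup>+x. ennreal \<bar>c * indicator U (x + h i) - c * indicator U x\<bar> \<partial>lborel) < ennreal e"
      using e by (intro order_tendstoD(2)) auto
    then show "\<forall>\<^sub>F i in sequentially. (\<integral>\<^sup>+x. ennreal \<bar>c * indicator U (x + h i) - c * indicator U x\<bar> \<partial>lborel) \<le> ennreal e"
      by (auto elim: eventually_mono)
  qed
  then show "\<forall>\<^sub>F h in nhds 0. (\<integral>\<^sup>+x. ennreal \<bar>c * indicator U (x + h) - c * indicator U x\<bar> \<partial>lborel) \<le> ennreal e"
    by simp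
qed

lemma integrable_imp_L1_continuous:
  assumes "integrable lborel (f :: real \<Rightarrow> real)"
  shows "L1_continuous f"
  using assms
proof (induction rule: integrable_induct)
  case (base A c)
  then have A [measurable]: "A \<in> sets borel" by simp
  show ?case
  proof (rule L1_continuous_approx)
    fix e :: real assume e: "0 < e"
    \<comment> \<open>The 1 in the denominator covers \<open>c = 0\<close>.\<close>
    then have e': "0 < e / (\<bar>c\<bar> + 1)" by simp
    obtain U where U: "open U" "A \<subseteq> U" "emeasure lborel (U - A) < ennreal (e / (\<bar>c\<bar> + 1))"
      using outer_regular_lborel[OF A e'] by blast
    have [measurable]: "U \<in> sets borel" using U by simp
    have "emeasure lborel U = emeasure lborel (U - A) + emeasure lborel A"
      using U by (subst plus_emeasure) (auto simp: Un_absorb2)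
    also have "\<dots> < \<infinity>"
      using U base by (auto simp: less_top[symmetric])
    finally have fin: "emeasure lborel U < \<infinity>" .
    have "(\<integral>\<^sup>+x. ennreal \<bar>indicator A x *\<^sub>R c - c * indicator U x\<bar> \<partial>lborel) = (\<integral>\<^sup>+x. ennreal \<bar>c\<bar> * indicator (U - A) x \<partial>lborel)"
      using U by (intro nn_integral_cong) (auto simp: indicator_def)
    also have "\<dots> = ennreal \<bar>c\<bar> * emeasure lborel (U - A)"
      by (simp add: nn_integral_cmult_indicator)
    also have "\<dots> \<le> ennreal \<bar>c\<bar> * ennreal (e / (\<bar>c\<bar> + 1))"
      using U by (intro mult_left_mono) auto
    also have "\<dots> = ennreal (\<bar>c\<bar> * (e / (\<bar>c\<bar> + 1)))"
      by (rule ennreal_mult[symmetric]) (use e in auto)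
    also have "\<dots> \<le> ennreal e"
      using e by (intro ennreal_leI) (simp add: field_simps)
    finally show "\<exists>g\<in>borel_measurable borel. L1_continuous g \<and> (\<integral>\<^sup>+x. ennreal \<bar>indicator A x *\<^sub>R c - g x\<bar> \<partial>lborel) \<le> ennreal e"
      using L1_continuous_indicator_open[OF U(1) fin, of c] by (intro bexI[of _ "\<lambda>x. c * indicator U x"]) auto
  qed measurable
next
  case (add f g)
  then show ?case by (intro L1_continuous_add) auto
next
  case (lim f s)
  have [measurable]: "f \<in> borel_measurable borel" "\<And>i. s i \<in> borel_measurable borel"
    using lim by auto
  show ?case
  proof (rule L1_continuous_approx)
    fix e :: real assume e: "0 < e"
    have "(\<lambda>i. \<integral>\<^sup>+x. ennreal \<bar>f x - s i x\<bar> \<partial>lborel) \<longlonglongrightarrow> (\<integral>\<^sup>+x. 0 \<partial>(lborel :: real measure))"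
    proof (rule nn_integral_dominated_convergence[where w="\<lambda>x. ennreal (3 * \<bar>f x\<bar>)"])
      show "AE x in lborel. ennreal \<bar>f x - s i x\<bar> \<le> ennreal (3 * \<bar>f x\<bar>)" for i
      proof (rule AE_I2)
        fix x
        have "\<bar>s i x\<bar> \<le> 2 * \<bar>f x\<bar>" using lim(3)[of x i] by simp
        then show "ennreal \<bar>f x - s i x\<bar> \<le> ennreal (3 * \<bar>f x\<bar>)" by (intro ennreal_leI) linarith
      qed
      have "integrable lborel (\<lambda>x. 3 * \<bar>f x\<bar>)" using lim by auto
      then show "(\<integral>\<^sup>+x. ennreal (3 * \<bar>f x\<bar>) \<partial>lborel) < \<infinity>"
        unfolding integrable_iff_bounded by (simp add: abs_mult)
      show "AE x in lborel. (\<lambda>i. ennreal \<bar>f x - s i x\<bar>) \<longlonglongrightarrow> 0"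
      proof (rule AE_I2)
        fix x
        have "(\<lambda>i. \<bar>f x - s i x\<bar>) \<longlonglongrightarrow> \<bar>f x - f x\<bar>"
          using lim(2)[of x] by (intro tendsto_intros) auto
        then show "(\<lambda>i. ennreal \<bar>f x - s i x\<bar>) \<longlonglongrightarrow> 0"
          using tendsto_ennrealI[of "\<lambda>i. \<bar>f x - s i x\<bar>" 0] by simp
      qed
    qed measurable
    then have "\<forall>\<^sub>F i in sequentially. (\<integral>\<^sup>+x. ennreal \<bar>f x - s i x\<bar> \<partial>lborel) < ennreal e"
      using e by (intro order_tendstoD(2)) auto
    then obtain i where "(\<integral>\<^sup>+x. ennreal \<bar>f x - s i x\<bar> \<partial>lborel) < ennreal e"
      by (auto simp: eventually_sequentially)
    then show "\<exists>g\<in>borel_measurable borel. L1_continuous g \<and> (\<integral>\<^sup>+x. ennreal \<bar>f x - g x\<bar> \<partial>lborel) \<le> ennreal e"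
      using lim(5) by (intro bexI[of _ "s i"]) auto
  qed measurable
qed

text \<open>Truncation at a large height changes \<open>f\<close> little in Lp. For the truncated
  function the p-th power of a difference is at most a constant times the difference itself, and
  bounded support makes it integrable, so the L1 result applies.\<close>

lemma Lp_continuous:
  fixes f :: "real \<Rightarrow> real"
  assumes [measurable]: "f \<in> borel_measurable borel" and p: "1 \<le> p"
    and fin: "(\<integral>\<^sup>+x. ennreal (\<bar>f x\<bar> powr p) \<partial>lborel) < \<infinity>"
    and supp: "\<And>x. x \<notin> {0..1} \<Longrightarrow> f x = 0"
    and e: "0 < e"
  shows "\<forall>\<^sub>F h in nhds 0. (\<integral>\<^sup>+x. ennreal (\<bar>f (x + h) - f x\<bar> powr p) \<partial>lborel) \<le> ennreal (e powr p)"
proof -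
  define t where "t k x = max (- real k) (min (real k) (f x))" for k :: nat and x
  have [measurable]: "t k \<in> borel_measurable borel" for k
    unfolding t_def by measurable
  have t_bd: "\<bar>t k x\<bar> \<le> real k" "\<bar>f x - t k x\<bar> \<le> \<bar>f x\<bar>" for k x
    by (auto simp: t_def max_def min_def abs_if)
  have "(\<lambda>k. \<integral>\<^sup>+x. ennreal (\<bar>f x - t k x\<bar> powr p) \<partial>lborel) \<longlonglongrightarrow> (\<integral>\<^sup>+x. 0 \<partial>(lborel :: real measure))"
  proof (rule nn_integral_dominated_convergence[where w="\<lambda>x. ennreal (\<bar>f x\<bar> powr p)"])
    show "AE x in lborel. ennreal (\<bar>f x - t k x\<bar> powr p) \<le> ennreal (\<bar>f x\<bar> powr p)" for k
      using p t_bd by (intro AE_I2 ennreal_leI powr_mono2) auto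
    show "AE x in lborel. (\<lambda>k. ennreal (\<bar>f x - t k x\<bar> powr p)) \<longlonglongrightarrow> 0"
    proof (rule AE_I2)
      fix x
      obtain K :: nat where K: "\<bar>f x\<bar> \<le> real K" using real_arch_simple by blast
      have "t k x = f x" if "K \<le> k" for k
        using K that by (auto simp: t_def max_def min_def)
      then show "(\<lambda>k. ennreal (\<bar>f x - t k x\<bar> powr p)) \<longlonglongrightarrow> 0"
        using p by (intro tendsto_eventually eventually_sequentiallyI[of K]) simp
    qed
  qed (use fin in auto)
  then have "\<forall>\<^sub>F k in sequentially. (\<integral>\<^sup>+x. ennreal (\<bar>f x - t k x\<bar> powr p) \<partial>lborel) < ennreal ((e / 3) powr p)"
    using e by (intro order_tendstoD(2)) auto
  then obtain k where k: "(\<integral>\<^sup>+x. ennreal (\<bar>f x - t k x\<bar> powr p) \<partial>lborel) \<le> ennreal ((e / 3) powr p)"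
    by (auto simp: eventually_sequentially intro: less_imp_le)
  \<comment> \<open>Truncated values differ by at most 2 k; the extra 1 keeps \<open>c\<close>
    positive for \<open>k = 0\<close>.\<close>
  define c where "c = (2 * real k + 1) powr (p - 1)"
  have c: "0 < c" by (simp add: c_def)
  have "integrable lborel (t k)"
  proof (rule Bochner_Integration.integrable_bound)
    show "integrable lborel (\<lambda>x. real k * indicator {0..1::real} x :: real)" by simp
    show "AE x in lborel. norm (t k x) \<le> norm (real k * indicator {0..1} x :: real)"
      using t_bd(1) supp by (intro AE_I2) (auto simp: indicator_def t_def)
  qed measurable
  then have "L1_continuous (t k)" by (rule integrable_imp_L1_continuous)
  then have "\<forall>\<^sub>F h in nhds 0. (\<integral>\<^sup>+x. ennreal \<bar>t k (x + h) - t k x\<bar> \<partial>lborel) \<le> ennreal ((e / 3) powr p / c)"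
    using e c by (simp add: L1_continuous_def)
  then show ?thesis
  proof eventually_elim
    case (elim h)
    have "(\<integral>\<^sup>+x. ennreal (\<bar>t k (x + h) - t k x\<bar> powr p) \<partial>lborel) \<le> (\<integral>\<^sup>+x. ennreal c * ennreal \<bar>t k (x + h) - t k x\<bar> \<partial>lborel)"
    proof (intro nn_integral_mono)
      fix x
      have "\<bar>t k (x + h) - t k x\<bar> \<le> 2 * real k + 1"
        using t_bd(1)[of k x] t_bd(1)[of k "x + h"] by linarith
      then have "\<bar>t k (x + h) - t k x\<bar> powr (p - 1) \<le> c"
        unfolding c_def using p by (intro powr_mono2) auto
      then have "\<bar>t k (x + h) - t k x\<bar> powr (p - 1) * \<bar>t k (x + h) - t k x\<bar> \<le> c * \<bar>t k (x + h) - t k x\<bar>"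
        by (rule mult_right_mono) simp
      also have "\<bar>t k (x + h) - t k x\<bar> powr (p - 1) * \<bar>t k (x + h) - t k x\<bar> = \<bar>t k (x + h) - t k x\<bar> powr p"
        by (cases "t k (x + h) = t k x") (simp_all add: powr_diff)
      finally show "ennreal (\<bar>t k (x + h) - t k x\<bar> powr p) \<le> ennreal c * ennreal \<bar>t k (x + h) - t k x\<bar>"
        using c by (simp add: ennreal_leI flip: ennreal_mult)
    qed
    also have "\<dots> = ennreal c * (\<integral>\<^sup>+x. ennreal \<bar>t k (x + h) - t k x\<bar> \<partial>lborel)"
      by (rule nn_integral_cmult) measurable
    also have "\<dots> \<le> ennreal c * ennreal ((e / 3) powr p / c)"
      by (intro mult_left_mono elim) simp
    also have "\<dots> = ennreal ((e / 3) powr p)"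
      using c by (simp flip: ennreal_mult)
    finally have 1: "(\<integral>\<^sup>+x. ennreal (\<bar>t k (x + h) - t k x\<bar> powr p) \<partial>lborel) \<le> ennreal ((e / 3) powr p)" .
    have 2: "(\<integral>\<^sup>+x. ennreal (\<bar>f (x + h) - t k (x + h)\<bar> powr p) \<partial>lborel) \<le> ennreal ((e / 3) powr p)"
      using k nn_integral_shift[of "\<lambda>x. ennreal (\<bar>f x - t k x\<bar> powr p)" h] by simp
    have 3: "(\<integral>\<^sup>+x. ennreal (\<bar>t k x - f x\<bar> powr p) \<partial>lborel) \<le> ennreal ((e / 3) powr p)"
      using k by (simp add: abs_minus_commute)
    have "(\<integral>\<^sup>+x. ennreal (\<bar>(f (x + h) - t k (x + h)) + (t k (x + h) - t k x) + (t k x - f x)\<bar> powr p) \<partial>lborel)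
        \<le> ennreal ((e / 3 + e / 3 + e / 3) powr p)"
      using p e by (intro Lp_triangle 1 2 3) auto
    then show ?case by simp
  qed
qed

section \<open>Lebesgue measurable functions and their Borel versions\<close>

text \<open>The norms see functions only up to null sets, while the product measure arguments use
  Borel measurability. This exchange serves \<open>f\<close>, the fixed points and the scaling
  functions alike.\<close>

lemma borel_version:
  fixes f :: "real \<Rightarrow> real"
  assumes "f \<in> borel_measurable (lebesgue_on {0..1})"
  obtains F where "F \<in> borel_measurable borel" "AE x in lborel. x \<in> {0..1} \<longrightarrow> f x = F x"
proof -
  have "(\<lambda>x. indicator {0..1} x *\<^sub>R f x) \<in> borel_measurable lebesgue"
    using assms by (subst borel_measurable_restrict_space_iff[symmetric]) auto
  then obtain F where "F \<in> borel_measurable lborel" "AE x in lborel. indicator {0..1} x *\<^sub>R f x = F x"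
    using completion_ex_borel_measurable_real by blast
  then show thesis
    by (intro that[of F]) (auto elim!: eventually_mono split: split_indicator_asm)
qed

lemma nn_integral_lebesgue_on:
  assumes "A \<in> sets borel"
  shows "(\<integral>\<^sup>+x. f x \<partial>lebesgue_on A) = (\<integral>\<^sup>+x. f x * indicator A x \<partial>lborel)"
  using assms by (subst nn_integral_restrict_space) (auto simp: nn_integral_completion)

lemma AE_lebesgue_on_iff:
  assumes "A \<in> sets borel"
  shows "(AE x in lebesgue_on A. P x) \<longleftrightarrow> (AE x in lborel. x \<in> A \<longrightarrow> P x)"
  using assms by (subst AE_restrict_space_iff) (auto simp: AE_completion_iff)

lemma nn_integral_unit_eq_Icc:
  assumes [measurable]: "f \<in> borel_measurable borel"
  shows "(\<integral>\<^sup>+x. f x \<partial>\<U>) = (\<integral>\<^sup>+x. f x * indicator {0..1} x \<partial>lborel)"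
  unfolding nn_integral_unit_measure[OF assms] using AE_lborel_singleton[of 1]
  by (intro nn_integral_cong_AE) (auto simp: indicator_def)

text \<open>\<open>P\<close> need not be a measurable predicate, so the substitution is made in a
  Borel null set that contains the exceptions.\<close>

lemma AE_lborel_affine:
  fixes P :: "real \<Rightarrow> bool"
  assumes c: "c \<noteq> 0" and P: "AE x in lborel. P x"
  shows "AE x in lborel. P (t + c * x)"
proof -
  obtain N where N: "N \<in> null_sets lborel" "{x. \<not> P x} \<subseteq> N"
  proof -
    from AE_E[OF P] obtain N where "{x \<in> space lborel. \<not> P x} \<subseteq> N" "emeasure lborel N = 0" "N \<in> sets lborel" .
    then show thesis by (intro that[of N] null_setsI) simp_all
  qed
  have "AE x in lborel. x \<notin> N" using N(1) by (rule AE_not_in)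
  then have "AE x in lborel. t + c * x \<notin> N"
    using N(1) c by (intro AE_borel_affine[of c "\<lambda>x. x \<notin> N" t]) auto
  then show ?thesis by (rule eventually_mono) (use N(2) in blast)
qed

lemma Lpnorm_eq:
  assumes "A \<in> sets borel" "g \<in> borel_measurable (lebesgue_on A)"
  shows "Lpnorm p A g = enn2real (\<integral>\<^sup>+x. ennreal (\<bar>g x\<bar> powr p) * indicator A x \<partial>lborel) powr (1 / p)"
  unfolding Lpnorm_def using assms
  by (subst integral_eq_nn_integral) (auto simp: nn_integral_lebesgue_on)

lemma Lpnorm_eq_borel:
  assumes "g \<in> borel_measurable (lebesgue_on {0..1})" and [measurable]: "G \<in> borel_measurable borel"
    and "AE x in lborel. x \<in> {0..1} \<longrightarrow> g x = G x"
  shows "Lpnorm p {0..1} g = enn2real (\<integral>\<^sup>+x. ennreal (\<bar>G x\<bar> powr p) \<partial>\<U>) powr (1 / p)"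
proof -
  have "(\<integral>\<^sup>+x. ennreal (\<bar>g x\<bar> powr p) * indicator {0..1} x \<partial>lborel) = (\<integral>\<^sup>+x. ennreal (\<bar>G x\<bar> powr p) * indicator {0..1} x \<partial>lborel)"
    using assms(3) by (intro nn_integral_cong_AE) (auto elim!: eventually_mono simp: indicator_def)
  then show ?thesis
    using assms by (simp add: Lpnorm_eq nn_integral_unit_eq_Icc)
qed

lemma memLp_borel:
  assumes "memLp p {0..1} g" and [measurable]: "G \<in> borel_measurable borel"
    and "AE x in lborel. x \<in> {0..1} \<longrightarrow> g x = G x"
  shows "(\<integral>\<^sup>+x. ennreal (\<bar>G x\<bar> powr p) \<partial>\<U>) < \<infinity>"
proof -
  have "(\<integral>\<^sup>+x. ennreal (\<bar>G x\<bar> powr p) \<partial>\<U>) = (\<integral>\<^sup>+x. ennreal (\<bar>g x\<bar> powr p) * indicator {0..1} x \<partial>lborel)"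
    using assms(3) by (simp add: nn_integral_unit_eq_Icc) (intro nn_integral_cong_AE, auto elim!: eventually_mono simp: indicator_def)
  also have "\<dots> = (\<integral>\<^sup>+x. ennreal (\<bar>g x\<bar> powr p) \<partial>lebesgue_on {0..1})"
    by (simp add: nn_integral_lebesgue_on)
  also have "\<dots> < \<infinity>"
    using assms(1) by (auto simp: memLp_def integrable_iff_bounded)
  finally show ?thesis .
qed

lemma integrable_unit_measure_Lp:
  assumes [measurable]: "F \<in> borel_measurable borel" and p: "1 \<le> p"
    and fin: "(\<integral>\<^sup>+x. ennreal (\<bar>F x\<bar> powr p) \<partial>\<U>) < \<infinity>"
  shows "integrable \<U> F"
proof (rule integrableI_bounded)
  have "(\<integral>\<^sup>+x. ennreal (norm (F x)) \<partial>\<U>) \<le> (\<integral>\<^sup>+x. 1 + ennreal (\<bar>F x\<bar> powr p) \<partial>\<U>)"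
  proof (intro nn_integral_mono)
    fix x
    have "\<bar>F x\<bar> \<le> \<bar>F x\<bar> powr p / p + (1 - 1 / p)"
      using p by (intro powr_add_div_le) auto
    also have "\<dots> \<le> \<bar>F x\<bar> powr p / 1 + 1"
      using p by (intro add_mono divide_left_mono) auto
    finally have "ennreal \<bar>F x\<bar> \<le> ennreal (1 + \<bar>F x\<bar> powr p)" by (intro ennreal_leI) simp
    then show "ennreal (norm (F x)) \<le> 1 + ennreal (\<bar>F x\<bar> powr p)" by simp
  qed
  also have "\<dots> = 1 + (\<integral>\<^sup>+x. ennreal (\<bar>F x\<bar> powr p) \<partial>\<U>)"
    using unit_measure.emeasure_space_1 by (simp add: nn_integral_add)
  also have "\<dots> < \<infinity>" using fin by simp
  finally show "(\<integral>\<^sup>+x. ennreal (norm (F x)) \<partial>\<U>) < \<infinity>" .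
qed measurable

text \<open>The two kernels agree for arguments below 1, and under the integral both the point
  \<open>s = 1\<close> and the difference of \<open>f\<close> and \<open>F\<close> are negligible.
  Hence the identity holds at every \<open>x < 1\<close>, not just almost everywhere.\<close>

lemma MKZ_eq_mkz_op:
  assumes n: "1 \<le> n" and x: "0 \<le> x" "x < 1"
    and f: "f \<in> borel_measurable (lebesgue_on {0..1})" and [measurable]: "F \<in> borel_measurable borel"
    and ae: "AE y in lborel. y \<in> {0..1} \<longrightarrow> f y = F y"
  shows "MKZ n f x = mkz_op n F x"
proof -
  have H: "Hker n x \<in> borel_measurable borel"
    unfolding Hker_def[abs_def] by measurable
  have H': "g \<in> borel_measurable (lebesgue_on {0..1})" if "g \<in> borel_measurable borel" for g :: "real \<Rightarrow> real"
    using that by (intro measurable_restrict_space1 measurable_completion) auto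
  have "MKZ n f x = (\<integral>s. Hker n x s * F s \<partial>lebesgue_on {0..1})"
    unfolding MKZ_def
  proof (rule integral_cong_AE)
    show "AE s in lebesgue_on {0..1}. Hker n x s * f s = Hker n x s * F s"
      using ae by (subst AE_lebesgue_on_iff) (auto elim!: eventually_mono)
  qed (rule borel_measurable_times[OF H'[OF H] f], rule borel_measurable_times[OF H'[OF H] H'[OF assms(5)]])
  also have "\<dots> = (\<integral>s. indicator {0..1} s *\<^sub>R (Hker n x s * F s) \<partial>lebesgue)"
    by (rule integral_restrict_space) auto
  also have "\<dots> = (\<integral>s. indicator {0..1} s *\<^sub>R (Hker n x s * F s) \<partial>lborel)"
    using H by (intro integral_completion) auto
  also have "\<dots> = (\<integral>s. indicator {0..<1} s *\<^sub>R (enn2real (mkz_kernel n x s) * F s) \<partial>lborel)"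
  proof (rule integral_cong_AE)
    have "indicator {0..1} s *\<^sub>R (Hker n x s * F s) = indicator {0..<1} s *\<^sub>R (enn2real (mkz_kernel n x s) * F s)" if "s \<noteq> 1" for s
      using mkz_kernel_eq_Hker[OF n x, of s] that by (auto simp: indicator_def)
    then show "AE s in lborel. indicator {0..1} s *\<^sub>R (Hker n x s * F s) = indicator {0..<1} s *\<^sub>R (enn2real (mkz_kernel n x s) * F s)"
      using AE_lborel_singleton[of 1] by (auto elim!: eventually_mono)
  qed (use H in measurable)
  also have "\<dots> = mkz_op n F x"
  proof -
    have eq: "\<U> = density lborel (\<lambda>s. ennreal (indicator {0..<1} s))"
      unfolding unit_measure_def by (intro arg_cong2[where f=density]) (auto simp: fun_eq_iff indicator_def)
    show ?thesis
      unfolding mkz_op_def eq by (subst integral_density) auto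
  qed
  finally show ?thesis .
qed

section \<open>Translation differences and the modulus\<close>

lemma shift_difference_measurable:
  fixes f :: "real \<Rightarrow> real"
  assumes "f \<in> borel_measurable (lebesgue_on {0..1})" "0 \<le> h"
  shows "(\<lambda>x. f (x + h) - f x) \<in> borel_measurable (lebesgue_on {0..1 - h})"
proof -
  let ?f = "\<lambda>x. indicator {0..1} x *\<^sub>R f x"
  have f: "?f \<in> borel_measurable lebesgue"
    using assms by (subst borel_measurable_restrict_space_iff[symmetric]) auto
  \<comment> \<open>A Lebesgue measurable function composed with a Borel map need not be measurable;
    a translation, however, is measurable for the Lebesgue sets on both sides.\<close>
  have "(\<lambda>x. h + 1 * x) \<in> lebesgue \<rightarrow>\<^sub>M lebesgue"
    using lebesgue_affine_measurable[where c="\<lambda>x::real. 1" and t=h] by simp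
  then have "(\<lambda>x. ?f (h + 1 * x)) \<in> borel_measurable lebesgue"
    by (rule measurable_compose[OF _ f])
  then have "(\<lambda>x. indicator {0..1 - h} x *\<^sub>R (?f (h + 1 * x) - ?f x)) \<in> borel_measurable lebesgue"
    by (intro borel_measurable_scaleR[OF _ borel_measurable_diff[OF _ f]] borel_measurable_indicator) auto
  also have "(\<lambda>x. indicator {0..1 - h} x *\<^sub>R (?f (h + 1 * x) - ?f x)) = (\<lambda>x. indicator {0..1 - h} x *\<^sub>R (f (x + h) - f x))"
    using assms(2) by (auto simp: fun_eq_iff indicator_def add.commute)
  finally show ?thesis
    by (subst borel_measurable_restrict_space_iff) auto
qed

text \<open>The p-th power of the norm inside \<open>omega1p\<close>, kept in \<open>ennreal\<close>
  because \<open>Lpnorm\<close> cannot tell an infinite integral from 0.\<close>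

definition shift_energy :: "real \<Rightarrow> (real \<Rightarrow> real) \<Rightarrow> real \<Rightarrow> ennreal"
  where "shift_energy p F h = (\<integral>\<^sup>+x. ennreal (\<bar>F (x + h) - F x\<bar> powr p) * indicator {0..1 - h} x \<partial>lborel)"

lemma Lpnorm_shift_difference:
  assumes f: "f \<in> borel_measurable (lebesgue_on {0..1})" and [measurable]: "F \<in> borel_measurable borel"
    and ae: "AE x in lborel. x \<in> {0..1} \<longrightarrow> f x = F x" and h: "0 \<le> h"
  shows "Lpnorm p {0..1 - h} (\<lambda>x. f (x + h) - f x) = enn2real (shift_energy p F h) powr (1 / p)"
proof -
  have "AE x in lborel. h + 1 * x \<in> {0..1} \<longrightarrow> f (h + 1 * x) = F (h + 1 * x)"
    by (rule AE_lborel_affine[OF _ ae]) simp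
  with ae have "AE x in lborel. ennreal (\<bar>f (x + h) - f x\<bar> powr p) * indicator {0..1 - h} x
      = ennreal (\<bar>F (x + h) - F x\<bar> powr p) * indicator {0..1 - h} x"
    by eventually_elim (use h in \<open>auto simp: indicator_def add.commute\<close>)
  then have "(\<integral>\<^sup>+x. ennreal (\<bar>f (x + h) - f x\<bar> powr p) * indicator {0..1 - h} x \<partial>lborel) = shift_energy p F h"
    unfolding shift_energy_def by (rule nn_integral_cong_AE)
  then show ?thesis
    using Lpnorm_eq[OF _ shift_difference_measurable[OF f h], of p] by simp
qed

text \<open>Minkowski's inequality for \<open>F (x + h)\<close> and \<open>- F x\<close>, both cut
  off to \<open>{0..1 - h}\<close> so that each argument stays in the unit interval.\<close>

lemma shift_energy_le:
  assumes [measurable]: "F \<in> borel_measurable borel" and p: "1 \<le> p" and h: "0 \<le> h" and c: "0 \<le> c"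
    and F: "(\<integral>\<^sup>+x. ennreal (\<bar>F x\<bar> powr p) \<partial>\<U>) \<le> ennreal (c powr p)"
  shows "shift_energy p F h \<le> ennreal ((2 * c) powr p)"
proof -
  have F': "(\<integral>\<^sup>+x. ennreal (\<bar>F x\<bar> powr p) * indicator {0..1} x \<partial>lborel) \<le> ennreal (c powr p)"
    using F by (simp add: nn_integral_unit_eq_Icc)
  have "(\<integral>\<^sup>+x. ennreal (\<bar>indicator {0..1 - h} x * F (x + h)\<bar> powr p) \<partial>lborel)
     \<le> (\<integral>\<^sup>+x. ennreal (\<bar>F (x + h)\<bar> powr p) * indicator {0..1} (x + h) \<partial>lborel)"
    using h p by (intro nn_integral_mono) (auto simp: indicator_def)
  also have "\<dots> = (\<integral>\<^sup>+x. ennreal (\<bar>F x\<bar> powr p) * indicator {0..1} x \<partial>lborel)"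
    by (rule nn_integral_shift[of "\<lambda>x. ennreal (\<bar>F x\<bar> powr p) * indicator {0..1} x"]) measurable
  also note F'
  finally have 1: "(\<integral>\<^sup>+x. ennreal (\<bar>indicator {0..1 - h} x * F (x + h)\<bar> powr p) \<partial>lborel) \<le> ennreal (c powr p)" .
  have "(\<integral>\<^sup>+x. ennreal (\<bar>- (indicator {0..1 - h} x * F x)\<bar> powr p) \<partial>lborel)
     \<le> (\<integral>\<^sup>+x. ennreal (\<bar>F x\<bar> powr p) * indicator {0..1} x \<partial>lborel)"
    using h p by (intro nn_integral_mono) (auto simp: indicator_def)
  also note F'
  finally have 2: "(\<integral>\<^sup>+x. ennreal (\<bar>- (indicator {0..1 - h} x * F x)\<bar> powr p) \<partial>lborel) \<le> ennreal (c powr p)" .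
  have "shift_energy p F h = (\<integral>\<^sup>+x. ennreal (\<bar>indicator {0..1 - h} x * F (x + h) + - (indicator {0..1 - h} x * F x)\<bar> powr p) \<partial>lborel)"
    unfolding shift_energy_def using p by (intro nn_integral_cong) (auto simp: indicator_def)
  also have "\<dots> \<le> ennreal ((c + c) powr p)"
    by (intro Lp_triangle 1 2 p c) measurable
  finally show ?thesis by simp
qed

lemma ennreal_enn2real_root_powr:
  assumes "1 \<le> p" "X < \<infinity>"
  shows "ennreal ((enn2real X powr (1 / p)) powr p) = X"
  using assms by (simp add: powr_powr)

text \<open>Pairs an Lp function with a Borel version; used for \<open>f\<close> and once more for
  the fixed point.\<close>

locale Lp_function =
  fixes p :: real and f F :: "real \<Rightarrow> real"
  assumes p: "1 \<le> p" and mem: "memLp p {0..1} f"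
    and F_meas [measurable]: "F \<in> borel_measurable borel"
    and f_eq_F: "AE x in lborel. x \<in> {0..1} \<longrightarrow> f x = F x"
begin

lemma f_meas: "f \<in> borel_measurable (lebesgue_on {0..1})"
  using mem by (simp add: memLp_def)

lemma F_finite: "(\<integral>\<^sup>+x. ennreal (\<bar>F x\<bar> powr p) \<partial>\<U>) < \<infinity>"
  by (rule memLp_borel[OF mem F_meas f_eq_F])

lemma Lpnorm_f: "ennreal (Lpnorm p {0..1} f powr p) = (\<integral>\<^sup>+x. ennreal (\<bar>F x\<bar> powr p) \<partial>\<U>)"
  unfolding Lpnorm_eq_borel[OF f_meas F_meas f_eq_F] by (rule ennreal_enn2real_root_powr[OF p F_finite])

lemma Lpnorm_nonneg: "0 \<le> Lpnorm p A g"
  by (simp add: Lpnorm_def)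

lemma shift_energy_bounded:
  assumes "0 \<le> h"
  shows "shift_energy p F h \<le> ennreal ((2 * Lpnorm p {0..1} f) powr p)"
  by (rule shift_energy_le) (use p assms Lpnorm_nonneg Lpnorm_f in auto)

lemma shift_energy_eq:
  assumes "0 \<le> h"
  shows "shift_energy p F h = ennreal (Lpnorm p {0..1 - h} (\<lambda>x. f (x + h) - f x) powr p)"
  unfolding Lpnorm_shift_difference[OF f_meas F_meas f_eq_F assms]
  using p le_less_trans[OF shift_energy_bounded[OF assms] ennreal_less_top]
  by (intro ennreal_enn2real_root_powr[symmetric]) auto

lemma Lpnorm_shift_le_iff:
  assumes "0 \<le> h" "0 \<le> c"
  shows "Lpnorm p {0..1 - h} (\<lambda>x. f (x + h) - f x) \<le> c \<longleftrightarrow> shift_energy p F h \<le> ennreal (c powr p)"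
proof
  show "Lpnorm p {0..1 - h} (\<lambda>x. f (x + h) - f x) \<le> c \<Longrightarrow> shift_energy p F h \<le> ennreal (c powr p)"
    unfolding shift_energy_eq[OF assms(1)] using p Lpnorm_nonneg by (intro ennreal_leI powr_mono2) auto
  assume "shift_energy p F h \<le> ennreal (c powr p)"
  then have "Lpnorm p {0..1 - h} (\<lambda>x. f (x + h) - f x) powr p \<le> c powr p"
    unfolding shift_energy_eq[OF assms(1)] by (subst (asm) ennreal_le_iff) auto
  then show "Lpnorm p {0..1 - h} (\<lambda>x. f (x + h) - f x) \<le> c"
    using powr_less_mono2[of p c "Lpnorm p {0..1 - h} (\<lambda>x. f (x + h) - f x)"] p assms by force
qed

text \<open>A supremum of reals is an upper bound only for a bounded family;
  \<open>shift_energy_bounded\<close> supplies the bound, twice the norm of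
  \<open>f\<close>.\<close>

lemma Lpnorm_shift_le_omega:
  assumes "0 < h" "h \<le> t"
  shows "Lpnorm p {0..1 - h} (\<lambda>x. f (x + h) - f x) \<le> omega1p p f t"
  unfolding omega1p_def
proof (rule cSUP_upper)
  show "bdd_above ((\<lambda>h. Lpnorm p {0..1 - h} (\<lambda>x. f (x + h) - f x)) ` {0<..t})"
  proof (rule bdd_aboveI2)
    fix h assume "h \<in> {0<..t}"
    then show "Lpnorm p {0..1 - h} (\<lambda>x. f (x + h) - f x) \<le> 2 * Lpnorm p {0..1} f"
      using shift_energy_bounded[of h] Lpnorm_nonneg by (subst Lpnorm_shift_le_iff) auto
  qed
qed (use assms in auto)

lemma omega_nonneg: "0 < t \<Longrightarrow> 0 \<le> omega1p p f t"
  using Lpnorm_shift_le_omega[of t t] Lpnorm_nonneg order_trans by blast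

lemma shift_energy_le_omega:
  assumes "0 < h" "h \<le> t"
  shows "shift_energy p F h \<le> ennreal (omega1p p f t powr p)"
  using Lpnorm_shift_le_iff[of h "omega1p p f t"] Lpnorm_shift_le_omega[OF assms] omega_nonneg[of t] assms by simp

lemma omega_le:
  assumes t: "0 < t" and c: "0 \<le> c" and le: "\<And>h. 0 < h \<Longrightarrow> h \<le> t \<Longrightarrow> shift_energy p F h \<le> ennreal (c powr p)"
  shows "omega1p p f t \<le> c"
  unfolding omega1p_def
proof (rule cSUP_least)
  fix h assume "h \<in> {0<..t}"
  then show "Lpnorm p {0..1 - h} (\<lambda>x. f (x + h) - f x) \<le> c"
    using le c by (subst Lpnorm_shift_le_iff) auto
qed (use t in auto)

text \<open>For \<open>x\<close> in \<open>{0..1 - h}\<close> both \<open>x\<close> and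
  \<open>x + h\<close> lie in the unit interval, so extending \<open>F\<close> by 0 can only enlarge
  the integral, and continuity of translation on the line applies.\<close>

lemma omega_tendsto_0: "(\<lambda>n. omega1p p f (1 / sqrt (real n))) \<longlonglongrightarrow> 0"
proof (rule LIMSEQ_I)
  fix e :: real assume e: "0 < e"
  let ?G = "\<lambda>x. F x * indicator {0..1} x"
  have "(\<integral>\<^sup>+x. ennreal (\<bar>?G x\<bar> powr p) \<partial>lborel) = (\<integral>\<^sup>+x. ennreal (\<bar>F x\<bar> powr p) \<partial>\<U>)"
    using p by (simp add: nn_integral_unit_eq_Icc) (intro nn_integral_cong, auto simp: indicator_def)
  then have "\<forall>\<^sub>F h in nhds 0. (\<integral>\<^sup>+x. ennreal (\<bar>?G (x + h) - ?G x\<bar> powr p) \<partial>lborel) \<le> ennreal ((e / 2) powr p)"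
    using p e F_finite by (intro Lp_continuous) auto
  then obtain d where d: "0 < d" "\<And>h. \<bar>h\<bar> < d \<Longrightarrow> (\<integral>\<^sup>+x. ennreal (\<bar>?G (x + h) - ?G x\<bar> powr p) \<partial>lborel) \<le> ennreal ((e / 2) powr p)"
    by (auto simp: eventually_nhds_metric dist_real_def)
  have le: "omega1p p f t \<le> e / 2" if t: "0 < t" "t < d" for t
  proof (rule omega_le)
    fix h assume h: "0 < h" "h \<le> t"
    have "shift_energy p F h \<le> (\<integral>\<^sup>+x. ennreal (\<bar>?G (x + h) - ?G x\<bar> powr p) \<partial>lborel)"
      unfolding shift_energy_def using h by (intro nn_integral_mono) (auto simp: indicator_def)
    also have "\<dots> \<le> ennreal ((e / 2) powr p)" using h t by (intro d) auto
    finally show "shift_energy p F h \<le> ennreal ((e / 2) powr p)" .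
  qed (use t e in auto)
  have "(\<lambda>n. 1 / sqrt (real n)) \<longlonglongrightarrow> 0" by real_asymp
  then have "\<forall>\<^sub>F n in sequentially. 1 / sqrt (real n) < d"
    using d by (intro order_tendstoD(2)) auto
  then obtain n0 where n0: "\<And>n. n0 \<le> n \<Longrightarrow> 1 / sqrt (real n) < d"
    by (auto simp: eventually_sequentially)
  show "\<exists>n0. \<forall>n\<ge>n0. norm (omega1p p f (1 / sqrt (real n)) - 0) < e"
  proof (intro exI allI impI)
    \<comment> \<open>For \<open>n = 0\<close> the range of shifts is empty because
      \<open>1 / sqrt 0 = 0\<close>; starting at 1 avoids that meaningless supremum.\<close>
    fix n assume n: "max n0 1 \<le> n"
    then have "0 < 1 / sqrt (real n)" by simp
    then show "norm (omega1p p f (1 / sqrt (real n)) - 0) < e"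
      using le[of "1 / sqrt (real n)"] n0[of n] omega_nonneg[of "1 / sqrt (real n)"] n e by simp
  qed
qed

lemma MKZ_error:
  assumes n: "1 \<le> n"
  shows "(\<integral>\<^sup>+x. ennreal (\<bar>mkz_op n F x - F x\<bar> powr p) \<partial>\<U>) \<le> ennreal ((300 * omega1p p f (1 / sqrt n)) powr p)"
proof (rule mkz_op_error[OF n p])
  show "integrable \<U> F" by (rule integrable_unit_measure_Lp[OF F_meas p F_finite])
  show "0 \<le> omega1p p f (1 / sqrt n)" using n by (intro omega_nonneg) simp
qed (use shift_energy_le_omega in \<open>simp add: shift_energy_def\<close>)

end

section \<open>The fixed point equation\<close>

lemma knots_mono:
  fixes xs :: "nat \<Rightarrow> real"
  assumes "\<forall>i<N. xs i < xs (Suc i)" "i \<le> j" "j \<le> N"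
  shows "xs i \<le> xs j"
  using assms(2,3)
proof (induction j rule: dec_induct)
  case (step k)
  then show ?case using assms(1) by (force dest: spec[of _ k])
qed simp

lemma nn_integral_affine_piece:
  assumes [measurable]: "f \<in> borel_measurable borel" and a: "0 < a"
  shows "(\<integral>\<^sup>+x. f ((x - b) / a) * indicator {b..<a + b} x \<partial>lborel) = ennreal a * (\<integral>\<^sup>+y. f y \<partial>\<U>)"
proof -
  have "(\<integral>\<^sup>+x. f ((x - b) / a) * indicator {b..<a + b} x \<partial>lborel)
     = ennreal \<bar>a\<bar> * (\<integral>\<^sup>+y. f ((b + a * y - b) / a) * indicator {b..<a + b} (b + a * y) \<partial>lborel)"
    using a by (intro nn_integral_real_affine) auto
  also have "(\<lambda>y. f ((b + a * y - b) / a) * indicator {b..<a + b} (b + a * y)) = (\<lambda>y. f y * indicator {0..<1} y)"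
    using a by (auto simp: fun_eq_iff indicator_def mult_less_cancel_left1 zero_le_mult_iff)
  finally show ?thesis using a by (simp add: nn_integral_unit_measure)
qed

text \<open>The half-open pieces are disjoint, so the p-th power of the sum is the sum of the p-th
  powers, without Minkowski's inequality. Substitution contributes the length \<open>a i\<close> of
  each piece, which gives exactly the p-th power of \<Lambda>.\<close>

lemma ifs_contraction:
  fixes A :: "nat \<Rightarrow> real \<Rightarrow> real" and xs a b L :: "nat \<Rightarrow> real"
  assumes p: "1 \<le> p" and [measurable]: "\<And>i. A i \<in> borel_measurable borel" "R \<in> borel_measurable borel" 
    and xs: "\<forall>i<N. xs i < xs (Suc i)"
    and ab: "\<And>i. i \<in> {1..N} \<Longrightarrow> 0 < a i \<and> b i = xs (i - 1) \<and> a i + b i = xs i"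
    and L: "\<And>i. i \<in> {1..N} \<Longrightarrow> 0 \<le> L i" "\<And>i. i \<in> {1..N} \<Longrightarrow> AE y in \<U>. \<bar>A i y\<bar> \<le> L i"
    and D: "AE x in lborel. x \<in> {0..<1} \<longrightarrow>
       D x = (\<Sum>i=1..N. A i ((x - b i) / a i) * R ((x - b i) / a i) * indicator {xs (i - 1)..<xs i} x)"
  and [measurable]: "D \<in> borel_measurable borel"
  shows "(\<integral>\<^sup>+x. ennreal (\<bar>D x\<bar> powr p) \<partial>\<U>) \<le> ennreal (\<Sum>i=1..N. a i * L i powr p) * (\<integral>\<^sup>+y. ennreal (\<bar>R y\<bar> powr p) \<partial>\<U>)"
proof -
  let ?J = "\<lambda>i. {b i..<a i + b i}"
  let ?T = "\<lambda>i x. A i ((x - b i) / a i) * R ((x - b i) / a i)"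
  have disj: "x \<notin> ?J j" if "i \<in> {1..N}" "j \<in> {1..N}" "i \<noteq> j" "x \<in> ?J i" for i j x
  proof -
    have "x \<notin> ?J j \<and> y \<notin> ?J i" if "i \<in> {1..N}" "j \<in> {1..N}" "i < j" "x \<in> ?J i" "y \<in> ?J j" for i j x y
    proof -
      have "xs i \<le> xs (j - 1)" using that by (intro knots_mono[OF xs]) auto
      then show ?thesis using that ab[of i] ab[of j] by auto
    qed
    from this[of i j x x] this[of j i x x] show ?thesis using that by (cases i j rule: linorder_cases) auto
  qed
  have pt: "ennreal (\<bar>\<Sum>i=1..N. ?T i x * indicator (?J i) x\<bar> powr p)
      \<le> (\<Sum>i=1..N. ennreal (\<bar>?T i x\<bar> powr p) * indicator (?J i) x)" for x
  proof (cases "\<exists>i\<in>{1..N}. x \<in> ?J i")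
    case True
    then obtain i where i: "i \<in> {1..N}" "x \<in> ?J i" by auto
    have "(\<Sum>j=1..N. ?T j x * indicator (?J j) x) = (\<Sum>j\<in>{i}. ?T j x * indicator (?J j) x)"
      using i disj[of i _ x] by (intro sum.mono_neutral_right) (auto simp: indicator_def)
    also have "\<dots> = ?T i x * indicator (?J i) x"
      by (simp only: sum.insert finite.emptyI empty_iff not_False_eq_True sum.empty add_0_right)
    also have "\<dots> = ?T i x" using i by simp
    finally have "ennreal (\<bar>\<Sum>j=1..N. ?T j x * indicator (?J j) x\<bar> powr p) = ennreal (\<bar>?T i x\<bar> powr p) * indicator (?J i) x"
      using i by (simp only: indicator_simps mult_1_right)
    also have "\<dots> \<le> (\<Sum>i=1..N. ennreal (\<bar>?T i x\<bar> powr p) * indicator (?J i) x)"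
      using i by (intro member_le_sum[of i "{1..N}" "\<lambda>i. ennreal (\<bar>?T i x\<bar> powr p) * indicator (?J i) x"]) auto
    finally show ?thesis .
  next
    case False
    then have "(\<Sum>i=1..N. ?T i x * indicator (?J i) x) = 0" by (intro sum.neutral) auto
    then show ?thesis by (simp only:) simp
  qed
  have "(\<integral>\<^sup>+x. ennreal (\<bar>D x\<bar> powr p) \<partial>\<U>) = (\<integral>\<^sup>+x. ennreal (\<bar>D x\<bar> powr p) * indicator {0..<1} x \<partial>lborel)"
    by (rule nn_integral_unit_measure) measurable
  also have "\<dots> \<le> (\<integral>\<^sup>+x. (\<Sum>i=1..N. ennreal (\<bar>?T i x\<bar> powr p) * indicator (?J i) x) \<partial>lborel)"
  proof (rule nn_integral_mono_AE)
    have J: "{xs (i - 1)..<xs i} = ?J i" if "i \<in> {1..N}" for i using ab[OF that] by metis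
    show "AE x in lborel. ennreal (\<bar>D x\<bar> powr p) * indicator {0..<1} x \<le> (\<Sum>i=1..N. ennreal (\<bar>?T i x\<bar> powr p) * indicator (?J i) x)"
      using D
    proof (rule eventually_mono)
      fix x assume Dx: "x \<in> {0..<1} \<longrightarrow> D x = (\<Sum>i=1..N. ?T i x * indicator {xs (i - 1)..<xs i} x)"
      have "(\<Sum>i=1..N. ?T i x * indicator {xs (i - 1)..<xs i} x) = (\<Sum>i=1..N. ?T i x * indicator (?J i) x)"
        by (intro sum.cong refl) (simp only: J)
      with Dx pt[of x] show "ennreal (\<bar>D x\<bar> powr p) * indicator {0..<1} x \<le> (\<Sum>i=1..N. ennreal (\<bar>?T i x\<bar> powr p) * indicator (?J i) x)"
        by (cases "x \<in> {0..<1}") (simp_all only: indicator_simps mult_1_right mult_zero_right zero_le simp_thms)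
    qed
  qed
  also have "\<dots> = (\<Sum>i=1..N. \<integral>\<^sup>+x. ennreal (\<bar>?T i x\<bar> powr p) * indicator (?J i) x \<partial>lborel)"
    by (rule nn_integral_sum) measurable
  also have "\<dots> \<le> (\<Sum>i=1..N. ennreal (a i * L i powr p) * (\<integral>\<^sup>+y. ennreal (\<bar>R y\<bar> powr p) \<partial>\<U>))"
  proof (rule sum_mono)
    fix i assume i: "i \<in> {1..N}"
    then have a: "0 < a i" using ab by auto
    have "(\<integral>\<^sup>+x. ennreal (\<bar>?T i x\<bar> powr p) * indicator (?J i) x \<partial>lborel) = ennreal (a i) * (\<integral>\<^sup>+y. ennreal (\<bar>A i y * R y\<bar> powr p) \<partial>\<U>)"
      using nn_integral_affine_piece[of "\<lambda>y. ennreal (\<bar>A i y * R y\<bar> powr p)" "a i" "b i"] a by simp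
    also have "\<dots> \<le> ennreal (a i) * (\<integral>\<^sup>+y. ennreal (L i powr p) * ennreal (\<bar>R y\<bar> powr p) \<partial>\<U>)"
    proof (intro mult_left_mono nn_integral_mono_AE)
      show "AE y in \<U>. ennreal (\<bar>A i y * R y\<bar> powr p) \<le> ennreal (L i powr p) * ennreal (\<bar>R y\<bar> powr p)"
        using L(2)[OF i]
      proof eventually_elim
        case (elim y)
        then have "\<bar>A i y\<bar> powr p \<le> L i powr p" using p by (intro powr_mono2) auto
        then show ?case
          by (simp add: abs_mult powr_mult ennreal_mult mult_right_mono ennreal_leI)
      qed
    qed simp
    also have "\<dots> = ennreal (a i * L i powr p) * (\<integral>\<^sup>+y. ennreal (\<bar>R y\<bar> powr p) \<partial>\<U>)"
      using a by (simp add: nn_integral_cmult ennreal_mult mult.assoc)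
    finally show "(\<integral>\<^sup>+x. ennreal (\<bar>?T i x\<bar> powr p) * indicator (?J i) x \<partial>lborel) \<le> \<dots>" .
  qed
  also have "\<dots> = ennreal (\<Sum>i=1..N. a i * L i powr p) * (\<integral>\<^sup>+y. ennreal (\<bar>R y\<bar> powr p) \<partial>\<U>)"
    unfolding sum_distrib_right[symmetric] using ab[THEN conjunct1, THEN less_imp_le]
    by (subst sum_ennreal) (auto intro!: mult_nonneg_nonneg)
  finally show ?thesis .
qed

text \<open>The essential supremum is nonnegative because the interval has positive measure, and
  finite by hypothesis, so \<open>real_of_ereal\<close> loses nothing.\<close>

lemma Linfnorm_bound:
  assumes "memLinf {0..1} \<alpha>"
  shows "0 \<le> Linfnorm {0..1} \<alpha>" "AE x in lborel. x \<in> {0..1} \<longrightarrow> \<bar>\<alpha> x\<bar> \<le> Linfnorm {0..1} \<alpha>"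
proof -
  let ?M = "lebesgue_on {0..1::real}" and ?f = "\<lambda>x. ereal \<bar>\<alpha> x\<bar>"
  have "esssup ?M (\<lambda>x. 0 :: ereal) = 0"
    by (rule esssup_const) (simp add: emeasure_restrict_space)
  moreover have "?f \<in> borel_measurable ?M"
    using assms by (auto simp: memLinf_def)
  then have "esssup ?M (\<lambda>x. 0 :: ereal) \<le> esssup ?M ?f"
    by (intro esssup_mono) auto
  ultimately have nonneg: "0 \<le> esssup ?M ?f" by simp
  then show "0 \<le> Linfnorm {0..1} \<alpha>" unfolding Linfnorm_def by (rule real_of_ereal_pos)
  have "\<bar>esssup ?M ?f\<bar> \<noteq> \<infinity>"
    using nonneg assms by (auto simp: memLinf_def)
  then have eq: "esssup ?M ?f = ereal (Linfnorm {0..1} \<alpha>)"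
    by (simp add: Linfnorm_def ereal_real)
  have "AE x in ?M. ?f x \<le> esssup ?M ?f" by (rule esssup_AE)
  then show "AE x in lborel. x \<in> {0..1} \<longrightarrow> \<bar>\<alpha> x\<bar> \<le> Linfnorm {0..1} \<alpha>"
    unfolding eq by (simp add: AE_lebesgue_on_iff)
qed

text \<open>Null sets are pulled back through finitely many inverse affine maps, written with slope
  \<open>1 / a i\<close>.\<close>

lemma AE_ball_finite_affine:
  assumes "finite I" "\<And>i. i \<in> I \<Longrightarrow> 0 < (a i :: real)" "\<And>i. i \<in> I \<Longrightarrow> AE y in lborel. P i y"
  shows "AE x in lborel. \<forall>i\<in>I. P i ((x - b i) / a i)"
proof -
  have "AE x in lborel. P i ((x - b i) / a i)" if "i \<in> I" for i
  proof -
    have "AE x in lborel. P i (- b i / a i + 1 / a i * x)"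
      by (rule AE_lborel_affine) (use assms that in force)+
    then show ?thesis by (simp add: diff_divide_distrib)
  qed
  then show ?thesis
    using assms(1) by (simp add: AE_ball_countable countable_finite)
qed

lemma (in Lp_function) fractal_error:
  fixes xs a b :: "nat \<Rightarrow> real" and \<alpha> :: "nat \<Rightarrow> real \<Rightarrow> real" and g :: "real \<Rightarrow> real"
  assumes n: "1 \<le> n"
    and xs: "\<forall>i<N. xs i < xs (Suc i)"
    and ab: "\<forall>i\<in>{1..N}. a i * 0 + b i = xs (i - 1) \<and> a i * 1 + b i = xs i"
    and \<alpha>: "\<forall>i\<in>{1..N}. memLinf {0..1} (\<alpha> i)"
    and g: "memLp p {0..1} g"
    and eq: "AE x in lebesgue_on {0..1}. g x = f x + (\<Sum>i=1..N. \<alpha> i ((x - b i) / a i) *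
       (g ((x - b i) / a i) - MKZ n f ((x - b i) / a i)) * indicator ((\<lambda>t. a i * t + b i) ` {0..1}) x)"
  defines "\<Lambda> \<equiv> (\<Sum>i=1..N. a i * Linfnorm {0..1} (\<alpha> i) powr p) powr (1 / p)"
  assumes \<Lambda>: "\<Lambda> < 1"
  shows "Lpnorm p {0..1} (\<lambda>x. g x - f x) \<le> 300 * (\<Lambda> / (1 - \<Lambda>)) * omega1p p f (1 / sqrt n)"
proof -
  let ?w = "omega1p p f (1 / sqrt n)"
  define L where "L i = Linfnorm {0..1} (\<alpha> i)" for i
  define S where "S = (\<Sum>i=1..N. a i * L i powr p)"
  have w: "0 \<le> ?w" using n by (intro omega_nonneg) simp
  have ab': "0 < a i \<and> b i = xs (i - 1) \<and> a i + b i = xs i" if i: "i \<in> {1..N}" for i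
  proof -
    have "xs (i - 1) < xs i" using xs[rule_format, of "i - 1"] i by auto
    then show ?thesis using ab i by force
  qed
  have g_meas: "g \<in> borel_measurable (lebesgue_on {0..1})" using g by (simp add: memLp_def)
  obtain G where G [measurable]: "G \<in> borel_measurable borel" and g_eq: "AE x in lborel. x \<in> {0..1} \<longrightarrow> g x = G x"
    using borel_version[OF g_meas] .
  interpret G: Lp_function p g G by unfold_locales (use p g g_eq in auto)
  \<comment> \<open>The index condition stands inside the existential, with 0 as default, so that
    the chosen \<open>A i\<close> is measurable for every \<open>i\<close>.\<close>
  have "\<exists>B. B \<in> borel_measurable borel \<and> (i \<in> {1..N} \<longrightarrow> (AE x in lborel. x \<in> {0..1} \<longrightarrow> \<alpha> i x = B x))" for i
  proof (cases "i \<in> {1..N}")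
    case True
    then have "\<alpha> i \<in> borel_measurable (lebesgue_on {0..1})" using \<alpha> by (auto simp: memLinf_def)
    then show ?thesis using borel_version by metis
  qed (auto intro!: exI[of _ "\<lambda>_. 0"])
  then obtain A where A [measurable]: "\<And>i. A i \<in> borel_measurable borel"
    and \<alpha>_eq: "\<And>i. i \<in> {1..N} \<Longrightarrow> AE x in lborel. x \<in> {0..1} \<longrightarrow> \<alpha> i x = A i x"
    by metis
  define M where "M = mkz_op n F"
  have M [measurable]: "M \<in> borel_measurable borel" unfolding M_def by measurable
  define D where "D x = G x - F x" for x
  have D_meas [measurable]: "D \<in> borel_measurable borel" unfolding D_def[abs_def] by measurable
  have AL: "AE y in \<U>. \<bar>A i y\<bar> \<le> L i" if i: "i \<in> {1..N}" for i
  proof -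
    have "memLinf {0..1} (\<alpha> i)" using \<alpha> i by auto
    from Linfnorm_bound(2)[OF this] \<alpha>_eq[OF i]
    have "AE y in lborel. y \<in> {0..<1} \<longrightarrow> \<bar>A i y\<bar> \<le> L i"
      by eventually_elim (auto simp: L_def)
    then show ?thesis
      unfolding unit_measure_def by (subst AE_density) (auto elim!: eventually_mono simp: indicator_def)
  qed
  have L: "0 \<le> L i" if "i \<in> {1..N}" for i
    using Linfnorm_bound(1) \<alpha> that by (auto simp: L_def)
  have S: "0 \<le> S"
    unfolding S_def using ab' by (intro sum_nonneg mult_nonneg_nonneg) (auto intro: less_imp_le)
  have \<Lambda>_eq: "\<Lambda> = S powr (1 / p)" by (simp add: \<Lambda>_def S_def L_def)
  have D: "AE x in lborel. x \<in> {0..<1} \<longrightarrow>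
      D x = (\<Sum>i=1..N. A i ((x - b i) / a i) * (G ((x - b i) / a i) - M ((x - b i) / a i)) * indicator {xs (i - 1)..<xs i} x)"
  proof -
    have 1: "AE x in lborel. \<forall>i\<in>{1..N}. (x - b i) / a i \<in> {0..1} \<longrightarrow> \<alpha> i ((x - b i) / a i) = A i ((x - b i) / a i)"
      by (rule AE_ball_finite_affine) (use ab' \<alpha>_eq in auto)
    have 2: "AE x in lborel. \<forall>i\<in>{1..N}. (x - b i) / a i \<in> {0..1} \<longrightarrow> g ((x - b i) / a i) = G ((x - b i) / a i)"
      by (rule AE_ball_finite_affine) (use ab' g_eq in auto)
    \<comment> \<open>Closed images of neighbouring maps share the knots. Off this finite set they
      may be replaced by the disjoint half-open pieces.\<close>
    have 3: "AE x in lborel. x \<notin> xs ` {0..N}"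
      by (intro AE_not_in finite_imp_null_set_lborel) simp
    have 4: "AE x in lborel. x \<in> {0..1} \<longrightarrow> g x = f x + (\<Sum>i=1..N. \<alpha> i ((x - b i) / a i) *
       (g ((x - b i) / a i) - MKZ n f ((x - b i) / a i)) * indicator ((\<lambda>t. a i * t + b i) ` {0..1}) x)"
      using eq by (simp add: AE_lebesgue_on_iff)
    from 1 2 3 4 f_eq_F g_eq show ?thesis
    proof eventually_elim
      case (elim x)
      have summand: "\<alpha> i ((x - b i) / a i) * (g ((x - b i) / a i) - MKZ n f ((x - b i) / a i)) * indicator ((\<lambda>t. a i * t + b i) ` {0..1}) x
        = A i ((x - b i) / a i) * (G ((x - b i) / a i) - M ((x - b i) / a i)) * indicator {xs (i - 1)..<xs i} x" if i: "i \<in> {1..N}" for i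
      proof -
        have a: "0 < a i" and b: "b i = xs (i - 1)" "a i + b i = xs i" using ab'[OF i] by auto
        have "(\<lambda>t. a i * t + b i) ` {0..1} = {b i..a i + b i}"
          using a by (subst image_affinity_atLeastAtMost) simp
        then have img: "(\<lambda>t. a i * t + b i) ` {0..1} = {xs (i - 1)..xs i}" using b by simp
        have "x \<noteq> xs i" using elim(3) i by auto
        show ?thesis
        proof (cases "x \<in> {xs (i - 1)..<xs i}")
          case True
          then have y: "0 \<le> (x - b i) / a i" "(x - b i) / a i < 1"
            using a b by (auto simp: divide_less_eq)
          \<comment> \<open>Valid at every argument below 1, so no exceptional set for
            \<open>MKZ\<close> has to be pulled back.\<close>
          have "MKZ n f ((x - b i) / a i) = M ((x - b i) / a i)"
            unfolding M_def by (rule MKZ_eq_mkz_op[OF n y f_meas F_meas f_eq_F])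
          moreover have "\<alpha> i ((x - b i) / a i) = A i ((x - b i) / a i)" "g ((x - b i) / a i) = G ((x - b i) / a i)"
            using elim(1,2) i y by auto
          ultimately show ?thesis using True by (simp add: img)
        next
          case False
          then have "x \<notin> {xs (i - 1)..xs i}" using \<open>x \<noteq> xs i\<close> by auto
          then show ?thesis using False by (simp add: img)
        qed
      qed
      show ?case
      proof
        assume "x \<in> {0..<1}"
        then have x: "x \<in> {0..1}" by auto
        have "D x = g x - f x" using elim(5,6) x by (simp add: D_def)
        also have "\<dots> = (\<Sum>i=1..N. \<alpha> i ((x - b i) / a i) *
            (g ((x - b i) / a i) - MKZ n f ((x - b i) / a i)) * indicator ((\<lambda>t. a i * t + b i) ` {0..1}) x)"
          using elim(4) x by simp
        also have "\<dots> = (\<Sum>i=1..N. A i ((x - b i) / a i) * (G ((x - b i) / a i) - M ((x - b i) / a i)) * indicator {xs (i - 1)..<xs i} x)"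
          by (rule sum.cong[OF refl summand])
        finally show "D x = \<dots>" .
      qed
    qed
  qed
  define d where "d = Lpnorm p {0..1} (\<lambda>x. g x - f x)"
  have d_nonneg: "0 \<le> d" unfolding d_def by (rule Lpnorm_nonneg)
  have d_eq: "ennreal (d powr p) = (\<integral>\<^sup>+x. ennreal (\<bar>D x\<bar> powr p) \<partial>\<U>)"
  proof -
    have "(\<integral>\<^sup>+x. ennreal (\<bar>G x + - F x\<bar> powr p) \<partial>\<U>) \<le> ennreal ((Lpnorm p {0..1} g + Lpnorm p {0..1} f) powr p)"
      using Lpnorm_f G.Lpnorm_f Lpnorm_nonneg p by (intro Lp_triangle) auto
    \<comment> \<open>Finiteness is required before the root in \<open>Lpnorm\<close> can be undone:
      for an infinite integral \<open>d\<close> would be 0.\<close>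
    then have fin: "(\<integral>\<^sup>+x. ennreal (\<bar>D x\<bar> powr p) \<partial>\<U>) < \<infinity>"
      by (auto simp: D_def intro: le_less_trans)
    have "d = enn2real (\<integral>\<^sup>+x. ennreal (\<bar>D x\<bar> powr p) \<partial>\<U>) powr (1 / p)"
      unfolding d_def
    proof (rule Lpnorm_eq_borel)
      show "(\<lambda>x. g x - f x) \<in> borel_measurable (lebesgue_on {0..1})"
        using f_meas g_meas by simp
      show "AE x in lborel. x \<in> {0..1} \<longrightarrow> g x - f x = D x"
        using f_eq_F g_eq by eventually_elim (auto simp: D_def)
    qed measurable
    then show ?thesis using ennreal_enn2real_root_powr[OF p fin] by simp
  qed
  have R: "(\<integral>\<^sup>+x. ennreal (\<bar>G x - M x\<bar> powr p) \<partial>\<U>) \<le> ennreal ((d + 300 * ?w) powr p)"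
  proof -
    have 1: "(\<integral>\<^sup>+x. ennreal (\<bar>F x - M x\<bar> powr p) \<partial>\<U>) \<le> ennreal ((300 * ?w) powr p)"
      using MKZ_error[OF n] by (simp add: M_def abs_minus_commute)
    have "(\<integral>\<^sup>+x. ennreal (\<bar>D x + (F x - M x)\<bar> powr p) \<partial>\<U>) \<le> ennreal ((d + 300 * ?w) powr p)"
      using w d_nonneg d_eq p by (intro Lp_triangle 1) auto
    then show ?thesis by (simp add: D_def)
  qed
  have "ennreal (d powr p) \<le> ennreal S * (\<integral>\<^sup>+x. ennreal (\<bar>G x - M x\<bar> powr p) \<partial>\<U>)"
    unfolding d_eq S_def by (rule ifs_contraction[OF p A _ xs ab' L AL D D_meas]) measurable
  also have "\<dots> \<le> ennreal S * ennreal ((d + 300 * ?w) powr p)"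
    by (intro mult_left_mono R) simp
  also have "\<dots> = ennreal (S * (d + 300 * ?w) powr p)"
    using S by (simp add: ennreal_mult)
  finally have "d powr p \<le> S * (d + 300 * ?w) powr p"
    using S by simp
  then have "(d powr p) powr (1 / p) \<le> (S * (d + 300 * ?w) powr p) powr (1 / p)"
    using p by (intro powr_mono2) auto
  then have "d \<le> \<Lambda> * (d + 300 * ?w)"
    using p d_nonneg w by (simp add: powr_mult powr_powr \<Lambda>_eq)
  \<comment> \<open>\<open>d\<close> is a real number, so \<Lambda> d may be moved to the left;
    division by 1 - \<Lambda> > 0 follows.\<close>
  then have "d * (1 - \<Lambda>) \<le> 300 * \<Lambda> * ?w" by (simp add: algebra_simps)
  then have "d \<le> 300 * \<Lambda> * ?w / (1 - \<Lambda>)"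
    using \<Lambda> by (simp add: pos_le_divide_eq)
  then show ?thesis by (simp add: d_def)
qed

text \<open>The constant is chosen before all other data, \<open>p\<close> included. The estimate
  starts at \<open>n = 1\<close>, since for \<open>n = 0\<close> the modulus would be a supremum
  over an empty set.\<close>

theorem theorem6p3:
  shows "\<exists>C>0. \<forall>(p::real) (N::nat) (xs::nat \<Rightarrow> real) (a::nat \<Rightarrow> real) (b::nat \<Rightarrow> real)
            (\<alpha>::nat \<Rightarrow> real \<Rightarrow> real) (f::real \<Rightarrow> real) (g::nat \<Rightarrow> real \<Rightarrow> real).
     1 \<le> p \<and> 1 \<le> N \<and> xs 0 = 0 \<and> xs N = 1 \<and> (\<forall>i<N. xs i < xs (Suc i)) \<and>
     (\<forall>i\<in>{1..N}. a i * 0 + b i = xs (i - 1) \<and> a i * 1 + b i = xs i) \<and>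
     (\<forall>i\<in>{1..N}. memLinf {0..1} (\<alpha> i)) \<and>
     (\<Sum>i=1..N. a i * Linfnorm {0..1} (\<alpha> i) powr p) powr (1 / p) < 1 \<and>
     memLp p {0..1} f \<and>
     (\<forall>n\<ge>1. memLp p {0..1} (g n) \<and>
        (AE x in lebesgue_on {0..1}.
           g n x = f x + (\<Sum>i=1..N. \<alpha> i ((x - b i) / a i) *
                     (g n ((x - b i) / a i) - MKZ n f ((x - b i) / a i)) *
                     indicator ((\<lambda>t. a i * t + b i) ` {0..1}) x)))
     \<longrightarrow>
     ((\<lambda>n. Lpnorm p {0..1} (\<lambda>x. g n x - f x)) \<longlonglongrightarrow> 0) \<and>
     (\<forall>n\<ge>1. Lpnorm p {0..1} (\<lambda>x. g n x - f x) \<le>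
        C * ((\<Sum>i=1..N. a i * Linfnorm {0..1} (\<alpha> i) powr p) powr (1 / p) /
             (1 - (\<Sum>i=1..N. a i * Linfnorm {0..1} (\<alpha> i) powr p) powr (1 / p)))
          * omega1p p f (1 / sqrt (real n)))"
proof (intro exI[of _ 300] conjI allI impI; (elim conjE)?)
  fix p :: real and N :: nat and xs a b :: "nat \<Rightarrow> real" and \<alpha> :: "nat \<Rightarrow> real \<Rightarrow> real"
    and f :: "real \<Rightarrow> real" and g :: "nat \<Rightarrow> real \<Rightarrow> real"
  let ?\<Lambda> = "(\<Sum>i=1..N. a i * Linfnorm {0..1} (\<alpha> i) powr p) powr (1 / p)"
  assume p: "1 \<le> p" and xs: "\<forall>i<N. xs i < xs (Suc i)"
    and ab: "\<forall>i\<in>{1..N}. a i * 0 + b i = xs (i - 1) \<and> a i * 1 + b i = xs i"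
    and \<alpha>: "\<forall>i\<in>{1..N}. memLinf {0..1} (\<alpha> i)" and \<Lambda>: "?\<Lambda> < 1" and f: "memLp p {0..1} f"
    and g: "\<forall>n\<ge>1. memLp p {0..1} (g n) \<and>
        (AE x in lebesgue_on {0..1}.
           g n x = f x + (\<Sum>i=1..N. \<alpha> i ((x - b i) / a i) *
                     (g n ((x - b i) / a i) - MKZ n f ((x - b i) / a i)) *
                     indicator ((\<lambda>t. a i * t + b i) ` {0..1}) x))"
  have "f \<in> borel_measurable (lebesgue_on {0..1})" using f by (simp add: memLp_def)
  then obtain F where F: "F \<in> borel_measurable borel" "AE x in lborel. x \<in> {0..1} \<longrightarrow> f x = F x"
    using borel_version by blast
  then interpret Lp_function p f F
    using p f by unfold_locales
  have bound: "Lpnorm p {0..1} (\<lambda>x. g n x - f x) \<le> 300 * (?\<Lambda> / (1 - ?\<Lambda>)) * omega1p p f (1 / sqrt (real n))" if "1 \<le> n" for n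
    using g that by (intro fractal_error[OF that xs ab \<alpha> _ _ \<Lambda>]) auto
  then show "Lpnorm p {0..1} (\<lambda>x. g n x - f x) \<le> 300 * (?\<Lambda> / (1 - ?\<Lambda>)) * omega1p p f (1 / sqrt (real n))" if "1 \<le> n" for n
    using that .
  have "(\<lambda>n. 300 * (?\<Lambda> / (1 - ?\<Lambda>)) * omega1p p f (1 / sqrt (real n))) \<longlonglongrightarrow> 300 * (?\<Lambda> / (1 - ?\<Lambda>)) * 0"
    by (intro tendsto_mult_left omega_tendsto_0)
  then have lim: "(\<lambda>n. 300 * (?\<Lambda> / (1 - ?\<Lambda>)) * omega1p p f (1 / sqrt (real n))) \<longlonglongrightarrow> 0"
    by simp
  show "(\<lambda>n. Lpnorm p {0..1} (\<lambda>x. g n x - f x)) \<longlonglongrightarrow> 0"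
    \<comment> \<open>The bound holds from \<open>n = 1\<close> on, which suffices for the
      limit.\<close>
    by (rule tendsto_sandwich[OF _ _ tendsto_const lim])
       (use bound Lpnorm_nonneg in \<open>auto simp: eventually_sequentially intro!: exI[of _ 1]\<close>)
qed simp

end
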